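(* Consider the pricing problem of a commodity $k$, as defined in the context. For each $t\in\{1,\dots,|T|\}$ let $$\hat P^k_t=\{p_{t_1\dots t_2}:\ 1\le t_1\le t\le t_2\le |T|,\ p_{t_1\dots t_2}\text{ exists}\},$$ where $p_{t_1\dots t_2}$ is a path of lowest total cost for the interval $t_1,\dots,t_2$ (see the context). Then: (i) there is an optimal solution $(p_1,\dots,p_{|T|})$ of the pricing problem such that $p_t\in\hat P^k_t$ for every $t\in\{1,\dots,|T|\}$; (ii) all the paths $p_{t_1\dots t_2}$ can be computed in $O(|T|^2|E|\ln|E|)$ time, and an optimal path-sequence using at each time step $t$ only paths of $\hat P^k_t$, hence an optimal solution of the pricing problem, can be computed in total time $O(\max\{|T|^3,\ |T|^2|E|\ln|E|\})$.
   Context: **Setting.** The time steps are $1,\dots,|T|$. $V$ is a finite set of nodes and, for each time step $t$, $E_t$ is the finite set of arcs allowed at time step $t$ (all contained in a common arc set on $V$). A commodity $k$ has demand $d^k\ge 0$ and, at each time step $t$, an origin $O^k_t\in V$ and a destination $D^k_t\in V$. A path is valid for $k$ at time step $t$ if it goes from $O^k_t$ to $D^k_t$ and uses only arcs of $E_t$. It is assumed that a valid path exists at every time step. For every $t$ and $e\in E_t$ a number $u_{et}\le 0$ is given (the dual value of the capacity constraint of arc $e$ at time step $t$). The penalty for one path change is $\alpha> 0$. No initial path before time step $1$ is considered. **Pricing problem of commodity $k$.** A path-sequence is a tuple $s=(p_1,\dots,p_{|T|})$ where $p_t$ is a valid path for $k$ at time step $t$. Its number of path changes is $n_s=|\{t\in\{2,\dots,|T|\}: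 p_t\ne p_{t-1}\}|$. The problem is to find a path-sequence minimizing $$\alpha\, n_s-d^k\sum_{t=1}^{|T|}\sum_{e\in p_t}u_{et}.$$ **Paths $p_{t_1\dots t_2}$.** For $1\le t_1\le t_2\le|T|$, $p_{t_1\dots t_2}$ is a chosen path that is valid for $k$ at every time step $t_1,\dots,t_2$ (so in particular all its arcs lie in $\bigcap_{t=t_1}^{t_2}E_t$) and that minimizes $-d^k\sum_{t=t_1}^{t_2}\sum_{e\in p}u_{et}$ among all such paths $p$, if at least one such path exists. Otherwise $p_{t_1\dots t_2}$ does not exist. **Complexity conventions.** $|E|=\max_t|E_t|$. Running times count elementary operations, with arithmetic operations and comparisons on real numbers at unit cost. It is assumed that $|E|\ge 2$ and $|V|=O(|E|)$, so that one run of Dijkstra's algorithm takes $O(|E|\ln|E|)$ time. *)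

theory Defs
  imports Complex_Main "Graph_Theory.Arc_Walk"
begin

section \<open>The pricing problem\<close>

record ('v, 'a) pricing =
  graph :: "('v, 'a) pre_digraph"
  horizon :: nat
  allowed :: "nat \<Rightarrow> 'a set"
  dual :: "'a \<Rightarrow> nat \<Rightarrow> real"
  origin :: "nat \<Rightarrow> 'v"
  destination :: "nat \<Rightarrow> 'v"
  demand :: real
  penalty :: real

text \<open>
  A path is a pair of its first vertex and its list of arcs. The first vertex matters only for
  paths without arcs: trivial paths at different vertices are different paths.
\<close>

type_synonym ('v, 'a) path = "'v \<times> 'a awalk"

definition valid_path_at :: "('v, 'a) pricing \<Rightarrow> nat \<Rightarrow> ('v, 'a) path \<Rightarrow> bool" where
  "valid_path_at I t p \<longleftrightarrow>
     fst p = origin I t \<and>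
     pre_digraph.apath (graph I) (origin I t) (snd p) (destination I t) \<and>
     set (snd p) \<subseteq> allowed I t"

definition pricing_problem :: "('v, 'a) pricing \<Rightarrow> bool" where
  "pricing_problem I \<longleftrightarrow>
     fin_digraph (graph I) \<and>
     1 \<le> horizon I \<and>
     0 \<le> demand I \<and>
     0 < penalty I \<and>
     (\<forall>t\<in>{1..horizon I}.
        allowed I t \<subseteq> arcs (graph I) \<and>
        origin I t \<in> verts (graph I) \<and>
        destination I t \<in> verts (graph I) \<and>
        (\<forall>e\<in>allowed I t. dual I e t \<le> 0) \<and>
        (\<exists>p. valid_path_at I t p))"

definition path_sequence :: "('v, 'a) pricing \<Rightarrow> (nat \<Rightarrow> ('v, 'a) path) \<Rightarrow> bool" where
  "path_sequence I s \<longleftrightarrow> (\<forall>t\<in>{1..horizon I}. valid_path_at I t (s t))"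

definition path_changes :: "('v, 'a) pricing \<Rightarrow> (nat \<Rightarrow> ('v, 'a) path) \<Rightarrow> nat" where
  "path_changes I s = card {t \<in> {2..horizon I}. s t \<noteq> s (t - 1)}"

definition objective :: "('v, 'a) pricing \<Rightarrow> (nat \<Rightarrow> ('v, 'a) path) \<Rightarrow> real" where
  "objective I s =
     penalty I * real (path_changes I s)
     - demand I * (\<Sum>t = 1..horizon I. \<Sum>e\<in>set (snd (s t)). dual I e t)"

definition optimal_sequence :: "('v, 'a) pricing \<Rightarrow> (nat \<Rightarrow> ('v, 'a) path) \<Rightarrow> bool" where
  "optimal_sequence I s \<longleftrightarrow>
     path_sequence I s \<and> (\<forall>s'. path_sequence I s' \<longrightarrow> objective I s \<le> objective I s')"


section \<open>Paths of lowest total cost for an interval\<close>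

definition valid_path_on ::
    "('v, 'a) pricing \<Rightarrow> nat \<Rightarrow> nat \<Rightarrow> ('v, 'a) path \<Rightarrow> bool" where
  "valid_path_on I t1 t2 p \<longleftrightarrow> (\<forall>t\<in>{t1..t2}. valid_path_at I t p)"

definition interval_cost ::
    "('v, 'a) pricing \<Rightarrow> nat \<Rightarrow> nat \<Rightarrow> ('v, 'a) path \<Rightarrow> real" where
  "interval_cost I t1 t2 p = - demand I * (\<Sum>t = t1..t2. \<Sum>e\<in>set (snd p). dual I e t)"

definition lowest_cost_path ::
    "('v, 'a) pricing \<Rightarrow> nat \<Rightarrow> nat \<Rightarrow> ('v, 'a) path \<Rightarrow> bool" where
  "lowest_cost_path I t1 t2 p \<longleftrightarrow>
     valid_path_on I t1 t2 p \<and>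
     (\<forall>q. valid_path_on I t1 t2 q \<longrightarrow> interval_cost I t1 t2 p \<le> interval_cost I t1 t2 q)"

text \<open>
  A choice of all the paths \<open>p\<^bsub>t1...t2\<^esub>\<close>; \<^const>\<open>None\<close> means that the path does not exist.
\<close>

definition interval_paths ::
    "('v, 'a) pricing \<Rightarrow> (nat \<Rightarrow> nat \<Rightarrow> ('v, 'a) path option) \<Rightarrow> bool" where
  "interval_paths I P \<longleftrightarrow>
     (\<forall>t1 t2. 1 \<le> t1 \<and> t1 \<le> t2 \<and> t2 \<le> horizon I \<longrightarrow>
        (case P t1 t2 of
           None \<Rightarrow> \<not> (\<exists>p. valid_path_on I t1 t2 p)
         | Some p \<Rightarrow> lowest_cost_path I t1 t2 p))"

definition candidate_paths ::
    "('v, 'a) pricing \<Rightarrow> (nat \<Rightarrow> nat \<Rightarrow> ('v, 'a) path option) \<Rightarrow> nat \<Rightarrow> ('v, 'a) path set" where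
  "candidate_paths I P t =
     {p. \<exists>t1 t2. 1 \<le> t1 \<and> t1 \<le> t \<and> t \<le> t2 \<and> t2 \<le> horizon I \<and> P t1 t2 = Some p}"


section \<open>Machine model\<close>

text \<open>
  Programs of a real random access machine, with structured control flow. Memory consists of
  scalar registers and of unbounded arrays, holding natural numbers (used as indices) or reals.
  There is no conversion of reals to naturals and no multiplication of naturals, which at unit
  cost would make the machine unrealistically strong. Subtraction of
  naturals is truncated. The number of registers and arrays is fixed by the program.
\<close>

type_synonym name = string

datatype nexp =
    NNum nat
  | NReg name
  | NArr name nexp
  | NAdd nexp nexp
  | NSub nexp nexp

datatype rexp =
    RNum int
  | RReg name
  | RArr name nexp
  | RAdd rexp rexp
  | RSub rexp rexp
  | RMul rexp rexp

datatype bexp =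
    NEq nexp nexp
  | NLess nexp nexp
  | RLess rexp rexp
  | BNot bexp
  | BAnd bexp bexp

datatype com =
    Skip
  | SetNReg name nexp
  | SetNArr name nexp nexp
  | SetRReg name rexp
  | SetRArr name nexp rexp
  | Seq com com
  | Cond bexp com com
  | While bexp com

record state =
  nreg :: "name \<Rightarrow> nat"
  narr :: "name \<Rightarrow> nat \<Rightarrow> nat"
  rreg :: "name \<Rightarrow> real"
  rarr :: "name \<Rightarrow> nat \<Rightarrow> real"

primrec nval :: "nexp \<Rightarrow> state \<Rightarrow> nat" where
  "nval (NNum k) s = k"
| "nval (NReg x) s = nreg s x"
| "nval (NArr a i) s = narr s a (nval i s)"
| "nval (NAdd e f) s = nval e s + nval f s"
| "nval (NSub e f) s = nval e s - nval f s"

primrec rval :: "rexp \<Rightarrow> state \<Rightarrow> real" where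
  "rval (RNum k) s = of_int k"
| "rval (RReg x) s = rreg s x"
| "rval (RArr a i) s = rarr s a (nval i s)"
| "rval (RAdd e f) s = rval e s + rval f s"
| "rval (RSub e f) s = rval e s - rval f s"
| "rval (RMul e f) s = rval e s * rval f s"

primrec bval :: "bexp \<Rightarrow> state \<Rightarrow> bool" where
  "bval (NEq e f) s \<longleftrightarrow> nval e s = nval f s"
| "bval (NLess e f) s \<longleftrightarrow> nval e s < nval f s"
| "bval (RLess e f) s \<longleftrightarrow> rval e s < rval f s"
| "bval (BNot b) s \<longleftrightarrow> \<not> bval b s"
| "bval (BAnd b c) s \<longleftrightarrow> bval b s \<and> bval c s"

text \<open>Every memory access, constant, operation, comparison and assignment costs one step.\<close>

primrec ncost :: "nexp \<Rightarrow> nat" where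
  "ncost (NNum k) = 1"
| "ncost (NReg x) = 1"
| "ncost (NArr a i) = 1 + ncost i"
| "ncost (NAdd e f) = 1 + ncost e + ncost f"
| "ncost (NSub e f) = 1 + ncost e + ncost f"

primrec rcost :: "rexp \<Rightarrow> nat" where
  "rcost (RNum k) = 1"
| "rcost (RReg x) = 1"
| "rcost (RArr a i) = 1 + ncost i"
| "rcost (RAdd e f) = 1 + rcost e + rcost f"
| "rcost (RSub e f) = 1 + rcost e + rcost f"
| "rcost (RMul e f) = 1 + rcost e + rcost f"

primrec bcost :: "bexp \<Rightarrow> nat" where
  "bcost (NEq e f) = 1 + ncost e + ncost f"
| "bcost (NLess e f) = 1 + ncost e + ncost f"
| "bcost (RLess e f) = 1 + rcost e + rcost f"
| "bcost (BNot b) = 1 + bcost b"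
| "bcost (BAnd b c) = 1 + bcost b + bcost c"

text \<open>
  \<open>exec c s n s'\<close>: started in state \<open>s\<close>, the program \<open>c\<close> terminates in state \<open>s'\<close> after
  \<open>n\<close> elementary steps.
\<close>

inductive exec :: "com \<Rightarrow> state \<Rightarrow> nat \<Rightarrow> state \<Rightarrow> bool" where
  Skip: "exec Skip s 1 s"
| SetNReg: "exec (SetNReg x e) s (1 + ncost e) (s\<lparr>nreg := (nreg s)(x := nval e s)\<rparr>)"
| SetNArr: "exec (SetNArr a i e) s (1 + ncost i + ncost e)
    (s\<lparr>narr := (narr s)(a := (narr s a)(nval i s := nval e s))\<rparr>)"
| SetRReg: "exec (SetRReg x e) s (1 + rcost e) (s\<lparr>rreg := (rreg s)(x := rval e s)\<rparr>)"
| SetRArr: "exec (SetRArr a i e) s (1 + ncost i + rcost e)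
    (s\<lparr>rarr := (rarr s)(a := (rarr s a)(nval i s := rval e s))\<rparr>)"
| Seq: "exec c1 s m s' \<Longrightarrow> exec c2 s' n s'' \<Longrightarrow> exec (Seq c1 c2) s (m + n) s''"
| CondTrue: "bval b s \<Longrightarrow> exec c1 s n s' \<Longrightarrow> exec (Cond b c1 c2) s (1 + bcost b + n) s'"
| CondFalse: "\<not> bval b s \<Longrightarrow> exec c2 s n s' \<Longrightarrow> exec (Cond b c1 c2) s (1 + bcost b + n) s'"
| WhileFalse: "\<not> bval b s \<Longrightarrow> exec (While b c) s (1 + bcost b) s"
| WhileTrue: "bval b s \<Longrightarrow> exec c s m s' \<Longrightarrow> exec (While b c) s' n s'' \<Longrightarrow>
    exec (While b c) s (1 + bcost b + m + n) s''"

inductive_cases SkipE: "exec Skip s n s'"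
inductive_cases SetNRegE: "exec (SetNReg x e) s n s'"
inductive_cases SetNArrE: "exec (SetNArr a i e) s n s'"
inductive_cases SetRRegE: "exec (SetRReg x e) s n s'"
inductive_cases SetRArrE: "exec (SetRArr a i e) s n s'"
inductive_cases SeqE: "exec (Seq c1 c2) s n s'"
inductive_cases CondE: "exec (Cond b c1 c2) s n s'"
inductive_cases WhileE: "exec (While b c) s n s'"

lemma exec_deterministic:
  "exec c s n s' \<Longrightarrow> exec c s m t' \<Longrightarrow> m = n \<and> t' = s'"
proof (induction arbitrary: m t' rule: exec.induct)
  case (Skip s)
  then show ?case by (elim SkipE) simp
next
  case (SetNReg x e s)
  then show ?case by (elim SetNRegE) simp
next
  case (SetNArr a i e s)
  then show ?case by (elim SetNArrE) simp
next
  case (SetRReg x e s)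
  then show ?case by (elim SetRRegE) simp
next
  case (SetRArr a i e s)
  then show ?case by (elim SetRArrE) simp
next
  case (Seq c1 s m1 s1 c2 n1 s2)
  from Seq.prems show ?case
    by (rule SeqE) (use Seq.IH in blast)
next
  case (CondTrue b s c1 n s' c2)
  from CondTrue.prems show ?case
    by (rule CondE) (use CondTrue.hyps(1) CondTrue.IH in force)+
next
  case (CondFalse b s c2 n s' c1)
  from CondFalse.prems show ?case
    by (rule CondE) (use CondFalse.hyps(1) CondFalse.IH in force)+
next
  case (WhileFalse b s c)
  from WhileFalse.prems show ?case
    by (rule WhileE) (use WhileFalse.hyps in simp_all)
next
  case (WhileTrue b s c m1 s1 n1 s2)
  from WhileTrue.prems show ?case
  proof (rule WhileE)
    fix k s' l
    assume m: "m = Suc (bcost b + k + l)"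
      and body: "exec c s k s'" and rest: "exec (While b c) s' l t'"
    have "k = m1" "s' = s1" using WhileTrue.IH(1) [OF body] by simp_all
    moreover have "l = n1" "t' = s2"
      using WhileTrue.IH(2) [of l t'] rest \<open>s' = s1\<close> by simp_all
    ultimately show ?thesis using m by simp
  qed (use WhileTrue.hyps(1) in simp)
qed


section \<open>Encoding of instances and of results\<close>

text \<open>
  On the machine, vertices and arcs are numbered from 0. The sets of allowed arcs are given as
  lists \<open>es 1, ..., es T\<close> in an arbitrary order.
\<close>

definition encoding :: "(nat, nat) pricing \<Rightarrow> (nat \<Rightarrow> nat list) \<Rightarrow> bool" where
  "encoding I es \<longleftrightarrow>
     verts (graph I) = {..<card (verts (graph I))} \<and>
     arcs (graph I) = {..<card (arcs (graph I))} \<and>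
     (\<forall>t\<in>{1..horizon I}. distinct (es t) \<and> set (es t) = allowed I t)"

definition array_of :: "'x::zero list \<Rightarrow> nat \<Rightarrow> 'x" where
  "array_of xs i = (if i < length xs then xs ! i else 0)"

text \<open>
  The lists \<open>es t\<close> are stored one after the other in \<open>''arc''\<close>: the list \<open>es t\<close> occupies the
  positions from \<open>''first'' t\<close> up to, but not including, \<open>''first'' (t + 1)\<close>. The array \<open>''dual''\<close>
  holds at the same positions the numbers \<open>u\<^bsub>et\<^esub>\<close>. All other memory cells are 0.
\<close>

definition initial_state :: "(nat, nat) pricing \<Rightarrow> (nat \<Rightarrow> nat list) \<Rightarrow> state" where
  "initial_state I es =
     (let G = graph I; T = horizon I in
      \<lparr> nreg = (\<lambda>_. 0)
          (''T'' := T,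
           ''V'' := card (verts G),
           ''A'' := card (arcs G)),
        narr = (\<lambda>_ _. 0)
          (''tail'' := array_of (map (tail G) [0..<card (arcs G)]),
           ''head'' := array_of (map (head G) [0..<card (arcs G)]),
           ''origin'' := (\<lambda>t. if t \<in> {1..T} then origin I t else 0),
           ''destination'' := (\<lambda>t. if t \<in> {1..T} then destination I t else 0),
           ''first'' := (\<lambda>t. if t \<in> {1..T + 1} then \<Sum>i = 1..<t. length (es i) else 0),
           ''arc'' := array_of (concat (map es [1..<T + 1]))),
        rreg = (\<lambda>_. 0)
          (''demand'' := demand I,
           ''penalty'' := penalty I),
        rarr = (\<lambda>_ _. 0)
          (''dual'' := array_of (concat (map (\<lambda>t. map (\<lambda>e. dual I e t) (es t)) [1..<T + 1]))) \<rparr>)"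

text \<open>
  A program returns the path \<open>p\<^bsub>t1...t2\<^esub>\<close> under the index \<open>(t1 - 1) T + (t2 - 1)\<close>, as an existence
  flag, the first vertex, and a segment of the array \<open>''P_arc''\<close> holding the arcs of the path.
\<close>

definition output_interval_path ::
    "(nat, nat) pricing \<Rightarrow> state \<Rightarrow> nat \<Rightarrow> nat \<Rightarrow> (nat, nat) path option" where
  "output_interval_path I s t1 t2 =
     (let i = (t1 - 1) * horizon I + (t2 - 1); j = narr s ''P_start'' i in
      if narr s ''P_exists'' i = 0 then None
      else Some (narr s ''P_origin'' i, map (narr s ''P_arc'') [j..<j + narr s ''P_length'' i]))"

definition output_sequence :: "state \<Rightarrow> nat \<Rightarrow> (nat, nat) path" where
  "output_sequence s t =
     (let j = narr s ''S_start'' t in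
      (narr s ''S_origin'' t, map (narr s ''S_arc'') [j..<j + narr s ''S_length'' t]))"


section \<open>Running times\<close>

definition max_arcs :: "('v, 'a) pricing \<Rightarrow> nat" where
  "max_arcs I = Max ((\<lambda>t. card (allowed I t)) ` {1..horizon I})"

text \<open>
  \<open>computable_in_time f R\<close>: one program computes, for every instance, a result satisfying \<open>R\<close> in
  \<open>O(f |T| |E|)\<close> steps. Only the constant of the \<open>O\<close> depends on the constant \<open>c\<close> of the
  assumption \<open>|V| = O(|E|)\<close>.
\<close>

definition computable_in_time ::
    "(real \<Rightarrow> real \<Rightarrow> real) \<Rightarrow> ((nat, nat) pricing \<Rightarrow> state \<Rightarrow> bool) \<Rightarrow> bool" where
  "computable_in_time f R \<longleftrightarrow>
     (\<exists>prog. \<forall>c::real. \<exists>C::real. \<forall>I es.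
        pricing_problem I \<and> encoding I es \<and>
        2 \<le> max_arcs I \<and> real (card (verts (graph I))) \<le> c * real (max_arcs I) \<longrightarrow>
        (\<exists>n s. exec prog (initial_state I es) n s \<and>
           real n \<le> C * f (real (horizon I)) (real (max_arcs I)) \<and> R I s))"

end

theory Submission
  imports Defs "HOL-Library.Discrete_Functions"
begin

text \<open>
  The time steps on which a path-sequence does not change its path form blocks. On a block \<open>t1..t2\<close>, the
  path can be replaced by \<open>p\<^bsub>t1...t2\<^esub>\<close>: the costs at other time steps stay the same, the costs on the
  block do not increase, because the old path is valid on the block too, and the number of changes does not
  increase either. So it suffices to choose a partition into blocks and to use \<open>p\<^bsub>t1...t2\<^esub>\<close> on each of them.
  A cheapest partition satisfies the recursion
  \<open>F t = min\<^bsub>a \<le> t\<^esub> (F (a - 1) + penalty + cost of p\<^bsub>a...t\<^esub>)\<close> with \<open>F 0 = 0\<close>, where the first block pays the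
  penalty too; this adds the same constant to all solutions. Lemma \<open>dp_table_le_step_costs\<close> shows that no
  path-sequence costs less than \<open>F\<close> at the horizon, \<open>blocks_step_costs\<close> that the sequence traced back from
  the table does not cost more, and \<open>blocks_optimal\<close> combines the two.
  
  Both running times are attained by the same program \<open>solve\<close>. For fixed \<open>t1\<close>, the end \<open>t2\<close> runs upwards, and
  one pass over the arcs of the time step \<open>t2\<close> updates which arcs have been allowed since \<open>t1\<close> and the sums of
  their costs. For these weights, which are not negative, \<open>p\<^bsub>t1...t2\<^esub>\<close> is a shortest path from the common
  origin to the common destination. Dijkstra's algorithm finds it; running it backwards from the
  destination has the effect that the successor arcs, followed from the origin, list the path in the
  right order. The queue is a tournament tree over the vertices, in which a changed leaf is propagated to
  the root in \<open>O(log V)\<close> steps. As soon as a path is found, the entry \<open>F t2\<close> is updated with it, which takes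
  constant time. The whole double loop takes time \<open>O(T\<^sup>2 (V + E) log V)\<close>, and \<open>V = O(E)\<close> turns this into
  \<open>O(T\<^sup>2 E log E)\<close>. Tracing back the table adds only \<open>O(T)\<close> steps, so the larger bound with \<open>T\<^sup>3\<close> follows
  as well (\<open>runs_solve\<close>, \<open>pair_time_bound\<close>, \<open>solve_in_time\<close>).
  
  The correctness of Dijkstra's algorithm is proved for abstract sets and labels first (\<open>search_inv\<close>). The
  programs are then verified with a predicate \<open>runs\<close> that combines termination, a bound on the number
  of steps and a postcondition.
\<close>

section \<open>Partitions of the time steps into blocks\<close>

text \<open>
  The first time step is charged like a change. Every block of equal paths then pays the penalty
  exactly once, and the objective is only shifted by a constant.
\<close>

definition step_cost :: "('v, 'a) pricing \<Rightarrow> (nat \<Rightarrow> ('v, 'a) path) \<Rightarrow> nat \<Rightarrow> real" where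
  "step_cost I s t =
     (if t = 1 \<or> s t \<noteq> s (t - 1) then penalty I else 0)
     - demand I * (\<Sum>e\<in>set (snd (s t)). dual I e t)"

lemma objective_eq_sum_step_cost:
  assumes "1 \<le> horizon I"
  shows "objective I s + penalty I = (\<Sum>t = 1..horizon I. step_cost I s t)"
proof -
  let ?T = "horizon I"
  have "(\<Sum>t = 1..?T. if t = 1 \<or> s t \<noteq> s (t - 1) then penalty I else 0)
      = (\<Sum>t \<in> {t \<in> {1..?T}. t = 1 \<or> s t \<noteq> s (t - 1)}. penalty I)"
    by (rule sum.inter_filter [symmetric]) simp
  also have "{t \<in> {1..?T}. t = 1 \<or> s t \<noteq> s (t - 1)} = insert 1 {t \<in> {2..?T}. s t \<noteq> s (t - 1)}"
  proof (rule set_eqI)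
    fix t :: nat
    have "t = 1 \<or> (1 \<le> t \<longleftrightarrow> 2 \<le> t)" by linarith
    then show "t \<in> {t \<in> {1..?T}. t = 1 \<or> s t \<noteq> s (t - 1)} \<longleftrightarrow>
        t \<in> insert 1 {t \<in> {2..?T}. s t \<noteq> s (t - 1)}"
      using assms by auto
  qed
  also have "(\<Sum>t \<in> \<dots>. penalty I) = penalty I * (1 + real (path_changes I s))"
    by (simp add: path_changes_def algebra_simps)
  finally show ?thesis
    by (simp add: step_cost_def objective_def sum_subtractf sum_distrib_left algebra_simps)
qed

lemma sum_split_interval:
  fixes f :: "nat \<Rightarrow> real"
  assumes "1 \<le> a" "a \<le> t"
  shows "sum f {1..t} = sum f {1..a - 1} + sum f {a..t}"
proof -
  have "{1..t} = {1..a - 1} \<union> {a..t}" using assms by auto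
  then show ?thesis using assms by (auto intro!: sum.union_disjoint)
qed

lemma interval_cost_eq:
  "interval_cost I a b p = (\<Sum>t = a..b. - demand I * (\<Sum>e\<in>set (snd p). dual I e t))"
  by (simp add: interval_cost_def sum_distrib_left)

text \<open>
  Bellman's equations for a cheapest partition of the first \<open>t\<close> time steps into blocks: \<open>F t\<close> is the
  value, and \<open>B t\<close> is the start of the last block.
\<close>

definition dp_table :: "('v, 'a) pricing \<Rightarrow> (nat \<Rightarrow> nat \<Rightarrow> ('v, 'a) path option) \<Rightarrow> nat \<Rightarrow>
    (nat \<Rightarrow> real) \<Rightarrow> (nat \<Rightarrow> nat) \<Rightarrow> bool" where
  "dp_table I P n F B \<longleftrightarrow> F 0 = 0 \<and> (\<forall>t\<in>{1..n}.
     (\<exists>p. 1 \<le> B t \<and> B t \<le> t \<and> P (B t) t = Some p \<and>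
        F t = F (B t - 1) + penalty I + interval_cost I (B t) t p) \<and>
     (\<forall>a p. 1 \<le> a \<and> a \<le> t \<and> P a t = Some p \<longrightarrow>
        F t \<le> F (a - 1) + penalty I + interval_cost I a t p))"

lemma dp_table_0: "dp_table I P n F B \<Longrightarrow> F 0 = 0"
  by (simp only: dp_table_def)

lemma dp_table_choice:
  assumes "dp_table I P n F B" "t \<in> {1..n}"
  obtains p where "1 \<le> B t" "B t \<le> t" "P (B t) t = Some p"
    "F t = F (B t - 1) + penalty I + interval_cost I (B t) t p"
  using assms unfolding dp_table_def by blast

lemma dp_table_le:
  assumes "dp_table I P n F B" "t \<in> {1..n}" "1 \<le> a" "a \<le> t" "P a t = Some p"
  shows "F t \<le> F (a - 1) + penalty I + interval_cost I a t p"
  using assms unfolding dp_table_def by blast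

lemma last_change:
  fixes s :: "nat \<Rightarrow> 'x"
  assumes "1 \<le> t"
  shows "\<exists>a. 1 \<le> a \<and> a \<le> t \<and> (\<forall>u\<in>{a..t}. s u = s t) \<and> (a = 1 \<or> s a \<noteq> s (a - 1))"
  using assms
proof (induction t)
  case (Suc t)
  show ?case
  proof (cases "t = 0 \<or> s (Suc t) \<noteq> s t")
    case True
    then show ?thesis by (intro exI [of _ "Suc t"]) auto
  next
    case False
    then have "1 \<le> t" by simp
    from Suc.IH [OF this] obtain a where "1 \<le> a" "a \<le> t" "\<forall>u\<in>{a..t}. s u = s t"
        "a = 1 \<or> s a \<noteq> s (a - 1)" by blast
    moreover have "s u = s (Suc t)" if "u \<in> {a..Suc t}" for u
    proof (cases "u = Suc t")
      case False
      then have "s u = s t" using that calculation(3) by (metis atLeastAtMost_iff le_SucE)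
      then show ?thesis using \<open>\<not> (t = 0 \<or> s (Suc t) \<noteq> s t)\<close> by simp
    qed simp
    moreover have "a \<le> Suc t" using calculation(2) by simp
    ultimately show ?thesis by blast
  qed
qed simp

lemma interval_paths_Some:
  assumes "interval_paths I P" "1 \<le> a" "a \<le> t" "t \<le> horizon I" "P a t = Some p"
  shows "lowest_cost_path I a t p"
proof -
  have "case P a t of None \<Rightarrow> \<not> (\<exists>p. valid_path_on I a t p) | Some p \<Rightarrow> lowest_cost_path I a t p"
    using assms(1-4) unfolding interval_paths_def by blast
  then show ?thesis using assms(5) by simp
qed

lemma interval_paths_exists:
  assumes "interval_paths I P" "1 \<le> a" "a \<le> t" "t \<le> horizon I" "valid_path_on I a t q"
  shows "\<exists>p. P a t = Some p"
proof (cases "P a t")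
  case None
  have "case P a t of None \<Rightarrow> \<not> (\<exists>p. valid_path_on I a t p) | Some p \<Rightarrow> lowest_cost_path I a t p"
    using assms(1-4) unfolding interval_paths_def by blast
  then show ?thesis using None assms(5) by (metis option.simps(4))
qed blast

text \<open>
  The last block \<open>{a..t}\<close> of \<open>s\<close> uses a path that is valid on the whole block. So it pays the penalty
  and at least the cost of the path chosen for the interval; the rest is covered by induction.
\<close>

lemma dp_table_le_step_costs:
  assumes tab: "dp_table I P (horizon I) F B" and P: "interval_paths I P"
    and s: "path_sequence I s"
  shows "t \<le> horizon I \<Longrightarrow> F t \<le> (\<Sum>u = 1..t. step_cost I s u)"
proof (induction t rule: less_induct)
  case (less t)
  show ?case
  proof (cases "t = 0")
    case True
    then show ?thesis using dp_table_0 [OF tab] by simp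
  next
    case False
    then have "1 \<le> t" by simp
    from last_change [OF this, of s] obtain a where a: "1 \<le> a" "a \<le> t"
        "\<forall>u\<in>{a..t}. s u = s t" "a = 1 \<or> s a \<noteq> s (a - 1)" by blast
    have val: "valid_path_on I a t (s t)"
      unfolding valid_path_on_def
    proof
      fix u assume u: "u \<in> {a..t}"
      then have "valid_path_at I u (s u)" using s a(1) less.prems by (simp add: path_sequence_def)
      moreover have "s u = s t" using a(3) u by blast
      ultimately show "valid_path_at I u (s t)" by simp
    qed
    then obtain p where p: "P a t = Some p"
      using interval_paths_exists [OF P a(1,2) less.prems] by blast
    have low: "lowest_cost_path I a t p"
      using interval_paths_Some [OF P a(1,2) less.prems p] .
    have step: "step_cost I s u = (if u = a then penalty I else 0)
        - demand I * (\<Sum>e\<in>set (snd (s t)). dual I e u)" if "u \<in> {a..t}" for u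
    proof (cases "u = a")
      case True
      moreover have "s a = s t" using a(2,3) by (metis atLeastAtMost_iff le_refl)
      ultimately show ?thesis using a(4) by (simp add: step_cost_def)
    next
      case False
      then have "u - 1 \<in> {a..t}" "u \<noteq> 1" using that a(1,2) by auto
      then have "s u = s t" "s (u - 1) = s t" using a(3) that by blast+
      then show ?thesis using False \<open>u \<noteq> 1\<close> by (simp add: step_cost_def)
    qed
    have "(\<Sum>u = a..t. step_cost I s u) = penalty I + interval_cost I a t (s t)"
      using a(1,2) by (simp add: step sum.distrib sum_subtractf interval_cost_eq sum_negf)
    moreover have "interval_cost I a t p \<le> interval_cost I a t (s t)"
      using low val unfolding lowest_cost_path_def by blast
    moreover have "F t \<le> F (a - 1) + penalty I + interval_cost I a t p"
      using dp_table_le [OF tab _ a(1,2) p] less.prems \<open>1 \<le> t\<close> by simp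
    moreover have "F (a - 1) \<le> (\<Sum>u = 1..a - 1. step_cost I s u)"
      using a(1,2) less.prems by (intro less.IH) auto
    ultimately show ?thesis using sum_split_interval [OF a(1,2), of "step_cost I s"] by linarith
  qed
qed

text \<open>
  Tracing the table back from the end: \<open>s\<close> consists of the recommended blocks on the time steps after \<open>t\<close>.
  The values of \<open>s\<close> up to \<open>t\<close> are still free, so the sequence can be built from the end.
\<close>

inductive blocks :: "(nat \<Rightarrow> nat \<Rightarrow> 'p option) \<Rightarrow> (nat \<Rightarrow> nat) \<Rightarrow> nat \<Rightarrow> (nat \<Rightarrow> 'p) \<Rightarrow> nat \<Rightarrow> bool"
  for P B n s where
  blocks_end: "blocks P B n s n"
| blocks_step: "blocks P B n s t \<Longrightarrow> 1 \<le> B t \<Longrightarrow> B t \<le> t \<Longrightarrow>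
    \<forall>u\<in>{B t..t}. P (B t) t = Some (s u) \<Longrightarrow> blocks P B n s (B t - 1)"

lemma blocks_cong:
  assumes "blocks P B n s t" "\<And>u. t < u \<Longrightarrow> s u = s' u"
  shows "blocks P B n s' t"
  using assms
proof (induction rule: blocks.induct)
  case (blocks_step t)
  have "s u = s' u" if "B t \<le> u" for u
    using that blocks_step.hyps blocks_step.prems by simp
  then have "\<forall>u\<in>{B t..t}. P (B t) t = Some (s' u)"
    using blocks_step.hyps(4) by fastforce
  moreover have "blocks P B n s' t"
    using blocks_step by simp
  ultimately show ?case using blocks_step.hyps by (blast intro: blocks.blocks_step)
qed (rule blocks_end)

text \<open>
  An inequality, because two neighbouring blocks may use the same path, and then there is no change
  between them.
\<close>

lemma blocks_step_costs:
  assumes tab: "dp_table I P (horizon I) F B" and pos: "0 < penalty I"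
    and P: "interval_paths I P"
    and "blocks P B (horizon I) s t"
  shows "t \<le> horizon I \<and>
    (\<Sum>u = t + 1..horizon I. step_cost I s u) \<le> F (horizon I) - F t \<and>
    (\<forall>u\<in>{t + 1..horizon I}. valid_path_at I u (s u) \<and> s u \<in> candidate_paths I P u)"
  using assms(4)
proof (induction rule: blocks.induct)
  case (blocks_step t)
  let ?a = "B t"
  have t: "?a \<le> t" "1 \<le> ?a" "t \<le> horizon I" using blocks_step by auto
  have "t \<in> {1..horizon I}" using t by simp
  then obtain p where p: "P ?a t = Some p" "F t = F (?a - 1) + penalty I + interval_cost I ?a t p"
    using dp_table_choice [OF tab] by metis
  have sp: "s u = p" if "u \<in> {?a..t}" for u
    using blocks_step.hyps(4) p(1) that by (metis option.inject)
  have "lowest_cost_path I ?a t p"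
    using interval_paths_Some [OF P t(2,1,3) p(1)] .
  then have val: "valid_path_on I ?a t p" by (simp add: lowest_cost_path_def)
  have step: "step_cost I s u \<le> (if u = ?a then penalty I else 0)
      - demand I * (\<Sum>e\<in>set (snd p). dual I e u)" if "u \<in> {?a..t}" for u
  proof (cases "u = ?a")
    case True
    then show ?thesis using sp [OF that] pos by (simp add: step_cost_def)
  next
    case False
    then have "u - 1 \<in> {?a..t}" "u \<noteq> 1" using that t by auto
    then show ?thesis using False sp that by (simp add: step_cost_def)
  qed
  have "(\<Sum>u = ?a..t. step_cost I s u) \<le> (\<Sum>u = ?a..t. (if u = ?a then penalty I else 0)
      - demand I * (\<Sum>e\<in>set (snd p). dual I e u))"
    by (rule sum_mono) (rule step)
  also have "\<dots> = penalty I + interval_cost I ?a t p"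
    using t by (simp add: sum.distrib sum_subtractf interval_cost_eq sum_negf)
  finally have le: "(\<Sum>u = ?a..t. step_cost I s u) \<le> penalty I + interval_cost I ?a t p" .
  have dec: "{?a - 1 + 1..horizon I} = {?a..t} \<union> {t + 1..horizon I}" using t by auto
  have "(\<Sum>u = ?a - 1 + 1..horizon I. step_cost I s u)
      = (\<Sum>u = ?a..t. step_cost I s u) + (\<Sum>u = t + 1..horizon I. step_cost I s u)"
    unfolding dec by (rule sum.union_disjoint) auto
  moreover have "valid_path_at I u (s u) \<and> s u \<in> candidate_paths I P u" if "u \<in> {?a..t}" for u
    using val that sp [OF that] p t by (auto simp: valid_path_on_def candidate_paths_def)
  ultimately show ?case using le p blocks_step.IH dec t by auto
qed simp

text \<open>
  The value \<open>F (horizon I)\<close> separates the two sides: it is at most the cost of every path-sequence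
  and at least the cost of the traced one.
\<close>

lemma blocks_optimal:
  assumes I: "pricing_problem I" and tab: "dp_table I P (horizon I) F B"
    and P: "interval_paths I P" and blk: "blocks P B (horizon I) s 0"
  shows "optimal_sequence I s \<and> (\<forall>t\<in>{1..horizon I}. s t \<in> candidate_paths I P t)"
proof -
  have T: "1 \<le> horizon I" and pos: "0 < penalty I" using I by (auto simp: pricing_problem_def)
  note up = blocks_step_costs [OF tab pos P blk]
  have seq: "path_sequence I s" using up by (auto simp: path_sequence_def)
  have "objective I s \<le> objective I s'" if "path_sequence I s'" for s'
  proof -
    have "F (horizon I) \<le> (\<Sum>u = 1..horizon I. step_cost I s' u)"
      using dp_table_le_step_costs [OF tab P that] by simp
    moreover have "F 0 = 0" using dp_table_0 [OF tab] .
    ultimately have "objective I s + penalty I \<le> objective I s' + penalty I"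
      unfolding objective_eq_sum_step_cost [OF T] using up by simp
    then show ?thesis by simp
  qed
  then show ?thesis using up seq by (simp add: optimal_sequence_def)
qed

lemma interval_paths_singleton:
  assumes "pricing_problem I" "interval_paths I P" "t \<in> {1..horizon I}"
  shows "\<exists>p. P t t = Some p"
proof -
  have "\<exists>p. valid_path_on I t t p"
    using assms by (auto simp: pricing_problem_def valid_path_on_def)
  then show ?thesis using interval_paths_exists [OF assms(2), of t t] assms(3) by auto
qed

lemma dp_table_exists:
  assumes I: "pricing_problem I" and P: "interval_paths I P"
  shows "n \<le> horizon I \<Longrightarrow> \<exists>F B. dp_table I P n F B"
proof (induction n)
  case 0
  then show ?case by (intro exI [of _ "\<lambda>_. 0"]) (simp add: dp_table_def)
next
  case (Suc n)
  then obtain F B where FB: "dp_table I P n F B" by auto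
  let ?m = "Suc n"
  let ?A = "{a \<in> {1..?m}. P a ?m \<noteq> None}"
  let ?c = "\<lambda>a. F (a - 1) + penalty I + interval_cost I a ?m (the (P a ?m))"
  have "?m \<in> ?A" using interval_paths_singleton [OF I P, of ?m] Suc by auto
  then obtain b where b: "b \<in> ?A" "\<forall>a\<in>?A. ?c b \<le> ?c a"
    using ex_is_arg_min_if_finite [of ?A ?c] by (auto simp: is_arg_min_linorder)
  have "dp_table I P ?m (F(?m := ?c b)) (B(?m := b))"
    unfolding dp_table_def
  proof (intro conjI ballI)
    show "(F(?m := ?c b)) 0 = 0" using dp_table_0 [OF FB] by simp
  next
    fix t assume t: "t \<in> {1..?m}"
    show "\<exists>p. 1 \<le> (B(?m := b)) t \<and> (B(?m := b)) t \<le> t \<and> P ((B(?m := b)) t) t = Some p \<and>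
        (F(?m := ?c b)) t = (F(?m := ?c b)) ((B(?m := b)) t - 1) + penalty I
          + interval_cost I ((B(?m := b)) t) t p"
    proof (cases "t = ?m")
      case True
      then show ?thesis using b by auto
    next
      case False
      then have n: "t \<in> {1..n}" using t by auto
      then obtain p where "1 \<le> B t" "B t \<le> t" "P (B t) t = Some p"
          "F t = F (B t - 1) + penalty I + interval_cost I (B t) t p"
        using dp_table_choice [OF FB] by metis
      then show ?thesis using False n by (intro exI [of _ p]) auto
    qed
    show "\<forall>a p. 1 \<le> a \<and> a \<le> t \<and> P a t = Some p \<longrightarrow>
        (F(?m := ?c b)) t \<le> (F(?m := ?c b)) (a - 1) + penalty I + interval_cost I a t p"
    proof (cases "t = ?m")
      case True
      show ?thesis
      proof (intro allI impI)
        fix a p assume ap: "1 \<le> a \<and> a \<le> t \<and> P a t = Some p"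
        then have "a \<in> ?A" using True by simp
        then have "?c b \<le> ?c a" using b(2) by blast
        then show "(F(?m := ?c b)) t \<le> (F(?m := ?c b)) (a - 1) + penalty I + interval_cost I a t p"
          using ap True by auto
      qed
    next
      case False
      then have n: "t \<in> {1..n}" using t by auto
      show ?thesis
      proof (intro allI impI)
        fix a p assume ap: "1 \<le> a \<and> a \<le> t \<and> P a t = Some p"
        then have "F t \<le> F (a - 1) + penalty I + interval_cost I a t p"
          using dp_table_le [OF FB n] by blast
        then show "(F(?m := ?c b)) t \<le> (F(?m := ?c b)) (a - 1) + penalty I + interval_cost I a t p"
          using ap n False by auto
      qed
    qed
  qed
  then show ?case by blast
qed

lemma blocks_exists:
  assumes tab: "dp_table I P n F B"
  shows "t \<le> n \<Longrightarrow> blocks P B n s t \<Longrightarrow> \<exists>s'. blocks P B n s' 0"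
proof (induction t arbitrary: s rule: less_induct)
  case (less t)
  show ?case
  proof (cases "t = 0")
    case False
    then have "t \<in> {1..n}" using less.prems(1) by simp
    then obtain p where p: "1 \<le> B t" "B t \<le> t" "P (B t) t = Some p"
      using dp_table_choice [OF tab] by metis
    let ?s = "\<lambda>u. if u \<le> t then p else s u"
    have "blocks P B n ?s t" using less.prems(2) by (rule blocks_cong) simp
    then have "blocks P B n ?s (B t - 1)" by (rule blocks_step) (use p in auto)
    then show ?thesis using p less.prems by (intro less.IH [of "B t - 1"]) auto
  qed (use less.prems in blast)
qed

lemma optimal_sequence_of_candidates:
  assumes I: "pricing_problem I" and P: "interval_paths I P"
  shows "\<exists>s. optimal_sequence I s \<and> (\<forall>t\<in>{1..horizon I}. s t \<in> candidate_paths I P t)"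
proof -
  obtain F B where tab: "dp_table I P (horizon I) F B"
    using dp_table_exists [OF I P] by blast
  have "blocks P B (horizon I) s (horizon I)" for s by (rule blocks_end)
  then obtain s where "blocks P B (horizon I) s 0"
    using blocks_exists [OF tab] by blast
  then show ?thesis using blocks_optimal [OF I tab P] by blast
qed

section \<open>Total correctness with time bounds\<close>

text \<open>
  The bound \<open>k\<close> need not be exact, so that the branches of a program can share one bound.
\<close>

definition runs :: "com \<Rightarrow> state \<Rightarrow> nat \<Rightarrow> (state \<Rightarrow> bool) \<Rightarrow> bool" where
  "runs c s k Q \<longleftrightarrow> (\<exists>n s'. exec c s n s' \<and> n \<le> k \<and> Q s')"

lemma runs_mono:
  assumes "runs c s k Q" "k \<le> k'" "\<And>s'. Q s' \<Longrightarrow> Q' s'"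
  shows "runs c s k' Q'"
  using assms unfolding runs_def by (meson le_trans)

lemma runs_Seq:
  assumes "runs c s k Q" "\<And>s'. Q s' \<Longrightarrow> runs d s' l R"
  shows "runs (Seq c d) s (k + l) R"
proof -
  obtain n s1 where 1: "exec c s n s1" "n \<le> k" "Q s1" using assms(1) by (auto simp: runs_def)
  then obtain m s2 where "exec d s1 m s2" "m \<le> l" "R s2" using assms(2) by (force simp: runs_def)
  with 1 show ?thesis unfolding runs_def by (meson exec.Seq add_mono)
qed

lemma runs_Cond:
  assumes "bval b s \<Longrightarrow> runs c s k Q" "\<not> bval b s \<Longrightarrow> runs d s k Q"
  shows "runs (Cond b c d) s (1 + bcost b + k) Q"
proof (cases "bval b s")
  case True
  then show ?thesis using assms(1) unfolding runs_def by (meson CondTrue add_left_mono)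
next
  case False
  then show ?thesis using assms(2) unfolding runs_def by (meson CondFalse add_left_mono)
qed

text \<open>
  The number \<open>k\<close> is a potential from which every iteration is paid. Iterations may consume different
  amounts, which is how the relaxations of Dijkstra's algorithm are counted once per arc and not
  once per vertex and arc.
\<close>

lemma runs_While:
  assumes "Inv k s"
    and step: "\<And>k s. Inv k s \<Longrightarrow> bval b s \<Longrightarrow>
      \<exists>l k'. runs c s l (Inv k') \<and> 1 + bcost b + l + k' \<le> k"
  shows "runs (While b c) s (k + 1 + bcost b) (\<lambda>s'. (\<exists>k'. Inv k' s') \<and> \<not> bval b s')"
  using assms(1)
proof (induction k arbitrary: s rule: less_induct)
  case (less k)
  show ?case
  proof (cases "bval b s")
    case False
    have "exec (While b c) s (1 + bcost b) s" using False by (rule WhileFalse)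
    then show ?thesis using False less.prems unfolding runs_def
      by (intro exI [of _ "1 + bcost b"] exI [of _ s]) auto
  next
    case True
    obtain l k' where "runs c s l (Inv k')" and k': "1 + bcost b + l + k' \<le> k"
      using step [OF less.prems True] by blast
    then obtain m s1 where 1: "exec c s m s1" "m \<le> l" "Inv k' s1" by (auto simp: runs_def)
    have "k' < k" using k' by linarith
    from less.IH [OF this 1(3)] obtain n s2 where 2: "exec (While b c) s1 n s2"
        "n \<le> k' + 1 + bcost b" "\<exists>k'. Inv k' s2" "\<not> bval b s2"
      by (auto simp: runs_def)
    have "exec (While b c) s (1 + bcost b + m + n) s2"
      using WhileTrue [OF True 1(1) 2(1)] .
    moreover have "1 + bcost b + m + n \<le> k + 1 + bcost b" using 1 2 k' by linarith
    ultimately show ?thesis using 2 unfolding runs_def by blast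
  qed
qed

lemma runs_While_count:
  assumes "Inv n s"
    and step: "\<And>n s. Inv n s \<Longrightarrow> bval b s \<Longrightarrow> \<exists>m. n = Suc m \<and> runs c s l (Inv m)"
    and k: "n * (1 + bcost b + l) + 1 + bcost b \<le> k"
    and Q: "\<And>n s'. Inv n s' \<Longrightarrow> \<not> bval b s' \<Longrightarrow> Q s'"
  shows "runs (While b c) s k Q"
proof -
  let ?Inv = "\<lambda>k s. \<exists>n. k = n * (1 + bcost b + l) \<and> Inv n s"
  have "runs (While b c) s (n * (1 + bcost b + l) + 1 + bcost b)
      (\<lambda>s'. (\<exists>k'. ?Inv k' s') \<and> \<not> bval b s')"
  proof (rule runs_While)
    fix k s assume "?Inv k s" "bval b s"
    then obtain n where n: "k = n * (1 + bcost b + l)" "Inv n s" by blast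
    with step \<open>bval b s\<close> obtain m where m: "n = Suc m" "runs c s l (Inv m)" by blast
    have "runs c s l (?Inv (m * (1 + bcost b + l)))"
      using m(2) by (rule runs_mono) auto
    then show "\<exists>l' k'. runs c s l' (?Inv k') \<and> 1 + bcost b + l' + k' \<le> k"
      using n m by (intro exI [of _ l] exI [of _ "m * (1 + bcost b + l)"]) simp
  qed (use assms in blast)
  then show ?thesis by (rule runs_mono) (use k Q in auto)
qed

text \<open>
  The programs below never use one name for two kinds of memory cells. So a single set of names
  describes what a program may change, and specifications can leave all other cells unmentioned.
\<close>

primrec writes :: "com \<Rightarrow> name set" where
  "writes Skip = {}"
| "writes (SetNReg x e) = {x}"
| "writes (SetNArr a i e) = {a}"
| "writes (SetRReg x e) = {x}"
| "writes (SetRArr a i e) = {a}"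
| "writes (Seq c d) = writes c \<union> writes d"
| "writes (Cond b c d) = writes c \<union> writes d"
| "writes (While b c) = writes c"

definition unchanged :: "name set \<Rightarrow> state \<Rightarrow> state \<Rightarrow> bool" where
  "unchanged X s s' \<longleftrightarrow> (\<forall>x. x \<notin> X \<longrightarrow>
     nreg s' x = nreg s x \<and> narr s' x = narr s x \<and> rreg s' x = rreg s x \<and> rarr s' x = rarr s x)"

lemma exec_unchanged: "exec c s n s' \<Longrightarrow> unchanged (writes c) s s'"
  by (induction rule: exec.induct) (auto simp: unchanged_def)

lemma runs_frame:
  assumes "runs c s k Q"
  shows "runs c s k (\<lambda>s'. Q s' \<and> unchanged (writes c) s s')"
  using assms unfolding runs_def by (meson exec_unchanged)

primrec loop_free :: "com \<Rightarrow> bool" where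
  "loop_free Skip = True"
| "loop_free (SetNReg x e) = True"
| "loop_free (SetNArr a i e) = True"
| "loop_free (SetRReg x e) = True"
| "loop_free (SetRArr a i e) = True"
| "loop_free (Seq c d) = (loop_free c \<and> loop_free d)"
| "loop_free (Cond b c d) = (loop_free c \<and> loop_free d)"
| "loop_free (While b c) = False"

text \<open>
  Symbolic execution of programs without loops; on loops the function has a dummy value.
\<close>

primrec effect :: "com \<Rightarrow> state \<Rightarrow> state" where
  "effect Skip s = s"
| "effect (SetNReg x e) s = s\<lparr>nreg := (nreg s)(x := nval e s)\<rparr>"
| "effect (SetNArr a i e) s = s\<lparr>narr := (narr s)(a := (narr s a)(nval i s := nval e s))\<rparr>"
| "effect (SetRReg x e) s = s\<lparr>rreg := (rreg s)(x := rval e s)\<rparr>"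
| "effect (SetRArr a i e) s = s\<lparr>rarr := (rarr s)(a := (rarr s a)(nval i s := rval e s))\<rparr>"
| "effect (Seq c d) s = effect d (effect c s)"
| "effect (Cond b c d) s = (if bval b s then effect c s else effect d s)"
| "effect (While b c) s = s"

primrec max_steps :: "com \<Rightarrow> nat" where
  "max_steps Skip = 1"
| "max_steps (SetNReg x e) = 1 + ncost e"
| "max_steps (SetNArr a i e) = 1 + ncost i + ncost e"
| "max_steps (SetRReg x e) = 1 + rcost e"
| "max_steps (SetRArr a i e) = 1 + ncost i + rcost e"
| "max_steps (Seq c d) = max_steps c + max_steps d"
| "max_steps (Cond b c d) = 1 + bcost b + max (max_steps c) (max_steps d)"
| "max_steps (While b c) = 0"

lemma exec_effect: "loop_free c \<Longrightarrow> \<exists>n\<le>max_steps c. exec c s n (effect c s)"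
proof (induction c arbitrary: s)
  case (SetNReg x e)
  show ?case using exec.SetNReg [of x e s] by auto
next
  case (SetNArr a i e)
  show ?case using exec.SetNArr [of a i e s] by auto
next
  case (SetRReg x e)
  show ?case using exec.SetRReg [of x e s] by auto
next
  case (SetRArr a i e)
  show ?case using exec.SetRArr [of a i e s] by auto
next
  case (Seq c d)
  then obtain n m where "exec c s n (effect c s)" "n \<le> max_steps c"
      "exec d (effect c s) m (effect d (effect c s))" "m \<le> max_steps d"
    by (metis loop_free.simps(6))
  then show ?case by (auto intro!: exI [of _ "n + m"] exec.Seq)
next
  case (Cond b c d)
  obtain n where n: "exec c s n (effect c s)" "n \<le> max_steps c"
    using Cond by (metis loop_free.simps(7))
  obtain m where m: "exec d s m (effect d s)" "m \<le> max_steps d"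
    using Cond by (metis loop_free.simps(7))
  show ?case
  proof (cases "bval b s")
    case True
    then show ?thesis using CondTrue [OF True n(1), of d] n(2)
      by (intro exI [of _ "1 + bcost b + n"]) auto
  next
    case False
    then show ?thesis using CondFalse [OF False m(1), of c] m(2)
      by (intro exI [of _ "1 + bcost b + m"]) auto
  qed
next
  case Skip
  show ?case using exec.Skip [of s] by auto
qed auto

lemma runs_effect:
  assumes "loop_free c" "max_steps c \<le> k" "Q (effect c s)"
  shows "runs c s k Q"
  using exec_effect [OF assms(1), of s] assms(2,3) unfolding runs_def by (meson le_trans)

section \<open>Tournament trees\<close>

text \<open>
  A binary tree in an array: node \<open>i\<close> has the children \<open>2 * i\<close> and \<open>2 * i + 1\<close>, and vertex \<open>v\<close> is the
  leaf \<open>N + v\<close>. A node holds 0 if no vertex below it is queued, and otherwise \<open>v + 1\<close> together with the key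
  of such a vertex \<open>v\<close> with the lowest key. The number \<open>N\<close> of leaves can be arbitrary, because halving
  leads from every positive index to the root 1.
\<close>

definition dominates :: "(nat \<Rightarrow> nat) \<Rightarrow> (nat \<Rightarrow> real) \<Rightarrow> nat \<Rightarrow> nat \<Rightarrow> bool" where
  "dominates tree key i c \<longleftrightarrow> (tree c \<noteq> 0 \<longrightarrow> tree i \<noteq> 0 \<and> key i \<le> key c)"

text \<open>
  Inequalities for the occupied children, rather than an equation for the minimum, make this true
  in a tree that is all 0, whatever keys it contains.
\<close>

definition node_ok :: "(nat \<Rightarrow> nat) \<Rightarrow> (nat \<Rightarrow> real) \<Rightarrow> nat \<Rightarrow> bool" where
  "node_ok tree key i \<longleftrightarrow>
     dominates tree key i (2 * i) \<and> dominates tree key i (2 * i + 1) \<and>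
     (tree i = 0 \<or> (\<exists>c\<in>{2 * i, 2 * i + 1}. tree i = tree c \<and> key i = key c))"

definition ancestors :: "nat \<Rightarrow> nat set" where
  "ancestors i = range (\<lambda>k. i div 2 ^ k)"

text \<open>
  The nodes in \<open>X\<close> await repair. Below, \<open>X\<close> is the path from a node to the root; for the index 0, which
  is not a node, this path excepts nothing.
\<close>

definition tournament_except ::
    "nat \<Rightarrow> (nat \<Rightarrow> nat) \<Rightarrow> (nat \<Rightarrow> real) \<Rightarrow> nat set \<Rightarrow> bool" where
  "tournament_except N tree key X \<longleftrightarrow>
     (\<forall>i\<in>{1..<N}. i \<notin> X \<longrightarrow> node_ok tree key i) \<and>
     (\<forall>v<N. tree (N + v) = 0 \<or> tree (N + v) = v + 1)"

abbreviation tournament :: "nat \<Rightarrow> (nat \<Rightarrow> nat) \<Rightarrow> (nat \<Rightarrow> real) \<Rightarrow> bool" where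
  "tournament N tree key \<equiv> tournament_except N tree key (ancestors 0)"

lemma ancestors_0: "ancestors 0 = {0}"
  by (auto simp: ancestors_def)

lemma self_in_ancestors: "i \<in> ancestors i"
  unfolding ancestors_def by (rule range_eqI [of _ _ 0]) simp

lemma ancestors_subset: "ancestors i \<subseteq> insert i (ancestors (i div 2))"
proof
  fix j assume "j \<in> ancestors i"
  then obtain k where k: "j = i div 2 ^ k" by (auto simp: ancestors_def)
  show "j \<in> insert i (ancestors (i div 2))"
  proof (cases k)
    case (Suc l)
    then have "j = i div 2 div 2 ^ l" using k by (simp add: div_mult2_eq)
    then show ?thesis by (auto simp: ancestors_def)
  qed (use k in simp)
qed

lemma tournament_root_dominates:
  assumes "tournament N tree key"
  shows "1 \<le> i \<Longrightarrow> i < 2 * N \<Longrightarrow> dominates tree key 1 i"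
proof (induction i rule: less_induct)
  case (less i)
  show ?case
  proof (cases "i = 1")
    case True
    then show ?thesis by (simp add: dominates_def)
  next
    case False
    let ?p = "i div 2"
    have p: "?p < i" "1 \<le> ?p" "?p < N" using False less.prems by auto
    have "node_ok tree key ?p"
      using assms p by (auto simp: tournament_except_def ancestors_0)
    moreover have "i = 2 * ?p \<or> i = 2 * ?p + 1" by presburger
    ultimately have "dominates tree key ?p i" unfolding node_ok_def by metis
    moreover have "dominates tree key 1 ?p" using less.IH p by simp
    ultimately show ?thesis unfolding dominates_def by fastforce
  qed
qed

text \<open>
  Every entry is copied from a child, so descending to that child ends at a leaf with the same entry.
\<close>

lemma tournament_points_to_leaf:
  assumes "tournament N tree key"
  shows "1 \<le> i \<Longrightarrow> i < 2 * N \<Longrightarrow> tree i \<noteq> 0 \<Longrightarrow>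
    \<exists>v<N. tree i = v + 1 \<and> tree (N + v) = v + 1 \<and> key i = key (N + v)"
proof (induction "2 * N - i" arbitrary: i rule: less_induct)
  case less
  show ?case
  proof (cases "i < N")
    case True
    then have "node_ok tree key i"
      using assms less.prems by (auto simp: tournament_except_def ancestors_0)
    then obtain c where c: "c \<in> {2 * i, 2 * i + 1}" "tree i = tree c" "key i = key c"
      using less.prems unfolding node_ok_def by blast
    then show ?thesis using less.hyps [of c] less.prems True by auto
  next
    case False
    then obtain v where "i = N + v" "v < N"
      using less.prems by (metis add_less_cancel_left le_Suc_ex mult_2 not_less)
    then show ?thesis using assms less.prems by (auto simp: tournament_except_def)
  qed
qed

lemma tournament_root_0:
  assumes "tournament N tree key" "tree 1 = 0" "v < N"
  shows "tree (N + v) = 0"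
  using tournament_root_dominates [OF assms(1), of "N + v"] assms by (auto simp: dominates_def)

lemma tournament_root_min:
  assumes "tournament N tree key" "tree 1 \<noteq> 0" "1 \<le> N"
  obtains v where "v < N" "tree 1 = v + 1" "tree (N + v) = v + 1"
    "\<And>u. u < N \<Longrightarrow> tree (N + u) \<noteq> 0 \<Longrightarrow> key (N + v) \<le> key (N + u)"
proof -
  obtain v where v: "v < N" "tree 1 = v + 1" "tree (N + v) = v + 1" "key 1 = key (N + v)"
    using tournament_points_to_leaf [OF assms(1), of 1] assms(2,3) by auto
  have "key (N + v) \<le> key (N + u)" if "u < N" "tree (N + u) \<noteq> 0" for u
    using tournament_root_dominates [OF assms(1), of "N + u"] that v by (auto simp: dominates_def)
  with v that show ?thesis by blast
qed

lemma node_ok_fun_upd: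
  assumes "j \<noteq> i" "2 * j \<noteq> i" "2 * j + 1 \<noteq> i"
  shows "node_ok (tree(i := x)) (key(i := y)) j \<longleftrightarrow> node_ok tree key j"
  using assms by (simp add: node_ok_def dominates_def)

lemma tournament_change_leaf:
  assumes "tournament N tree key" "v < N" "x = 0 \<or> x = v + 1"
  shows "tournament_except N (tree(N + v := x)) (key(N + v := y)) (ancestors ((N + v) div 2))"
  unfolding tournament_except_def
proof (intro conjI ballI impI allI)
  fix i assume i: "i \<in> {1..<N}" "i \<notin> ancestors ((N + v) div 2)"
  then have "i \<noteq> (N + v) div 2" using self_in_ancestors by metis
  then have "2 * i \<noteq> N + v" "2 * i + 1 \<noteq> N + v" by presburger+
  moreover have "node_ok tree key i"
    using assms(1) i by (auto simp: tournament_except_def ancestors_0)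
  ultimately show "node_ok (tree(N + v := x)) (key(N + v := y)) i"
    using i by (simp add: node_ok_fun_upd)
next
  fix u assume "u < N"
  then show "(tree(N + v := x)) (N + u) = 0 \<or> (tree(N + v := x)) (N + u) = u + 1"
    using assms by (auto simp: tournament_except_def)
qed

lemma tournament_repair_node:
  assumes "tournament_except N tree key (ancestors i)" "1 \<le> i" "i < N"
    and c: "c = (if tree (2 * i) = 0 \<or> tree (2 * i + 1) \<noteq> 0 \<and> key (2 * i + 1) < key (2 * i)
      then 2 * i + 1 else 2 * i)"
  shows "tournament_except N (tree(i := tree c)) (key(i := key c)) (ancestors (i div 2))"
  unfolding tournament_except_def
proof (intro conjI ballI impI allI)
  fix j assume j: "j \<in> {1..<N}" "j \<notin> ancestors (i div 2)"
  show "node_ok (tree(i := tree c)) (key(i := key c)) j"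
  proof (cases "j = i")
    case True
    then show ?thesis using assms(2) c by (auto simp: node_ok_def dominates_def)
  next
    case False
    then have "j \<notin> ancestors i" using j ancestors_subset by blast
    then have "node_ok tree key j" using assms(1) j by (simp add: tournament_except_def)
    moreover have "j \<noteq> i div 2" using j self_in_ancestors by metis
    then have "2 * j \<noteq> i" "2 * j + 1 \<noteq> i" by presburger+
    ultimately show ?thesis using False by (simp add: node_ok_fun_upd)
  qed
next
  fix u assume "u < N"
  then show "(tree(i := tree c)) (N + u) = 0 \<or> (tree(i := tree c)) (N + u) = u + 1"
    using assms by (auto simp: tournament_except_def)
qed

section \<open>Shortest paths by label setting\<close>

text \<open>
  Lists in memory. The arc \<open>a\<close> is stored as \<open>a + 1\<close>, so that 0 can mark the end.
\<close>

fun linked :: "(nat \<Rightarrow> nat) \<Rightarrow> nat \<Rightarrow> nat list \<Rightarrow> bool" where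
  "linked nx p [] \<longleftrightarrow> p = 0"
| "linked nx p (a # as) \<longleftrightarrow> p = a + 1 \<and> linked nx (nx a) as"

lemma linked_fun_upd: "a \<notin> set as \<Longrightarrow> linked (nx(a := y)) p as \<longleftrightarrow> linked nx p as"
  by (induction as arbitrary: p) auto

text \<open>
  The path that leads from \<open>v\<close> to \<open>D\<close> along the successor arcs \<open>sc\<close>. All vertices after \<open>v\<close> are required
  to be settled. Successor arcs of settled vertices never change, and a vertex that is relabelled is not
  settled, so putting it in front of such a path keeps the vertices distinct, even if arcs of weight 0
  form a cycle.
\<close>

fun tree_path :: "('v, 'a) pre_digraph \<Rightarrow> 'v \<Rightarrow> 'a set \<Rightarrow> ('v \<Rightarrow> 'a) \<Rightarrow> 'v set \<Rightarrow>
    'v \<Rightarrow> 'a list \<Rightarrow> bool" where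
  "tree_path G D A sc S v [] \<longleftrightarrow> v = D"
| "tree_path G D A sc S v (a # p) \<longleftrightarrow>
     v \<noteq> D \<and> sc v = a \<and> a \<in> A \<and> tail G a = v \<and> head G a \<in> S \<and>
     v \<notin> set (pre_digraph.awalk_verts G (head G a) p) \<and> tree_path G D A sc S (head G a) p"

lemma tree_path_mono: "tree_path G D A sc S v p \<Longrightarrow> S \<subseteq> S' \<Longrightarrow> tree_path G D A sc S' v p"
  by (induction p arbitrary: v) auto

lemma tree_path_fun_upd:
  "tree_path G D A sc S v p \<Longrightarrow> u \<notin> S \<Longrightarrow> v \<noteq> u \<Longrightarrow> tree_path G D A (sc(u := a)) S v p"
  by (induction p arbitrary: v) auto

lemma tree_path_settled:
  "tree_path G D A sc S v p \<Longrightarrow> v \<in> S \<Longrightarrow> D \<in> S \<and> set (pre_digraph.awalk_verts G v p) \<subseteq> S"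
  by (induction p arbitrary: v) (auto simp: pre_digraph.awalk_verts.simps)

lemma (in wf_digraph) tree_path_apath:
  "tree_path G D A sc S v p \<Longrightarrow> A \<subseteq> arcs G \<Longrightarrow> v \<in> verts G \<Longrightarrow>
     apath v p D \<and> set p \<subseteq> A"
proof (induction p arbitrary: v)
  case (Cons a p)
  then have "a \<in> arcs G" by auto
  moreover have "apath (head G a) p D \<and> set p \<subseteq> A"
    using Cons.IH [of "head G a"] Cons.prems calculation by simp
  ultimately show ?case using Cons.prems by (simp add: apath_Cons_iff)
qed (simp add: apath_Nil_iff)

text \<open>
  The invariant of Dijkstra's algorithm, run backwards from \<open>D\<close>: \<open>S\<close> contains the settled and \<open>R\<close> the
  reached vertices, \<open>d\<close> the labels, and \<open>U\<close> the arcs that are not yet relaxed although their heads are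
  settled.
\<close>

definition search_inv :: "('v, 'a) pre_digraph \<Rightarrow> 'v \<Rightarrow> 'a set \<Rightarrow> ('a \<Rightarrow> real) \<Rightarrow>
    'v set \<Rightarrow> 'v set \<Rightarrow> 'a set \<Rightarrow> ('v \<Rightarrow> real) \<Rightarrow> ('v \<Rightarrow> 'a) \<Rightarrow> bool" where
  "search_inv G D A w S R U d sc \<longleftrightarrow>
     S \<subseteq> R \<and> R \<subseteq> verts G \<and> D \<in> R \<and>
     (\<forall>v\<in>S. \<forall>u\<in>R - S. d v \<le> d u) \<and>
     (\<forall>v\<in>R. \<exists>p. tree_path G D A sc S v p \<and> d v = sum_list (map w p)) \<and>
     (\<forall>a\<in>A - U. head G a \<in> S \<longrightarrow> tail G a \<in> R \<and> d (tail G a) \<le> w a + d (head G a))"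

lemma search_init:
  assumes "D \<in> verts G" "d D = 0"
  shows "search_inv G D A w {} {D} {} d sc"
  using assms by (auto simp: search_inv_def intro!: exI [of _ "[]"])

lemma search_select:
  assumes inv: "search_inv G D A w S R {} d sc"
    and v: "v \<in> R - S" "\<And>u. u \<in> R - S \<Longrightarrow> d v \<le> d u"
  shows "search_inv G D A w (insert v S) R {a \<in> A. head G a = v} d sc"
    and "\<forall>u\<in>insert v S. d u \<le> d v"
proof -
  have "\<exists>p. tree_path G D A sc (insert v S) u p \<and> d u = sum_list (map w p)" if u: "u \<in> R" for u
  proof -
    obtain p where p: "tree_path G D A sc S u p" "d u = sum_list (map w p)"
      using inv u unfolding search_inv_def by meson
    show ?thesis using tree_path_mono [OF p(1), of "insert v S"] p(2) by blast
  qed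
  moreover have "\<forall>u\<in>insert v S. \<forall>r\<in>R - insert v S. d u \<le> d r"
    using inv v by (auto simp: search_inv_def)
  ultimately show "search_inv G D A w (insert v S) R {a \<in> A. head G a = v} d sc"
    using inv v unfolding search_inv_def by auto
  show "\<forall>u\<in>insert v S. d u \<le> d v"
    using inv v by (auto simp: search_inv_def)
qed

text \<open>
  A settled vertex is never improved: its label is at most the label of \<open>v\<close>, and the weight of the arc
  is not negative.
\<close>

lemma search_relax:
  assumes inv: "search_inv G D A w S R U d sc"
    and v: "v \<in> S" "\<forall>u\<in>S. d u \<le> d v"
    and a: "a \<in> A" "head G a = v" "tail G a = u" "u \<in> verts G" "0 \<le> w a"
    and improve: "u \<notin> R \<or> w a + d v < d u"
  shows "u \<notin> S"
    and "search_inv G D A w S (insert u R) (U - {a}) (d(u := w a + d v)) (sc(u := a))"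
proof -
  show u: "u \<notin> S"
  proof
    assume "u \<in> S"
    then have "d u \<le> d v" "u \<in> R" using v inv by (auto simp: search_inv_def)
    then show False using improve a by simp
  qed
  have SR: "S \<subseteq> R" "R \<subseteq> verts G" "D \<in> R" "\<And>u r. u \<in> S \<Longrightarrow> r \<in> R - S \<Longrightarrow> d u \<le> d r"
    "\<And>b. b \<in> A - U \<Longrightarrow> head G b \<in> S \<Longrightarrow> tail G b \<in> R \<and> d (tail G b) \<le> w b + d (head G b)"
    using inv unfolding search_inv_def by blast+
  obtain p where p: "tree_path G D A sc S v p" "d v = sum_list (map w p)"
    using inv v SR unfolding search_inv_def by blast
  have D: "D \<in> S" "set (pre_digraph.awalk_verts G v p) \<subseteq> S"
    using tree_path_settled [OF p(1) v(1)] by auto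
  let ?d = "d(u := w a + d v)" and ?sc = "sc(u := a)"
  have paths: "\<exists>p. tree_path G D A ?sc S r p \<and> ?d r = sum_list (map w p)" if r: "r \<in> insert u R" for r
  proof (cases "r = u")
    case True
    have "tree_path G D A ?sc S v p" using tree_path_fun_upd [OF p(1) u] u v by auto
    then have "tree_path G D A ?sc S u (a # p)" using a D u v by auto
    then show ?thesis using True p by (intro exI [of _ "a # p"]) simp
  next
    case False
    then obtain q where "tree_path G D A sc S r q" "d r = sum_list (map w q)"
      using inv r unfolding search_inv_def by blast
    then show ?thesis using tree_path_fun_upd [of G D A sc S r q u a] u False by auto
  qed
  have le: "?d x \<le> ?d r" if "x \<in> S" "r \<in> insert u R - S" for x r
  proof (cases "r = u")
    case True
    then show ?thesis using that u v a(5) by fastforce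
  next
    case False
    then show ?thesis using that u SR(4) [of x r] by auto
  qed
  have closed: "tail G b \<in> insert u R \<and> ?d (tail G b) \<le> w b + ?d (head G b)"
    if b: "b \<in> A - (U - {a})" "head G b \<in> S" for b
  proof (cases "b = a")
    case True
    then show ?thesis using a u v by auto
  next
    case False
    then have "tail G b \<in> R \<and> d (tail G b) \<le> w b + d (head G b)" using SR(5) b by blast
    moreover have "head G b \<noteq> u" using b u by auto
    ultimately show ?thesis using improve by auto
  qed
  show "search_inv G D A w S (insert u R) (U - {a}) ?d ?sc"
    unfolding search_inv_def using SR(1-3) a(4) le paths closed by blast
qed

lemma search_skip:
  assumes "search_inv G D A w S R U d sc"
    and "tail G a \<in> R" "d (tail G a) \<le> w a + d (head G a)"
  shows "search_inv G D A w S R (U - {a}) d sc"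
  using assms unfolding search_inv_def by blast

lemma search_final_path:
  assumes "search_inv G D A w S S U d sc" "v \<in> S"
  obtains p where "tree_path G D A sc S v p" "d v = sum_list (map w p)"
  using assms unfolding search_inv_def by blast

text \<open>
  When no vertex is queued, all arcs into \<open>S\<close> satisfy the triangle inequality of the labels. Summing it
  along a walk to \<open>D\<close> shows that its start is reached and that the walk is not cheaper than the label.
\<close>

lemma search_final_le:
  assumes inv: "search_inv G D A w S S {} d sc"
  shows "pre_digraph.cas G v q D \<Longrightarrow> set q \<subseteq> A \<Longrightarrow> v \<in> S \<and> d v \<le> sum_list (map w q)"
proof (induction q arbitrary: v)
  case Nil
  then have v: "v = D" by (simp add: pre_digraph.cas.simps)
  have D: "D \<in> S" using inv by (simp add: search_inv_def)
  then obtain p where p: "tree_path G D A sc S D p" "d D = sum_list (map w p)"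
    using search_final_path [OF inv] by blast
  then have "d D = 0" by (cases p) auto
  then show ?case using v D by simp
next
  case (Cons a q)
  then have a: "tail G a = v" "pre_digraph.cas G (head G a) q D" "a \<in> A"
    by (auto simp: pre_digraph.cas.simps)
  then have "head G a \<in> S" "d (head G a) \<le> sum_list (map w q)" using Cons by auto
  moreover have "head G a \<in> S \<Longrightarrow> tail G a \<in> S \<and> d (tail G a) \<le> w a + d (head G a)"
    using inv a(3) unfolding search_inv_def by blast
  ultimately show ?case using a(1) by simp
qed

section \<open>Intervals as shortest path problems\<close>

definition same_ends :: "('v, 'a) pricing \<Rightarrow> nat \<Rightarrow> nat \<Rightarrow> bool" where
  "same_ends I a b \<longleftrightarrow>
     (\<forall>t\<in>{a..b}. origin I t = origin I a \<and> destination I t = destination I a)"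

definition common_arcs :: "('v, 'a) pricing \<Rightarrow> nat \<Rightarrow> nat \<Rightarrow> 'a set" where
  "common_arcs I a b = {e. \<forall>t\<in>{a..b}. e \<in> allowed I t}"

definition interval_weight :: "('v, 'a) pricing \<Rightarrow> nat \<Rightarrow> nat \<Rightarrow> 'a \<Rightarrow> real" where
  "interval_weight I a b e = (\<Sum>t = a..b. - demand I * dual I e t)"

lemma cas_end_unique:
  "pre_digraph.cas G u q v \<Longrightarrow> pre_digraph.cas G u q v' \<Longrightarrow> v = v'"
  by (induction q arbitrary: u) (auto simp: pre_digraph.cas.simps)

text \<open>
  The first vertex and the arcs of a path determine its last vertex. So a path can be valid at several
  time steps only if they share the origin and the destination.
\<close>

lemma valid_path_on_iff:
  assumes "a \<le> b"
  shows "valid_path_on I a b p \<longleftrightarrow> same_ends I a b \<and> fst p = origin I b \<and>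
    pre_digraph.apath (graph I) (origin I b) (snd p) (destination I b) \<and>
    set (snd p) \<subseteq> common_arcs I a b" (is "?l \<longleftrightarrow> ?r")
proof
  assume l: ?l
  have at: "valid_path_at I t p" if "t \<in> {a..b}" for t
    using l that by (auto simp: valid_path_on_def)
  have eq: "origin I t = origin I a \<and> destination I t = destination I a" if t: "t \<in> {a..b}" for t
  proof -
    have 1: "pre_digraph.cas (graph I) (fst p) (snd p) (destination I s)" "fst p = origin I s"
      if "s \<in> {a..b}" for s
      using at [OF that]
      by (auto simp: valid_path_at_def pre_digraph.apath_def pre_digraph.awalk_def)
    have "destination I t = destination I a"
      by (rule cas_end_unique [OF 1(1) [OF t] 1(1)]) (use assms in simp)
    then show ?thesis using 1(2) [OF t] 1(2) [of a] assms by simp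
  qed
  have "same_ends I a b" using eq unfolding same_ends_def by blast
  moreover have "set (snd p) \<subseteq> common_arcs I a b"
    using at unfolding common_arcs_def valid_path_at_def by blast
  moreover have "valid_path_at I b p" using at assms by simp
  ultimately show ?r unfolding valid_path_at_def by blast
next
  assume r: ?r
  show ?l
    unfolding valid_path_on_def
  proof
    fix t assume t: "t \<in> {a..b}"
    have "b \<in> {a..b}" using assms by simp
    then have "origin I t = origin I b" "destination I t = destination I b"
      using r t unfolding same_ends_def by metis+
    moreover have "set (snd p) \<subseteq> allowed I t" using r t unfolding common_arcs_def by blast
    ultimately show "valid_path_at I t p" using r by (simp add: valid_path_at_def)
  qed
qed

text \<open>
  The arcs of a path without repeated vertices are distinct, so the cost of an interval is the sum of
  arc weights in which the time steps are already added up.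
\<close>

lemma interval_cost_eq_weight:
  assumes "wf_digraph (graph I)" "pre_digraph.apath (graph I) u (snd p) v"
  shows "interval_cost I a b p = sum_list (map (interval_weight I a b) (snd p))"
proof -
  have "distinct (snd p)"
    using wf_digraph.distinct_verts_imp_distinct [OF assms(1)] assms(2)
    unfolding pre_digraph.apath_def by blast
  then have "sum_list (map (interval_weight I a b) (snd p)) = (\<Sum>e\<in>set (snd p). interval_weight I a b e)"
    by (simp add: sum_list_distinct_conv_sum_set)
  also have "\<dots> = (\<Sum>t = a..b. \<Sum>e\<in>set (snd p). - demand I * dual I e t)"
    unfolding interval_weight_def by (rule sum.swap)
  also have "\<dots> = interval_cost I a b p"
    by (simp add: interval_cost_def sum_distrib_left sum_negf)
  finally show ?thesis by simp
qed

lemma search_result: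
  assumes wf: "wf_digraph (graph I)" and ab: "a \<le> b"
    and arcs: "common_arcs I a b \<subseteq> arcs (graph I)"
    and O: "origin I b \<in> verts (graph I)"
    and inv: "search_inv (graph I) (destination I b) (common_arcs I a b) (interval_weight I a b)
      S S {} d sc"
  shows "\<not> (same_ends I a b \<and> origin I b \<in> S) \<Longrightarrow> \<not> (\<exists>p. valid_path_on I a b p)"
    and "same_ends I a b \<Longrightarrow> tree_path (graph I) (destination I b) (common_arcs I a b) sc S
        (origin I b) p \<Longrightarrow> d (origin I b) = sum_list (map (interval_weight I a b) p) \<Longrightarrow>
      lowest_cost_path I a b (origin I b, p) \<and>
      interval_cost I a b (origin I b, p) = d (origin I b)"
proof -
  let ?G = "graph I" and ?O = "origin I b" and ?D = "destination I b"
  have le: "?O \<in> S \<and> d ?O \<le> sum_list (map (interval_weight I a b) (snd q))"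
    if "valid_path_on I a b q" for q
    using search_final_le [OF inv, of ?O "snd q"] that ab
    by (simp add: valid_path_on_iff pre_digraph.apath_def pre_digraph.awalk_def)
  show "\<not> (same_ends I a b \<and> ?O \<in> S) \<Longrightarrow> \<not> (\<exists>p. valid_path_on I a b p)"
    using le valid_path_on_iff [OF ab, of I] by blast
  assume same: "same_ends I a b" and p: "tree_path ?G ?D (common_arcs I a b) sc S ?O p"
    and d: "d ?O = sum_list (map (interval_weight I a b) p)"
  have "pre_digraph.apath ?G ?O p ?D \<and> set p \<subseteq> common_arcs I a b"
    using wf_digraph.tree_path_apath [OF wf p arcs O] .
  then have "valid_path_on I a b (?O, p)" "interval_cost I a b (?O, p) = d ?O"
    using same ab d interval_cost_eq_weight [OF wf, of ?O "(?O, p)"] by (auto simp: valid_path_on_iff)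
  moreover have "d ?O \<le> interval_cost I a b q" if "valid_path_on I a b q" for q
  proof -
    have "pre_digraph.apath ?G ?O (snd q) ?D" using that ab by (simp add: valid_path_on_iff)
    then show ?thesis using le [OF that] interval_cost_eq_weight [OF wf] by metis
  qed
  ultimately show "lowest_cost_path I a b (?O, p) \<and> interval_cost I a b (?O, p) = d ?O"
    by (simp add: lowest_cost_path_def)
qed

section \<open>Repairing a tournament tree on the machine\<close>

fun block :: "com list \<Rightarrow> com" where
  "block [] = Skip"
| "block [c] = c"
| "block (c # cs) = Seq c (block cs)"

abbreviation "increment x \<equiv> SetNReg x (NAdd (NReg x) (NNum 1))"
abbreviation "BOr b c \<equiv> BNot (BAnd (BNot b) (BNot c))"

text \<open>
  The parent is read from a table, because halving is not an operation of the machine.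
\<close>

definition repair_step :: com where
  "repair_step = block [
     SetNReg ''c'' (NAdd (NReg ''i'') (NReg ''i'')),
     Cond (BOr (NEq (NArr ''tree'' (NReg ''c'')) (NNum 0))
             (BAnd (BNot (NEq (NArr ''tree'' (NAdd (NReg ''c'') (NNum 1))) (NNum 0)))
               (RLess (RArr ''key'' (NAdd (NReg ''c'') (NNum 1))) (RArr ''key'' (NReg ''c'')))))
       (increment ''c'') Skip,
     SetNArr ''tree'' (NReg ''i'') (NArr ''tree'' (NReg ''c'')),
     SetRArr ''key'' (NReg ''i'') (RArr ''key'' (NReg ''c'')),
     SetNReg ''i'' (NArr ''parent'' (NReg ''i''))]"

definition repair :: com where
  "repair = While (NLess (NNum 0) (NReg ''i'')) repair_step"

lemma writes_repair: "writes repair = {''c'', ''i'', ''tree'', ''key''}"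
  by (auto simp: repair_def repair_step_def)

lemma repair_step_effect:
  "effect repair_step s = (let i = nreg s ''i''; t = narr s ''tree''; k = rarr s ''key'';
     c = (if t (2 * i) = 0 \<or> t (2 * i + 1) \<noteq> 0 \<and> k (2 * i + 1) < k (2 * i) then 2 * i + 1 else 2 * i)
   in s\<lparr>nreg := (nreg s)(''c'' := c, ''i'' := narr s ''parent'' i),
        narr := (narr s)(''tree'' := t(i := t c)), rarr := (rarr s)(''key'' := k(i := k c))\<rparr>)"
  by (simp add: repair_step_def Let_def mult_2)

lemma runs_repair:
  assumes "tournament_except N (narr s ''tree'') (rarr s ''key'') (ancestors (nreg s ''i''))"
    and "nreg s ''i'' < N" and par: "\<And>j. j \<in> {1..<2 * N} \<Longrightarrow> narr s ''parent'' j = j div 2"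
    and L: "L = floor_log N + 1"
  shows "runs repair s (60 * L + 4) (\<lambda>s'. tournament N (narr s' ''tree'') (rarr s' ''key'') \<and>
    (\<forall>j\<ge>N. narr s' ''tree'' j = narr s ''tree'' j \<and> rarr s' ''key'' j = rarr s ''key'' j))"
proof -
  let ?Inv = "\<lambda>n s'. tournament_except N (narr s' ''tree'') (rarr s' ''key'') (ancestors (nreg s' ''i'')) \<and>
    nreg s' ''i'' < N \<and> n = (if nreg s' ''i'' = 0 then 0 else floor_log (nreg s' ''i'') + 1) \<and>
    narr s' ''parent'' = narr s ''parent'' \<and>
    (\<forall>j\<ge>N. narr s' ''tree'' j = narr s ''tree'' j \<and> rarr s' ''key'' j = rarr s ''key'' j)"
  show ?thesis
    unfolding repair_def
  proof (rule runs_While_count [where Inv = ?Inv and l = 50])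
    show "?Inv (if nreg s ''i'' = 0 then 0 else floor_log (nreg s ''i'') + 1) s"
      using assms by simp
  next
    fix n s' assume inv: "?Inv n s'" and "bval (NLess (NNum 0) (NReg ''i'')) s'"
    then have i: "0 < nreg s' ''i''" "nreg s' ''i'' < N" by auto
    define i where "i = nreg s' ''i''"
    define m where "m = floor_log i"
    have m: "n = Suc m" using inv i by (simp add: m_def i_def)
    have half: "narr s' ''parent'' i = i div 2"
      using par [of i] inv i by (simp add: i_def)
    have fl: "m = (if i div 2 = 0 then 0 else floor_log (i div 2) + 1)"
    proof (cases "i = 1")
      case False
      then have "2 \<le> i" using i by (simp add: i_def)
      then show ?thesis using floor_log_rec [of i] by (simp add: m_def del: floor_log_half)
    qed (simp add: m_def)
    define t k where "t = narr s' ''tree''" and "k = rarr s' ''key''"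
    define c where "c = (if t (2 * i) = 0 \<or> t (2 * i + 1) \<noteq> 0 \<and> k (2 * i + 1) < k (2 * i)
      then 2 * i + 1 else 2 * i)"
    have "tournament_except N (t(i := t c)) (k(i := k c)) (ancestors (i div 2))"
      using inv i c_def unfolding t_def k_def i_def
      by (intro tournament_repair_node) auto
    moreover have "effect repair_step s' = s'\<lparr>nreg := (nreg s')(''c'' := c, ''i'' := i div 2),
        narr := (narr s')(''tree'' := t(i := t c)), rarr := (rarr s')(''key'' := k(i := k c))\<rparr>"
      unfolding repair_step_effect Let_def using half by (simp add: t_def k_def i_def c_def)
    ultimately have "?Inv m (effect repair_step s')"
      using inv i fl by (auto simp: i_def t_def k_def)
    then have "runs repair_step s' 50 (?Inv m)"
      by (rule runs_effect [rotated 2]) (simp_all add: repair_step_def)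
    then show "\<exists>m. n = Suc m \<and> runs repair_step s' 50 (?Inv m)" using m by blast
  next
    have "floor_log (nreg s ''i'') \<le> floor_log N" using assms(2) by (intro floor_log_le_iff) simp
    then show "(if nreg s ''i'' = 0 then 0 else floor_log (nreg s ''i'') + 1) *
        (1 + bcost (NLess (NNum 0) (NReg ''i'')) + 50) + 1 + bcost (NLess (NNum 0) (NReg ''i''))
        \<le> 60 * L + 4"
      using L by simp
  next
    fix n s' assume "?Inv n s'" "\<not> bval (NLess (NNum 0) (NReg ''i'')) s'"
    then show "tournament N (narr s' ''tree'') (rarr s' ''key'') \<and>
      (\<forall>j\<ge>N. narr s' ''tree'' j = narr s ''tree'' j \<and> rarr s' ''key'' j = rarr s ''key'' j)" by simp
  qed
qed

lemma runs_repair_leaf: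
  assumes tour: "tournament N t k" and v: "v < N" "x = 0 \<or> x = v + 1"
    and s: "narr s ''tree'' = t(N + v := x)" "rarr s ''key'' = k(N + v := y)"
      "nreg s ''i'' = (N + v) div 2"
    and par: "\<And>j. j \<in> {1..<2 * N} \<Longrightarrow> narr s ''parent'' j = j div 2"
    and L: "L = floor_log N + 1"
  shows "runs repair s (60 * L + 4) (\<lambda>s'. tournament N (narr s' ''tree'') (rarr s' ''key'') \<and>
    (\<forall>u. narr s' ''tree'' (N + u) = (t(N + v := x)) (N + u) \<and>
      rarr s' ''key'' (N + u) = (k(N + v := y)) (N + u)) \<and>
    unchanged {''c'', ''i'', ''tree'', ''key''} s s')"
proof -
  have "runs repair s (60 * L + 4) (\<lambda>s'. tournament N (narr s' ''tree'') (rarr s' ''key'') \<and>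
    (\<forall>j\<ge>N. narr s' ''tree'' j = narr s ''tree'' j \<and> rarr s' ''key'' j = rarr s ''key'' j))"
    using tournament_change_leaf [OF tour v, of y] v(1) par L by (intro runs_repair) (simp_all add: s)
  from runs_frame [OF this] show ?thesis
    by (rule runs_mono) (simp_all add: s writes_repair)
qed

section \<open>Dijkstra's algorithm on the machine\<close>

definition search_state :: "(nat, nat) pre_digraph \<Rightarrow> nat \<Rightarrow> nat set \<Rightarrow> (nat \<Rightarrow> real) \<Rightarrow>
    nat set \<Rightarrow> nat set \<Rightarrow> nat set \<Rightarrow> state \<Rightarrow> bool" where
  "search_state G D A w S R U s \<longleftrightarrow> (let N = card (verts G) in
     tournament N (narr s ''tree'') (rarr s ''key'') \<and>
     (\<forall>v<N. narr s ''reached'' v \<noteq> 0 \<longleftrightarrow> v \<in> R) \<and>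
     (\<forall>v<N. narr s ''tree'' (N + v) \<noteq> 0 \<longleftrightarrow> v \<in> R - S) \<and>
     search_inv G D A w S R U (\<lambda>v. rarr s ''key'' (N + v)) (narr s ''succ''))"

text \<open>
  What the search reads and never changes, where \<open>adj v\<close> lists the usable arcs into \<open>v\<close>.
\<close>

definition search_env :: "(nat, nat) pre_digraph \<Rightarrow> nat set \<Rightarrow> (nat \<Rightarrow> real) \<Rightarrow>
    (nat \<Rightarrow> nat list) \<Rightarrow> state \<Rightarrow> bool" where
  "search_env G A w adj s \<longleftrightarrow>
     verts G = {..<card (verts G)} \<and> (\<forall>a\<in>A. tail G a \<in> verts G \<and> head G a \<in> verts G \<and> 0 \<le> w a) \<and>
     nreg s ''V'' = card (verts G) \<and>
     (\<forall>i\<in>{1..<2 * card (verts G)}. narr s ''parent'' i = i div 2) \<and>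
     (\<forall>a\<in>A. narr s ''tail'' a = tail G a \<and> narr s ''head'' a = head G a \<and>
       rarr s ''weight'' a = w a) \<and>
     (\<forall>v\<in>verts G. linked (narr s ''next'') (narr s ''bucket'' v) (adj v) \<and>
       set (adj v) = {a \<in> A. head G a = v})"

lemma search_env_unchanged:
  assumes "search_env G A w adj s" "unchanged X s s'"
    and "X \<inter> {''V'', ''parent'', ''tail'', ''head'', ''weight'', ''next'', ''bucket''} = {}"
  shows "search_env G A w adj s'"
proof -
  have "nreg s' ''V'' = nreg s ''V''" "narr s' ''parent'' = narr s ''parent''"
    "narr s' ''tail'' = narr s ''tail''" "narr s' ''head'' = narr s ''head''"
    "rarr s' ''weight'' = rarr s ''weight''" "narr s' ''next'' = narr s ''next''"
    "narr s' ''bucket'' = narr s ''bucket''"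
    using assms(2,3) unfolding unchanged_def by blast+
  then show ?thesis using assms(1) by (simp add: search_env_def)
qed

definition relax_enter :: com where
  "relax_enter = block [
     SetNArr ''reached'' (NReg ''u'') (NNum 1),
     SetNArr ''succ'' (NReg ''u'') (NReg ''a''),
     SetNArr ''tree'' (NReg ''l'') (NAdd (NReg ''u'') (NNum 1)),
     SetRArr ''key'' (NReg ''l'') (RReg ''x''),
     SetNReg ''i'' (NArr ''parent'' (NReg ''l''))]"

definition relax_prepare :: com where
  "relax_prepare = block [
     SetNReg ''a'' (NSub (NReg ''e'') (NNum 1)),
     SetNReg ''u'' (NArr ''tail'' (NReg ''a'')),
     SetNReg ''l'' (NAdd (NReg ''V'') (NReg ''u'')),
     SetRReg ''x'' (RAdd (RArr ''weight'' (NReg ''a'')) (RArr ''key'' (NAdd (NReg ''V'') (NReg ''v'')))),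
     SetNReg ''e'' (NArr ''next'' (NReg ''a''))]"

definition relax :: com where
  "relax = Seq relax_prepare
     (Cond (BOr (NEq (NArr ''reached'' (NReg ''u'')) (NNum 0))
             (RLess (RReg ''x'') (RArr ''key'' (NReg ''l''))))
       (Seq relax_enter repair) Skip)"

lemma writes_relax: "writes relax =
    {''a'', ''u'', ''l'', ''x'', ''e'', ''reached'', ''succ'', ''tree'', ''key'', ''c'', ''i''}"
  by (auto simp: relax_def relax_enter_def relax_prepare_def writes_repair)

text \<open>
  A vertex that is relabelled is not settled. So the labels in \<open>S\<close> persist, and with them the fact that
  the vertex being scanned has the highest label in \<open>S\<close>.
\<close>

lemma runs_relax:
  assumes env: "search_env G A w adj s" and st: "search_state G D A w S R U s"
    and e: "nreg s ''e'' = a + 1" and a: "a \<in> A" "head G a = nreg s ''v''" and v: "nreg s ''v'' \<in> S"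
    and mx: "\<forall>u\<in>S. rarr s ''key'' (card (verts G) + u) \<le> rarr s ''key'' (card (verts G) + nreg s ''v'')"
    and L: "L = floor_log (card (verts G)) + 1"
  shows "runs relax s (60 * L + 80) (\<lambda>s'. (\<exists>R'. search_state G D A w S R' (U - {a}) s') \<and>
     nreg s' ''e'' = narr s ''next'' a \<and>
     (\<forall>u\<in>S. rarr s' ''key'' (card (verts G) + u) = rarr s ''key'' (card (verts G) + u)))"
proof -
  define N where "N = card (verts G)"
  define v where "v = nreg s ''v''"
  define u where "u = tail G a"
  define d where "d = (\<lambda>v. rarr s ''key'' (N + v))"
  define s1 where "s1 = effect relax_prepare s"
  have V: "verts G = {..<N}" and u: "u < N" and tw: "narr s ''tail'' a = u" "rarr s ''weight'' a = w a"
    and NV: "nreg s ''V'' = N" and w: "0 \<le> w a"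
    using env a by (auto simp: search_env_def N_def u_def)
  have s1: "s1 = s\<lparr>nreg := (nreg s)(''a'' := a, ''u'' := u, ''l'' := N + u, ''e'' := narr s ''next'' a),
      rreg := (rreg s)(''x'' := w a + d v)\<rparr>"
    using e tw NV by (simp add: s1_def relax_prepare_def d_def v_def fun_upd_twist)
  have st': "tournament N (narr s ''tree'') (rarr s ''key'')"
    "\<And>v. v < N \<Longrightarrow> narr s ''reached'' v \<noteq> 0 \<longleftrightarrow> v \<in> R"
    "\<And>v. v < N \<Longrightarrow> narr s ''tree'' (N + v) \<noteq> 0 \<longleftrightarrow> v \<in> R - S"
    "search_inv G D A w S R U d (narr s ''succ'')"
    using st by (auto simp: search_state_def N_def Let_def d_def)
  have vS: "v \<in> S" "\<forall>u\<in>S. d u \<le> d v" "head G a = v" using v mx a by (auto simp: v_def d_def N_def)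
  let ?Q = "\<lambda>s'. (\<exists>R'. search_state G D A w S R' (U - {a}) s') \<and>
     nreg s' ''e'' = narr s ''next'' a \<and> (\<forall>u\<in>S. rarr s' ''key'' (N + u) = rarr s ''key'' (N + u))"
  let ?b = "BOr (NEq (NArr ''reached'' (NReg ''u'')) (NNum 0))
             (RLess (RReg ''x'') (RArr ''key'' (NReg ''l'')))"
  have b: "bval ?b s1 \<longleftrightarrow> u \<notin> R \<or> w a + d v < d u"
    using st'(2) u by (auto simp: s1 d_def)
  have "runs relax s (25 + (1 + bcost ?b + (21 + (60 * L + 4)))) ?Q"
    unfolding relax_def
  proof (rule runs_Seq)
    show "runs relax_prepare s 25 (\<lambda>s'. s' = s1)"
      by (rule runs_effect) (simp_all add: relax_prepare_def s1_def)
  next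
    fix s' assume "s' = s1"
    have "runs (Cond ?b (Seq relax_enter repair) Skip) s1 (1 + bcost ?b + (21 + (60 * L + 4))) ?Q"
    proof (rule runs_Cond)
      assume "bval ?b s1"
      then have imp: "u \<notin> R \<or> w a + d v < d u" using b by simp
      have uS: "u \<notin> S" and inv: "search_inv G D A w S (insert u R) (U - {a})
          (d(u := w a + d v)) ((narr s ''succ'')(u := a))"
        using search_relax [OF st'(4) vS(1,2) a(1) vS(3) _ _ w imp] u V by (auto simp: u_def)
      define s2 where "s2 = effect relax_enter s1"
      have par: "\<And>j. j \<in> {1..<2 * N} \<Longrightarrow> narr s ''parent'' j = j div 2"
        using env by (simp add: search_env_def N_def)
      have s2: "s2 = s1\<lparr>nreg := (nreg s1)(''i'' := (N + u) div 2),
          narr := (narr s)(''reached'' := (narr s ''reached'')(u := 1),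
            ''succ'' := (narr s ''succ'')(u := a), ''tree'' := (narr s ''tree'')(N + u := u + 1)),
          rarr := (rarr s)(''key'' := (rarr s ''key'')(N + u := w a + d v))\<rparr>"
        using u par [of "N + u"] by (simp add: s2_def relax_enter_def s1)
      show "runs (Seq relax_enter repair) s1 (21 + (60 * L + 4)) ?Q"
      proof (rule runs_Seq)
        show "runs relax_enter s1 21 (\<lambda>s'. s' = s2)"
          by (rule runs_effect) (simp_all add: relax_enter_def s2_def)
      next
        fix s' assume "s' = s2"
        show "runs repair s' (60 * L + 4) ?Q"
          unfolding \<open>s' = s2\<close>
        proof (rule runs_mono [OF runs_repair_leaf [OF st'(1) u, where x = "u + 1" and y = "w a + d v"]])
          show "\<And>j. j \<in> {1..<2 * N} \<Longrightarrow> narr s2 ''parent'' j = j div 2"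
            using par by (simp add: s2)
          show "L = floor_log N + 1" by (simp add: L N_def)
        next
          fix s' assume *: "tournament N (narr s' ''tree'') (rarr s' ''key'') \<and>
             (\<forall>x. narr s' ''tree'' (N + x) = ((narr s ''tree'')(N + u := u + 1)) (N + x) \<and>
               rarr s' ''key'' (N + x) = ((rarr s ''key'')(N + u := w a + d v)) (N + x)) \<and>
             unchanged {''c'', ''i'', ''tree'', ''key''} s2 s'"
          then have fr: "narr s' ''reached'' = narr s2 ''reached''" "narr s' ''succ'' = narr s2 ''succ''"
              "nreg s' ''e'' = nreg s2 ''e''"
            by (simp_all add: unchanged_def)
          have key: "(\<lambda>v. rarr s' ''key'' (N + v)) = d(u := w a + d v)"
            using * by (auto simp: d_def)
          have tr: "narr s' ''tree'' (N + x) = ((narr s ''tree'')(N + u := u + 1)) (N + x)" for x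
            using * by blast
          have "search_state G D A w S (insert u R) (U - {a}) s'"
            unfolding search_state_def Let_def N_def [symmetric] key tr
            using * inv st'(2,3) uS by (auto simp: fr s2)
          moreover have "\<forall>x\<in>S. rarr s' ''key'' (N + x) = rarr s ''key'' (N + x)"
            using key uS by (metis d_def fun_upd_other)
          ultimately show "?Q s'" by (auto simp: fr s2 s1)
        qed (simp_all add: s2 s1)
      qed
    next
      assume "\<not> bval ?b s1"
      then have "u \<in> R" "d u \<le> w a + d v" using b by auto
      then have "search_inv G D A w S R (U - {a}) d (narr s ''succ'')"
        using search_skip [OF st'(4)] vS by (simp add: u_def)
      then have "search_state G D A w S R (U - {a}) s1"
        using st' by (simp add: search_state_def Let_def N_def [symmetric] s1 d_def)
      then have "?Q s1" by (auto simp: s1)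
      then show "runs Skip s1 (21 + (60 * L + 4)) ?Q"
        by (intro runs_effect) auto
    qed
    then show "runs (Cond ?b (Seq relax_enter repair) Skip) s' (1 + bcost ?b + (21 + (60 * L + 4))) ?Q"
      using \<open>s' = s1\<close> by simp
  qed
  then show ?thesis unfolding N_def [symmetric] by (rule runs_mono) auto
qed

lemma search_state_mono:
  assumes "search_state G D A w S R U s" "U \<subseteq> U'"
  shows "search_state G D A w S R U' s"
  using assms unfolding search_state_def search_inv_def Let_def by blast

definition scan :: com where
  "scan = While (NLess (NNum 0) (NReg ''e'')) relax"

lemma writes_scan: "writes scan =
    {''a'', ''u'', ''l'', ''x'', ''e'', ''reached'', ''succ'', ''tree'', ''key'', ''c'', ''i''}"
  by (simp add: scan_def writes_relax)

lemma runs_scan: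
  assumes env: "search_env G A w adj s" and v: "nreg s ''v'' = v" "v \<in> S"
    and st: "search_state G D A w S R (set as) s"
    and as: "linked (narr s ''next'') (nreg s ''e'') as" "set as \<subseteq> {a \<in> A. head G a = v}"
    and mx: "\<forall>u\<in>S. rarr s ''key'' (card (verts G) + u) \<le> rarr s ''key'' (card (verts G) + v)"
    and L: "L = floor_log (card (verts G)) + 1"
  shows "runs scan s (length as * (60 * L + 84) + 4)
    (\<lambda>s'. \<exists>R'. search_state G D A w S R' {} s')"
proof -
  let ?N = "card (verts G)"
  let ?Inv = "\<lambda>n s'. \<exists>R as. n = length as \<and> nreg s' ''v'' = v \<and> search_env G A w adj s' \<and>
    search_state G D A w S R (set as) s' \<and> linked (narr s' ''next'') (nreg s' ''e'') as \<and>
    set as \<subseteq> {a \<in> A. head G a = v} \<and>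
    (\<forall>u\<in>S. rarr s' ''key'' (?N + u) \<le> rarr s' ''key'' (?N + v))"
  show ?thesis
    unfolding scan_def
  proof (rule runs_While_count [where Inv = ?Inv and l = "60 * L + 80"])
    show "?Inv (length as) s" using assms by blast
  next
    fix n s' assume "?Inv n s'" and "bval (NLess (NNum 0) (NReg ''e'')) s'"
    then obtain R as where inv: "n = length as" "nreg s' ''v'' = v" "search_env G A w adj s'"
      "search_state G D A w S R (set as) s'" "linked (narr s' ''next'') (nreg s' ''e'') as"
      "set as \<subseteq> {a \<in> A. head G a = v}"
      "\<forall>u\<in>S. rarr s' ''key'' (?N + u) \<le> rarr s' ''key'' (?N + v)" and e: "0 < nreg s' ''e''"
      by auto
    then obtain a as' where as: "as = a # as'" by (cases as) auto
    have ea: "nreg s' ''e'' = a + 1" "linked (narr s' ''next'') (narr s' ''next'' a) as'"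
      and a: "a \<in> A" "head G a = v"
      using inv as by auto
    have "runs relax s' (60 * L + 80) (\<lambda>s''. (\<exists>R'. search_state G D A w S R' (set as - {a}) s'') \<and>
       nreg s'' ''e'' = narr s' ''next'' a \<and>
       (\<forall>u\<in>S. rarr s'' ''key'' (?N + u) = rarr s' ''key'' (?N + u)))"
      by (rule runs_relax [OF inv(3,4) ea(1) a(1) _ _ _ L]) (use inv a v in auto)
    from runs_frame [OF this] have "runs relax s' (60 * L + 80) (?Inv (length as'))"
    proof (rule runs_mono)
      fix s'' assume *: "((\<exists>R'. search_state G D A w S R' (set as - {a}) s'') \<and>
       nreg s'' ''e'' = narr s' ''next'' a \<and>
       (\<forall>u\<in>S. rarr s'' ''key'' (?N + u) = rarr s' ''key'' (?N + u))) \<and>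
       unchanged (writes relax) s' s''"
      then obtain R' where "search_state G D A w S R' (set as - {a}) s''" by blast
      then have "search_state G D A w S R' (set as') s''"
        by (rule search_state_mono) (auto simp: as)
      moreover have "nreg s'' ''v'' = v" "narr s'' ''next'' = narr s' ''next''"
        using * inv(2) by (simp_all add: unchanged_def writes_relax)
      moreover have "search_env G A w adj s''"
        by (rule search_env_unchanged [OF inv(3), of "writes relax"])
          (use * in \<open>auto simp: writes_relax\<close>)
      ultimately show "?Inv (length as') s''"
        using * ea inv(6,7) as v(2) by (intro exI [of _ R'] exI [of _ as']) auto
    qed simp
    then show "\<exists>m. n = Suc m \<and> runs relax s' (60 * L + 80) (?Inv m)"
      using inv(1) as by (intro exI [of _ "length as'"]) simp
  next
    show "length as * (1 + bcost (NLess (NNum 0) (NReg ''e'')) + (60 * L + 80)) + 1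
        + bcost (NLess (NNum 0) (NReg ''e'')) \<le> length as * (60 * L + 84) + 4"
      by (simp add: algebra_simps)
  next
    fix n s' assume "?Inv n s'" and b: "\<not> bval (NLess (NNum 0) (NReg ''e'')) s'"
    then obtain R as where "search_state G D A w S R (set as) s'"
      "linked (narr s' ''next'') (nreg s' ''e'') as" by blast
    moreover from this b have "as = []" by (cases as) auto
    ultimately show "\<exists>R'. search_state G D A w S R' {} s'" by auto
  qed
qed

definition settle_start :: com where
  "settle_start = block [
     SetNReg ''v'' (NSub (NArr ''tree'' (NNum 1)) (NNum 1)),
     SetNReg ''l'' (NAdd (NReg ''V'') (NReg ''v'')),
     SetNArr ''tree'' (NReg ''l'') (NNum 0),
     SetNReg ''i'' (NArr ''parent'' (NReg ''l'')),
     SetNReg ''e'' (NArr ''bucket'' (NReg ''v''))]"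

definition settle :: com where
  "settle = Seq settle_start (Seq repair scan)"

lemma writes_settle: "writes settle =
    {''a'', ''u'', ''l'', ''x'', ''e'', ''reached'', ''succ'', ''tree'', ''key'', ''c'', ''i'', ''v''}"
  by (auto simp: settle_def settle_start_def writes_repair writes_scan)

lemma runs_settle:
  assumes env: "search_env G A w adj s" and st: "search_state G D A w S R {} s"
    and root: "narr s ''tree'' 1 \<noteq> 0" and ne: "0 < card (verts G)"
    and L: "L = floor_log (card (verts G)) + 1"
  shows "\<exists>v<card (verts G). v \<notin> S \<and>
    runs settle s (60 * L + 40 + length (adj v) * (60 * L + 84))
      (\<lambda>s'. \<exists>R'. search_state G D A w (insert v S) R' {} s')"
proof -
  define N where "N = card (verts G)"
  define d where "d = (\<lambda>v. rarr s ''key'' (N + v))"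
  have st': "tournament N (narr s ''tree'') (rarr s ''key'')"
    "\<And>v. v < N \<Longrightarrow> narr s ''reached'' v \<noteq> 0 \<longleftrightarrow> v \<in> R"
    "\<And>v. v < N \<Longrightarrow> narr s ''tree'' (N + v) \<noteq> 0 \<longleftrightarrow> v \<in> R - S"
    "search_inv G D A w S R {} d (narr s ''succ'')"
    using st by (auto simp: search_state_def N_def Let_def d_def)
  obtain v where v: "v < N" "narr s ''tree'' 1 = v + 1" "narr s ''tree'' (N + v) = v + 1"
    "\<And>u. u < N \<Longrightarrow> narr s ''tree'' (N + u) \<noteq> 0 \<Longrightarrow> d v \<le> d u"
    using tournament_root_min [OF st'(1) root] ne unfolding d_def N_def by (metis Suc_leI One_nat_def)
  have V: "verts G = {..<N}" and NV: "nreg s ''V'' = N"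
    and par: "\<And>j. j \<in> {1..<2 * N} \<Longrightarrow> narr s ''parent'' j = j div 2"
    using env by (auto simp: search_env_def N_def)
  have vR: "v \<in> R - S" using st'(3) [OF v(1)] v(3) by simp
  have RN: "R \<subseteq> {..<N}" using st'(4) V by (simp add: search_inv_def)
  have min: "d v \<le> d u" if "u \<in> R - S" for u
    using v(4) [of u] st'(3) [of u] that RN by auto
  note sel = search_select [OF st'(4) vR min]
  have vS: "v \<in> insert v S" by simp
  let ?Q = "\<lambda>s'. \<exists>R'. search_state G D A w (insert v S) R' {} s'"
  define s1 where "s1 = effect settle_start s"
  have s1: "s1 = s\<lparr>nreg := (nreg s)(''v'' := v, ''l'' := N + v, ''i'' := (N + v) div 2,
        ''e'' := narr s ''bucket'' v),
      narr := (narr s)(''tree'' := (narr s ''tree'')(N + v := 0))\<rparr>"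
    using v NV par [of "N + v"] by (simp add: s1_def settle_start_def)
  have "runs settle s (26 + ((60 * L + 4) + (length (adj v) * (60 * L + 84) + 4))) ?Q"
    unfolding settle_def
  proof (rule runs_Seq)
    show "runs settle_start s 26 (\<lambda>s'. s' = s1)"
      by (rule runs_effect) (simp_all add: settle_start_def s1_def)
  next
    fix s' assume s': "s' = s1"
    show "runs (Seq repair scan) s' (60 * L + 4 + (length (adj v) * (60 * L + 84) + 4)) ?Q"
      unfolding s'
    proof (rule runs_Seq [OF runs_repair_leaf [OF st'(1) v(1),
          where x = 0 and y = "rarr s ''key'' (N + v)"]])
      show "\<And>j. j \<in> {1..<2 * N} \<Longrightarrow> narr s1 ''parent'' j = j div 2"
        using par by (simp add: s1)
      show "L = floor_log N + 1" by (simp add: L N_def)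
    next
      fix s2 assume *: "tournament N (narr s2 ''tree'') (rarr s2 ''key'') \<and>
         (\<forall>u. narr s2 ''tree'' (N + u) = ((narr s ''tree'')(N + v := 0)) (N + u) \<and>
           rarr s2 ''key'' (N + u) = ((rarr s ''key'')(N + v := rarr s ''key'' (N + v))) (N + u)) \<and>
         unchanged {''c'', ''i'', ''tree'', ''key''} s1 s2"
      then have fr: "narr s2 ''reached'' = narr s ''reached''" "narr s2 ''succ'' = narr s ''succ''"
          "narr s2 ''next'' = narr s ''next''" "nreg s2 ''e'' = narr s ''bucket'' v" "nreg s2 ''v'' = v"
        by (simp_all add: unchanged_def s1)
      have key: "(\<lambda>v. rarr s2 ''key'' (N + v)) = d"
        using * by (auto simp: d_def)
      have tr: "narr s2 ''tree'' (N + x) = ((narr s ''tree'')(N + v := 0)) (N + x)" for x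
        using * by blast
      have adj: "linked (narr s ''next'') (narr s ''bucket'' v) (adj v)" "set (adj v) = {a \<in> A. head G a = v}"
        using env v(1) V by (auto simp: search_env_def)
      show "runs scan s2 (length (adj v) * (60 * L + 84) + 4) ?Q"
      proof (rule runs_scan [where v = v])
        have "search_env G A w adj s1"
          using env by (simp add: search_env_def s1)
        then show "search_env G A w adj s2"
          by (rule search_env_unchanged) (use * in auto)
        show "search_state G D A w (insert v S) R (set (adj v)) s2"
          unfolding search_state_def Let_def N_def [symmetric] key tr
          using * sel(1) st'(2,3) by (auto simp: fr adj)
        show "\<forall>u\<in>insert v S. rarr s2 ''key'' (card (verts G) + u) \<le> rarr s2 ''key'' (card (verts G) + v)"
          using sel(2) key unfolding N_def by (metis N_def)
      qed (use fr adj L in auto)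
    qed (simp_all add: s1)
  qed
  then have "runs settle s (60 * L + 40 + length (adj v) * (60 * L + 84)) ?Q"
    by (rule runs_mono) auto
  then show ?thesis using v(1) vR unfolding N_def by blast
qed

definition search_start :: com where
  "search_start = block [
     SetNReg ''v'' (NArr ''destination'' (NReg ''t2'')),
     SetNReg ''l'' (NAdd (NReg ''V'') (NReg ''v'')),
     SetNArr ''reached'' (NReg ''v'') (NNum 1),
     SetNArr ''tree'' (NReg ''l'') (NAdd (NReg ''v'') (NNum 1)),
     SetRArr ''key'' (NReg ''l'') (RNum 0),
     SetNReg ''i'' (NArr ''parent'' (NReg ''l''))]"

definition search :: com where
  "search = Seq search_start (Seq repair
     (While (NLess (NNum 0) (NArr ''tree'' (NNum 1))) settle))"

lemma writes_search: "writes search =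
    {''a'', ''u'', ''l'', ''x'', ''e'', ''reached'', ''succ'', ''tree'', ''key'', ''c'', ''i'', ''v''}"
  by (auto simp: search_def search_start_def writes_repair writes_settle)

lemma runs_settle_loop:
  assumes env: "search_env G A w adj s" and st: "search_state G D A w {} R {} s"
    and ne: "0 < card (verts G)" and L: "L = floor_log (card (verts G)) + 1"
  shows "runs (While (NLess (NNum 0) (NArr ''tree'' (NNum 1))) settle) s
    ((\<Sum>v<card (verts G). 60 * L + 45 + length (adj v) * (60 * L + 84)) + 5)
    (\<lambda>s'. \<exists>S. search_state G D A w S S {} s')"
proof -
  define N where "N = card (verts G)"
  let ?b = "NLess (NNum 0) (NArr ''tree'' (NNum 1))"
  let ?c = "\<lambda>v. 60 * L + 45 + length (adj v) * (60 * L + 84)"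
  \<comment> \<open>Every vertex that is not settled keeps the credit for its removal from the queue and for all arcs into it.\<close>
  let ?Inv = "\<lambda>k s'. \<exists>S R. k = (\<Sum>v\<in>{..<N} - S. ?c v) \<and> search_env G A w adj s' \<and>
    search_state G D A w S R {} s'"
  have "runs (While ?b settle) s ((\<Sum>v<N. ?c v) + 1 + bcost ?b)
      (\<lambda>s'. (\<exists>k'. ?Inv k' s') \<and> \<not> bval ?b s')"
  proof (rule runs_While)
    show "?Inv (\<Sum>v<N. ?c v) s" using env st by (intro exI [of _ "{}"] exI [of _ R]) simp
  next
    fix k s' assume "?Inv k s'" and b: "bval ?b s'"
    then obtain S R where k: "k = (\<Sum>v\<in>{..<N} - S. ?c v)" and inv: "search_env G A w adj s'"
      "search_state G D A w S R {} s'" by blast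
    obtain v where v: "v < N" "v \<notin> S" and
      r: "runs settle s' (60 * L + 40 + length (adj v) * (60 * L + 84))
        (\<lambda>s'. \<exists>R'. search_state G D A w (insert v S) R' {} s')"
      using runs_settle [OF inv _ ne L] b unfolding N_def by auto
    have "k = ?c v + (\<Sum>v\<in>{..<N} - S - {v}. ?c v)"
      unfolding k by (rule sum.remove) (use v in auto)
    also have "{..<N} - S - {v} = {..<N} - insert v S" by blast
    finally have kk: "k = ?c v + (\<Sum>v\<in>{..<N} - insert v S. ?c v)" .
    from runs_frame [OF r]
    have "runs settle s' (60 * L + 40 + length (adj v) * (60 * L + 84))
        (?Inv (\<Sum>v\<in>{..<N} - insert v S. ?c v))"
    proof (rule runs_mono)
      fix s'' assume *: "(\<exists>R'. search_state G D A w (insert v S) R' {} s'') \<and>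
        unchanged (writes settle) s' s''"
      have "search_env G A w adj s''"
        by (rule search_env_unchanged [OF inv(1), of "writes settle"])
          (use * in \<open>auto simp: writes_settle\<close>)
      then show "?Inv (\<Sum>v\<in>{..<N} - insert v S. ?c v) s''" using * by blast
    qed simp
    then show "\<exists>l k'. runs settle s' l (?Inv k') \<and> 1 + bcost ?b + l + k' \<le> k"
      using kk by (intro exI [of _ "60 * L + 40 + length (adj v) * (60 * L + 84)"]
        exI [of _ "\<Sum>v\<in>{..<N} - insert v S. ?c v"]) simp
  qed
  then show ?thesis
    unfolding N_def [symmetric]
  proof (rule runs_mono)
    fix s' assume *: "(\<exists>k'. ?Inv k' s') \<and> \<not> bval ?b s'"
    then obtain S R where st: "search_state G D A w S R {} s'" by blast
    then have q: "\<And>v. v < N \<Longrightarrow> narr s' ''tree'' (N + v) \<noteq> 0 \<longleftrightarrow> v \<in> R - S"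
      and tour: "tournament N (narr s' ''tree'') (rarr s' ''key'')" and SR: "S \<subseteq> R" "R \<subseteq> verts G"
      by (simp_all add: search_state_def search_inv_def Let_def N_def)
    have RN: "R \<subseteq> {..<N}" using SR(2) env by (simp add: search_env_def N_def)
    have "narr s' ''tree'' 1 = 0" using * by simp
    then have "narr s' ''tree'' (N + v) = 0" if "v < N" for v
      using tournament_root_0 [OF tour _ that] by simp
    then have "v \<notin> R - S" if "v < N" for v
      using q [OF that] that by simp
    then have "S = R" using SR(1) RN by blast
    then show "\<exists>S. search_state G D A w S S {} s'" using st by blast
  qed simp
qed

lemma runs_search:
  assumes env: "search_env G A w adj s" and D: "narr s ''destination'' (nreg s ''t2'') = D" "D \<in> verts G"
    and clear: "\<And>j. j < 2 * card (verts G) \<Longrightarrow> narr s ''tree'' j = 0 \<and> narr s ''reached'' j = 0"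
    and L: "L = floor_log (card (verts G)) + 1"
  shows "runs search s
    ((\<Sum>v<card (verts G). 60 * L + 45 + length (adj v) * (60 * L + 84)) + 60 * L + 40)
    (\<lambda>s'. \<exists>S. search_state G D A w S S {} s')"
proof -
  define N where "N = card (verts G)"
  have V: "verts G = {..<N}" and NV: "nreg s ''V'' = N"
    and par: "\<And>j. j \<in> {1..<2 * N} \<Longrightarrow> narr s ''parent'' j = j div 2"
    using env by (auto simp: search_env_def N_def)
  have DN: "D < N" "0 < N" using D V by auto
  let ?Q = "\<lambda>s'. \<exists>S. search_state G D A w S S {} s'"
  define s1 where "s1 = effect search_start s"
  have s1: "s1 = s\<lparr>nreg := (nreg s)(''v'' := D, ''l'' := N + D, ''i'' := (N + D) div 2),
      narr := (narr s)(''reached'' := (narr s ''reached'')(D := 1),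
        ''tree'' := (narr s ''tree'')(N + D := D + 1)),
      rarr := (rarr s)(''key'' := (rarr s ''key'')(N + D := 0))\<rparr>"
    using D NV DN par [of "N + D"] by (simp add: s1_def search_start_def)
  have tour: "tournament N (narr s ''tree'') (rarr s ''key'')"
    using clear by (auto simp: tournament_except_def node_ok_def dominates_def N_def)
  let ?k = "(\<Sum>v<N. 60 * L + 45 + length (adj v) * (60 * L + 84)) + 5"
  have "runs search s (30 + ((60 * L + 4) + ?k)) ?Q"
    unfolding search_def
  proof (rule runs_Seq)
    show "runs search_start s 30 (\<lambda>s'. s' = s1)"
      by (rule runs_effect) (simp_all add: search_start_def s1_def)
  next
    fix s' assume s': "s' = s1"
    show "runs (Seq repair (While (NLess (NNum 0) (NArr ''tree'' (NNum 1))) settle)) s'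
        (60 * L + 4 + ?k) ?Q"
      unfolding s'
    proof (rule runs_Seq [OF runs_repair_leaf [OF tour DN(1), where x = "D + 1" and y = 0]])
      show "\<And>j. j \<in> {1..<2 * N} \<Longrightarrow> narr s1 ''parent'' j = j div 2"
        using par by (simp add: s1)
      show "L = floor_log N + 1" by (simp add: L N_def)
    next
      fix s2 assume *: "tournament N (narr s2 ''tree'') (rarr s2 ''key'') \<and>
         (\<forall>u. narr s2 ''tree'' (N + u) = ((narr s ''tree'')(N + D := D + 1)) (N + u) \<and>
           rarr s2 ''key'' (N + u) = ((rarr s ''key'')(N + D := 0)) (N + u)) \<and>
         unchanged {''c'', ''i'', ''tree'', ''key''} s1 s2"
      then have fr: "narr s2 ''reached'' = (narr s ''reached'')(D := 1)"
        by (simp add: unchanged_def s1)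
      have "rarr s2 ''key'' (N + D) = 0" using * by simp
      then have inv: "search_inv G D A w {} {D} {} (\<lambda>v. rarr s2 ''key'' (N + v)) (narr s2 ''succ'')"
        using D(2) by (intro search_init) auto
      have tr: "narr s2 ''tree'' (N + x) = ((narr s ''tree'')(N + D := D + 1)) (N + x)" for x
        using * by blast
      show "runs (While (NLess (NNum 0) (NArr ''tree'' (NNum 1))) settle) s2 ?k ?Q"
        unfolding N_def
      proof (rule runs_settle_loop)
        have "search_env G A w adj s1"
          using env by (simp add: search_env_def s1)
        then show "search_env G A w adj s2"
          by (rule search_env_unchanged) (use * in auto)
        show "search_state G D A w {} {D} {} s2"
          unfolding search_state_def Let_def N_def [symmetric] tr
          using * inv clear by (auto simp: fr N_def)
      qed (use DN L N_def in auto)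
    qed (simp_all add: s1)
  qed
  then show ?thesis unfolding N_def by (rule runs_mono) auto
qed

section \<open>Initialization and the arcs common to an interval\<close>

definition clear_step :: com where
  "clear_step = block [
     SetNArr ''tree'' (NReg ''i'') (NNum 0),
     SetNArr ''reached'' (NReg ''i'') (NNum 0),
     SetNArr ''bucket'' (NReg ''i'') (NNum 0),
     increment ''i'']"

definition clear :: com where
  "clear = Seq (SetNReg ''i'' (NNum 0))
     (While (NLess (NReg ''i'') (NAdd (NReg ''V'') (NReg ''V''))) clear_step)"

lemma writes_clear: "writes clear = {''i'', ''tree'', ''reached'', ''bucket''}"
  by (auto simp: clear_def clear_step_def)

lemma runs_clear:
  assumes "nreg s ''V'' = N"
  shows "runs clear s (60 * N + 20) (\<lambda>s'. \<forall>j<2 * N. narr s' ''tree'' j = 0 \<and>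
    narr s' ''reached'' j = 0 \<and> narr s' ''bucket'' j = 0)"
proof -
  let ?Q = "\<lambda>s' :: state. \<forall>j<2 * N. narr s' ''tree'' j = 0 \<and> narr s' ''reached'' j = 0 \<and> narr s' ''bucket'' j = 0"
  let ?Inv = "\<lambda>n (s' :: state). nreg s' ''V'' = N \<and> nreg s' ''i'' \<le> 2 * N \<and> n = 2 * N - nreg s' ''i'' \<and>
    (\<forall>j<nreg s' ''i''. narr s' ''tree'' j = 0 \<and> narr s' ''reached'' j = 0 \<and> narr s' ''bucket'' j = 0)"
  have "runs clear s (2 + (60 * N + 18)) ?Q"
    unfolding clear_def
  proof (rule runs_Seq)
    show "runs (SetNReg ''i'' (NNum 0)) s 2 (?Inv (2 * N))"
      by (rule runs_effect) (use assms in simp_all)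
  next
    fix s1 assume s1: "?Inv (2 * N) s1"
    show "runs (While (NLess (NReg ''i'') (NAdd (NReg ''V'') (NReg ''V''))) clear_step) s1
        (60 * N + 18) ?Q"
    proof (rule runs_While_count [where Inv = ?Inv and l = 13])
      show "?Inv (2 * N) s1" by (rule s1)
    next
      fix n s' assume inv: "?Inv n s'"
        and b: "bval (NLess (NReg ''i'') (NAdd (NReg ''V'') (NReg ''V''))) s'"
      then have "n = Suc (n - 1)" by auto
      moreover have "runs clear_step s' 13 (?Inv (n - 1))"
        by (rule runs_effect) (use inv b in \<open>auto simp: clear_step_def less_Suc_eq\<close>)
      ultimately show "\<exists>m. n = Suc m \<and> runs clear_step s' 13 (?Inv m)" by blast
    qed auto
  qed
  then show ?thesis by (rule runs_mono) auto
qed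

definition parents_step :: com where
  "parents_step = block [
     SetNArr ''parent'' (NAdd (NReg ''i'') (NReg ''i'')) (NReg ''i''),
     SetNArr ''parent'' (NAdd (NAdd (NReg ''i'') (NReg ''i'')) (NNum 1)) (NReg ''i''),
     increment ''i'']"

definition parents :: com where
  "parents = Seq (SetNReg ''i'' (NNum 1)) (While (NLess (NReg ''i'') (NReg ''V'')) parents_step)"

lemma writes_parents: "writes parents = {''i'', ''parent''}"
  by (auto simp: parents_def parents_step_def)

lemma runs_parents:
  assumes "nreg s ''V'' = N" "1 \<le> N" "narr s ''parent'' = (\<lambda>_. 0)"
  shows "runs parents s (60 * N + 20) (\<lambda>s'. \<forall>j\<in>{1..<2 * N}. narr s' ''parent'' j = j div 2)"
proof -
  let ?Q = "\<lambda>s' :: state. \<forall>j\<in>{1..<2 * N}. narr s' ''parent'' j = j div 2"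
  let ?Inv = "\<lambda>n (s' :: state). nreg s' ''V'' = N \<and> 1 \<le> nreg s' ''i'' \<and> nreg s' ''i'' \<le> N \<and> n = N - nreg s' ''i'' \<and>
    (\<forall>j<2 * nreg s' ''i''. narr s' ''parent'' j = j div 2)"
  have "runs parents s (2 + (60 * N + 18)) ?Q"
    unfolding parents_def
  proof (rule runs_Seq)
    show "runs (SetNReg ''i'' (NNum 1)) s 2 (?Inv (N - 1))"
      by (rule runs_effect) (use assms in simp_all)
  next
    fix s1 assume s1: "?Inv (N - 1) s1"
    show "runs (While (NLess (NReg ''i'') (NReg ''V'')) parents_step) s1 (60 * N + 18) ?Q"
    proof (rule runs_While_count [where Inv = ?Inv and l = 17])
      show "?Inv (N - 1) s1" by (rule s1)
    next
      fix n s' assume inv: "?Inv n s'" and b: "bval (NLess (NReg ''i'') (NReg ''V'')) s'"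
      then have "n = Suc (n - 1)" by auto
      moreover have "runs parents_step s' 17 (?Inv (n - 1))"
      proof (rule runs_effect)
        let ?i = "nreg s' ''i''"
        have "effect parents_step s' = s'\<lparr>nreg := (nreg s')(''i'' := ?i + 1),
            narr := (narr s')(''parent'' := (narr s' ''parent'')(2 * ?i := ?i, 2 * ?i + 1 := ?i))\<rparr>"
          by (simp add: parents_step_def mult_2)
        then show "?Inv (n - 1) (effect parents_step s')"
          using inv b by (auto simp: less_Suc_eq)
      qed (simp_all add: parents_step_def)
      ultimately show "\<exists>m. n = Suc m \<and> runs parents_step s' 17 (?Inv m)" by blast
    qed auto
  qed
  then show ?thesis by (rule runs_mono) auto
qed

text \<open>
  The pairs \<open>(t1, t2)\<close> are numbered by \<open>z\<close> in the order in which they are handled, and \<open>alive a = z\<close> says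
  that \<open>a\<close> is allowed on the whole interval \<open>t1..t2\<close>. When \<open>t2\<close> grows, an arc survives if its mark is
  \<open>z - 1\<close>; when a new \<open>t1\<close> begins, all arcs of its time step are admitted. So old marks need not be
  erased, and one pass over the arcs of the time step \<open>t2\<close> updates the common arcs, their weights and the
  lists of arcs by head.
\<close>

definition link_arc :: com where
  "link_arc = block [
     Cond (NEq (NReg ''t1'') (NReg ''t2'')) (SetRArr ''weight'' (NReg ''a'') (RNum 0)) Skip,
     SetRArr ''weight'' (NReg ''a'') (RSub (RArr ''weight'' (NReg ''a''))
       (RMul (RReg ''demand'') (RArr ''dual'' (NReg ''i'')))),
     SetNArr ''alive'' (NReg ''a'') (NReg ''z''),
     SetNReg ''v'' (NArr ''head'' (NReg ''a'')),
     SetNArr ''next'' (NReg ''a'') (NArr ''bucket'' (NReg ''v'')),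
     SetNArr ''bucket'' (NReg ''v'') (NAdd (NReg ''a'') (NNum 1))]"

definition arcs_step :: com where
  "arcs_step = block [
     SetNReg ''a'' (NArr ''arc'' (NReg ''i'')),
     Cond (BOr (NEq (NReg ''t1'') (NReg ''t2''))
         (NEq (NAdd (NArr ''alive'' (NReg ''a'')) (NNum 1)) (NReg ''z'')))
       link_arc Skip,
     increment ''i'']"

definition collect_arcs :: com where
  "collect_arcs = Seq (SetNReg ''i'' (NArr ''first'' (NReg ''t2'')))
     (While (NLess (NReg ''i'') (NArr ''first'' (NAdd (NReg ''t2'') (NNum 1)))) arcs_step)"

lemma writes_collect_arcs:
  "writes collect_arcs = {''i'', ''a'', ''v'', ''weight'', ''alive'', ''next'', ''bucket''}"
  by (auto simp: collect_arcs_def arcs_step_def link_arc_def)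

lemma effect_arcs_step:
  "effect arcs_step s = (let a = narr s ''arc'' (nreg s ''i''); i = nreg s ''i'' in
     if nreg s ''t1'' = nreg s ''t2'' \<or> narr s ''alive'' a + 1 = nreg s ''z''
     then (let v = narr s ''head'' a in
       s\<lparr>nreg := (nreg s)(''a'' := a, ''v'' := v, ''i'' := i + 1),
         narr := (narr s)(''alive'' := (narr s ''alive'')(a := nreg s ''z''),
           ''next'' := (narr s ''next'')(a := narr s ''bucket'' v),
           ''bucket'' := (narr s ''bucket'')(v := a + 1)),
         rarr := (rarr s)(''weight'' := (rarr s ''weight'')(a :=
           (if nreg s ''t1'' = nreg s ''t2'' then 0 else rarr s ''weight'' a)
             - rreg s ''demand'' * rarr s ''dual'' i))\<rparr>)
     else s\<lparr>nreg := (nreg s)(''a'' := a, ''i'' := i + 1)\<rparr>)"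
  by (simp add: arcs_step_def link_arc_def Let_def)

definition buckets_ok :: "nat \<Rightarrow> (nat \<Rightarrow> nat) \<Rightarrow> nat set \<Rightarrow> (nat \<Rightarrow> nat list) \<Rightarrow> state \<Rightarrow> bool" where
  "buckets_ok N h X adj s \<longleftrightarrow>
     (\<forall>v<N. linked (narr s ''next'') (narr s ''bucket'' v) (adj v) \<and> set (adj v) = {a \<in> X. h a = v})"

lemma buckets_insert:
  assumes "buckets_ok N h X adj s" "a \<notin> X" "h a = v" "v < N"
    and "narr s' ''next'' = (narr s ''next'')(a := narr s ''bucket'' v)"
    and "narr s' ''bucket'' = (narr s ''bucket'')(v := a + 1)"
  shows "buckets_ok N h (insert a X) (adj(v := a # adj v)) s'"
  unfolding buckets_ok_def
proof (intro allI impI)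
  fix u assume u: "u < N"
  have 1: "linked (narr s ''next'') (narr s ''bucket'' u) (adj u)" "set (adj u) = {a \<in> X. h a = u}"
    using assms(1) u unfolding buckets_ok_def by auto
  have "linked (narr s' ''next'') (narr s ''bucket'' u) (adj u)"
    using 1 assms(2) by (simp add: assms(5) linked_fun_upd)
  then show "linked (narr s' ''next'') (narr s' ''bucket'' u) ((adj(v := a # adj v)) u) \<and>
      set ((adj(v := a # adj v)) u) = {a' \<in> insert a X. h a' = u}"
    using 1(2) assms(2,3) by (auto simp: assms(5,6))
qed

lemma runs_collect_arcs:
  assumes first: "narr s ''first'' (nreg s ''t2'') = f"
      "narr s ''first'' (nreg s ''t2'' + 1) = f + length xs"
    and arc: "\<And>k. k < length xs \<Longrightarrow> narr s ''arc'' (f + k) = xs ! k"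
    and dual: "\<And>k. k < length xs \<Longrightarrow> rarr s ''dual'' (f + k) = y (xs ! k)"
    and xs: "distinct xs" "\<And>a. a \<in> set xs \<Longrightarrow> narr s ''head'' a = h a \<and> h a < N"
    and bucket: "\<And>v. v < N \<Longrightarrow> narr s ''bucket'' v = 0"
  defines "live \<equiv> {a \<in> set xs. nreg s ''t1'' = nreg s ''t2'' \<or> narr s ''alive'' a + 1 = nreg s ''z''}"
  shows "runs collect_arcs s (100 * length xs + 20) (\<lambda>s'.
    (\<forall>a. narr s' ''alive'' a = (if a \<in> live then nreg s ''z'' else narr s ''alive'' a)) \<and>
    (\<forall>a\<in>live. rarr s' ''weight'' a =
      (if nreg s ''t1'' = nreg s ''t2'' then 0 else rarr s ''weight'' a) - rreg s ''demand'' * y a) \<and>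
    (\<exists>adj. buckets_ok N h live adj s' \<and> (\<Sum>v<N. length (adj v)) \<le> length xs))"
    (is "runs _ _ _ ?Q")
proof -
  let ?b = "NLess (NReg ''i'') (NArr ''first'' (NAdd (NReg ''t2'') (NNum 1)))"
  let ?R = "\<lambda>Y k (s' :: state). (\<forall>a. narr s' ''alive'' a = (if a \<in> Y then nreg s ''z'' else narr s ''alive'' a)) \<and>
    (\<forall>a\<in>Y. rarr s' ''weight'' a =
      (if nreg s ''t1'' = nreg s ''t2'' then 0 else rarr s ''weight'' a) - rreg s ''demand'' * y a) \<and>
    (\<forall>a. a \<notin> Y \<longrightarrow> rarr s' ''weight'' a = rarr s ''weight'' a) \<and>
    (\<exists>adj. buckets_ok N h Y adj s' \<and> (\<Sum>v<N. length (adj v)) \<le> k)"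
  let ?Inv = "\<lambda>n (s' :: state). \<exists>k. k \<le> length xs \<and> n = length xs - k \<and> nreg s' ''i'' = f + k \<and>
    nreg s' ''t1'' = nreg s ''t1'' \<and> nreg s' ''t2'' = nreg s ''t2'' \<and> nreg s' ''z'' = nreg s ''z'' \<and>
    rreg s' ''demand'' = rreg s ''demand'' \<and> narr s' ''first'' = narr s ''first'' \<and>
    narr s' ''arc'' = narr s ''arc'' \<and> narr s' ''head'' = narr s ''head'' \<and>
    rarr s' ''dual'' = rarr s ''dual'' \<and> ?R (live \<inter> set (take k xs)) k s'"
  have "runs collect_arcs s (3 + (100 * length xs + 17)) (?Inv 0)"
    unfolding collect_arcs_def
  proof (rule runs_Seq)
    have "?Inv (length xs) (effect (SetNReg ''i'' (NArr ''first'' (NReg ''t2''))) s)"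
      using first bucket
      by (intro exI [of _ 0]) (auto simp: buckets_ok_def intro!: exI [of _ "\<lambda>_. []"])
    then show "runs (SetNReg ''i'' (NArr ''first'' (NReg ''t2''))) s 3 (?Inv (length xs))"
      by (intro runs_effect) simp_all
  next
    fix s1 assume s1: "?Inv (length xs) s1"
    show "runs (While ?b arcs_step) s1 (100 * length xs + 17) (?Inv 0)"
    proof (rule runs_While_count [where Inv = ?Inv and l = 80])
      show "?Inv (length xs) s1" by (rule s1)
    next
      fix n s' assume "?Inv n s'" and b: "bval ?b s'"
      then obtain k where k: "k \<le> length xs" "n = length xs - k" and i: "nreg s' ''i'' = f + k" and
        fr: "nreg s' ''t1'' = nreg s ''t1''" "nreg s' ''t2'' = nreg s ''t2''" "nreg s' ''z'' = nreg s ''z''"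
          "rreg s' ''demand'' = rreg s ''demand''" "narr s' ''first'' = narr s ''first''"
          "narr s' ''arc'' = narr s ''arc''" "narr s' ''head'' = narr s ''head''"
          "rarr s' ''dual'' = rarr s ''dual''" and R: "?R (live \<inter> set (take k xs)) k s'"
        by blast
      have kl: "k < length xs" using b i fr first by simp
      define a where "a = xs ! k"
      have ax: "a \<in> set xs" "narr s' ''arc'' (nreg s' ''i'') = a" "rarr s' ''dual'' (nreg s' ''i'') = y a"
        "narr s' ''head'' a = h a" "h a < N"
        using kl xs arc [OF kl] dual [OF kl] i fr by (auto simp: a_def)
      have tk: "set (take (Suc k) xs) = insert a (set (take k xs))"
        using kl by (simp add: take_Suc_conv_app_nth a_def)
      have an: "a \<notin> set (take k xs)"
        using xs(1) kl by (auto simp: a_def in_set_conv_nth nth_eq_iff_index_eq)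
      let ?X = "live \<inter> set (take k xs)"
      have al: "narr s' ''alive'' a = narr s ''alive'' a" "rarr s' ''weight'' a = rarr s ''weight'' a"
        using R an by auto
      have live: "a \<in> live \<longleftrightarrow> nreg s' ''t1'' = nreg s' ''t2'' \<or> narr s' ''alive'' a + 1 = nreg s' ''z''"
        using ax(1) by (simp add: live_def fr al)
      let ?s = "effect arcs_step s'"
      have R': "?R (live \<inter> set (take (Suc k) xs)) (Suc k) ?s"
      proof (cases "a \<in> live")
        case True
        then have X: "live \<inter> set (take (Suc k) xs) = insert a ?X" using tk by auto
        have eff: "narr ?s ''alive'' = (narr s' ''alive'')(a := nreg s ''z'')"
          "narr ?s ''next'' = (narr s' ''next'')(a := narr s' ''bucket'' (h a))"
          "narr ?s ''bucket'' = (narr s' ''bucket'')(h a := a + 1)"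
          "rarr ?s ''weight'' = (rarr s' ''weight'')(a :=
             (if nreg s ''t1'' = nreg s ''t2'' then 0 else rarr s ''weight'' a) - rreg s ''demand'' * y a)"
          using True [unfolded live] unfolding effect_arcs_step Let_def ax
          by (auto simp: ax fr al)
        obtain adj where adj: "buckets_ok N h ?X adj s'" "(\<Sum>v<N. length (adj v)) \<le> k"
          using R by blast
        have "buckets_ok N h (insert a ?X) (adj(h a := a # adj (h a))) ?s"
          by (rule buckets_insert [OF adj(1) _ refl ax(5) eff(2,3)]) (use an in auto)
        moreover have "(\<Sum>v<N. length ((adj(h a := a # adj (h a))) v)) \<le> Suc k"
        proof -
          have "(\<Sum>v<N. length ((adj(h a := a # adj (h a))) v))
              = (\<Sum>v<N. length (adj v) + (if v = h a then 1 else 0))"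
            by (rule sum.cong) auto
          also have "\<dots> = (\<Sum>v<N. length (adj v)) + 1"
            using ax(5) by (simp add: sum.distrib)
          finally show ?thesis using adj(2) by simp
        qed
        ultimately have "\<exists>adj. buckets_ok N h (insert a ?X) adj ?s \<and> (\<Sum>v<N. length (adj v)) \<le> Suc k"
          by blast
        then show ?thesis unfolding X using R by (simp add: eff)
      next
        case False
        then have X: "live \<inter> set (take (Suc k) xs) = ?X" using tk by auto
        have eff: "narr ?s = narr s'" "rarr ?s = rarr s'"
          using False [unfolded live] unfolding effect_arcs_step Let_def ax by auto
        obtain adj where adj: "buckets_ok N h ?X adj s'" "(\<Sum>v<N. length (adj v)) \<le> k"
          using R by blast
        then have "\<exists>adj. buckets_ok N h ?X adj ?s \<and> (\<Sum>v<N. length (adj v)) \<le> Suc k"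
          by (intro exI [of _ adj]) (simp add: buckets_ok_def eff)
        then show ?thesis unfolding X using R by (simp add: eff)
      qed
      have "nreg ?s ''i'' = f + Suc k \<and> nreg ?s ''t1'' = nreg s ''t1'' \<and> nreg ?s ''t2'' = nreg s ''t2'' \<and>
        nreg ?s ''z'' = nreg s ''z'' \<and>
        rreg ?s ''demand'' = rreg s ''demand'' \<and> narr ?s ''first'' = narr s ''first'' \<and>
        narr ?s ''arc'' = narr s ''arc'' \<and> narr ?s ''head'' = narr s ''head'' \<and>
        rarr ?s ''dual'' = rarr s ''dual''"
        by (simp add: effect_arcs_step Let_def fr i)
      then have "?Inv (length xs - Suc k) ?s"
        using R' kl by (intro exI [of _ "Suc k"] conjI) simp_all
      then have "runs arcs_step s' 80 (?Inv (length xs - Suc k))"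
        by (rule runs_effect [rotated 2]) (simp_all add: arcs_step_def link_arc_def)
      moreover have "n = Suc (length xs - Suc k)" using k kl by simp
      ultimately show "\<exists>m. n = Suc m \<and> runs arcs_step s' 80 (?Inv m)" by blast
    next
      fix n s' assume "?Inv n s'" and "\<not> bval ?b s'"
      moreover from this have "n = 0" using first by auto
      ultimately show "?Inv 0 s'" by simp
    qed simp
  qed
  then show ?thesis
  proof (rule runs_mono)
    fix s' assume "?Inv 0 s'"
    then have "?R (live \<inter> set xs) (length xs) s'" by auto
    moreover have "live \<inter> set xs = live" by (auto simp: live_def)
    ultimately show "?Q s'" by simp
  qed simp
qed

section \<open>Storing a path\<close>

definition path_start :: com where
  "path_start = block [
     SetNArr ''P_exists'' (NReg ''p'') (NNum 1),
     SetNArr ''P_origin'' (NReg ''p'') (NArr ''origin'' (NReg ''t2'')),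
     SetNArr ''P_start'' (NReg ''p'') (NReg ''m''),
     SetNReg ''v'' (NArr ''origin'' (NReg ''t2''))]"

text \<open>
  Every arc is stored at the same position of \<open>P_arc\<close> and of \<open>S_arc\<close>. The final path-sequence can therefore
  reuse the segments of the paths that it consists of.
\<close>

definition path_step :: com where
  "path_step = block [
     SetNReg ''a'' (NArr ''succ'' (NReg ''v'')),
     SetNArr ''P_arc'' (NReg ''m'') (NReg ''a''),
     SetNArr ''S_arc'' (NReg ''m'') (NReg ''a''),
     increment ''m'',
     SetNReg ''v'' (NArr ''head'' (NReg ''a''))]"

definition write_path :: com where
  "write_path = Seq path_start (Seq
     (While (BNot (NEq (NReg ''v'') (NArr ''destination'' (NReg ''t2'')))) path_step)
     (SetNArr ''P_length'' (NReg ''p'') (NSub (NReg ''m'') (NArr ''P_start'' (NReg ''p'')))))"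

lemma writes_write_path: "writes write_path = {''P_exists'', ''P_origin'', ''P_start'', ''P_length'',
    ''P_arc'', ''S_arc'', ''a'', ''v'', ''m''}"
  by (auto simp: write_path_def path_start_def path_step_def)

definition path_written :: "nat \<Rightarrow> nat list \<Rightarrow> state \<Rightarrow> state \<Rightarrow> bool" where
  "path_written v p s s' \<longleftrightarrow>
     narr s' ''P_exists'' = (narr s ''P_exists'')(nreg s ''p'' := 1) \<and>
     narr s' ''P_origin'' = (narr s ''P_origin'')(nreg s ''p'' := v) \<and>
     narr s' ''P_start'' = (narr s ''P_start'')(nreg s ''p'' := nreg s ''m'') \<and>
     narr s' ''P_length'' = (narr s ''P_length'')(nreg s ''p'' := length p) \<and>
     narr s' ''S_arc'' = narr s' ''P_arc'' \<and>
     (\<forall>j<nreg s ''m''. narr s' ''P_arc'' j = narr s ''P_arc'' j) \<and>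
     (\<forall>j<length p. narr s' ''P_arc'' (nreg s ''m'' + j) = p ! j) \<and>
     nreg s' ''m'' = nreg s ''m'' + length p"

lemma runs_write_path:
  assumes p: "tree_path G (narr s ''destination'' (nreg s ''t2'')) A (narr s ''succ'') S
      (narr s ''origin'' (nreg s ''t2'')) p"
    and h: "\<And>a. a \<in> A \<Longrightarrow> narr s ''head'' a = head G a"
    and same: "narr s ''S_arc'' = narr s ''P_arc''"
  shows "runs write_path s (40 * length p + 40) (path_written (narr s ''origin'' (nreg s ''t2'')) p s)"
proof -
  define x m v d where "x = nreg s ''p''" and "m = nreg s ''m''"
    and "v = narr s ''origin'' (nreg s ''t2'')" and "d = narr s ''destination'' (nreg s ''t2'')"
  let ?b = "BNot (NEq (NReg ''v'') (NArr ''destination'' (NReg ''t2'')))"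
  let ?c = "SetNArr ''P_length'' (NReg ''p'') (NSub (NReg ''m'') (NArr ''P_start'' (NReg ''p'')))"
  let ?J = "\<lambda>p1 p2 n (s' :: state). p = p1 @ p2 \<and> n = length p2 \<and>
    tree_path G d A (narr s ''succ'') S (nreg s' ''v'') p2 \<and>
    nreg s' ''t2'' = nreg s ''t2'' \<and> nreg s' ''p'' = x \<and> narr s' ''succ'' = narr s ''succ'' \<and>
    narr s' ''head'' = narr s ''head'' \<and> narr s' ''destination'' = narr s ''destination'' \<and>
    narr s' ''P_exists'' = (narr s ''P_exists'')(x := 1) \<and>
    narr s' ''P_origin'' = (narr s ''P_origin'')(x := v) \<and>
    narr s' ''P_start'' = (narr s ''P_start'')(x := m) \<and>
    narr s' ''P_length'' = narr s ''P_length'' \<and>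
    narr s' ''S_arc'' = narr s' ''P_arc'' \<and>
    (\<forall>j<m. narr s' ''P_arc'' j = narr s ''P_arc'' j) \<and>
    (\<forall>j<length p1. narr s' ''P_arc'' (m + j) = p1 ! j) \<and>
    nreg s' ''m'' = m + length p1"
  let ?Inv = "\<lambda>n s'. \<exists>p1 p2. ?J p1 p2 n s'"
  have "runs write_path s (15 + ((30 * length p + 7) + 8)) (path_written v p s)"
    unfolding write_path_def
  proof (rule runs_Seq)
    have "?Inv (length p) (effect path_start s)"
      using p same by (intro exI [of _ "[]"] exI [of _ p])
        (simp add: path_start_def x_def m_def v_def d_def)
    then show "runs path_start s 15 (?Inv (length p))"
      by (rule runs_effect [rotated 2]) (simp_all add: path_start_def)
  next
    fix s1 assume s1: "?Inv (length p) s1"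
    show "runs (Seq (While ?b path_step) ?c) s1 (30 * length p + 7 + 8) (path_written v p s)"
    proof (rule runs_Seq)
      show "runs (While ?b path_step) s1 (30 * length p + 7) (?Inv 0)"
      proof (rule runs_While_count [where Inv = ?Inv and l = 20])
        show "?Inv (length p) s1" by (rule s1)
      next
        fix n s' assume "?Inv n s'" and b: "bval ?b s'"
        then obtain p1 p2 where "?J p1 p2 n s'" by blast
        note inv = this [THEN conjunct1] this [THEN conjunct2]
        have "nreg s' ''v'' \<noteq> d" using b inv(2) by (simp add: d_def)
        then obtain a q where p2: "p2 = a # q" using inv(2) by (cases p2) auto
        then have a: "narr s ''succ'' (nreg s' ''v'') = a" "a \<in> A"
          "tree_path G d A (narr s ''succ'') S (head G a) q" using inv(2) by auto
        have eff: "effect path_step s' = s'\<lparr>nreg := (nreg s')(''a'' := a, ''m'' := m + length p1 + 1,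
              ''v'' := head G a),
            narr := (narr s')(''P_arc'' := (narr s' ''P_arc'')(m + length p1 := a),
              ''S_arc'' := (narr s' ''P_arc'')(m + length p1 := a))\<rparr>"
          by (simp add: path_step_def inv a h)
        have "?Inv (length q) (effect path_step s')"
          unfolding eff using inv a p2
          by (intro exI [of _ "p1 @ [a]"] exI [of _ q]) (auto simp: nth_append less_Suc_eq)
        then have "runs path_step s' 20 (?Inv (length q))"
          by (rule runs_effect [rotated 2]) (simp_all add: path_step_def)
        then show "\<exists>m. n = Suc m \<and> runs path_step s' 20 (?Inv m)" using inv(2) p2 by auto
      next
        fix n s' assume inv: "?Inv n s'" and b: "\<not> bval ?b s'"
        then obtain p2 where p2: "n = length p2" "tree_path G d A (narr s ''succ'') S (nreg s' ''v'') p2"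
          "nreg s' ''v'' = d" unfolding d_def by auto
        then have "n = 0" by (cases p2) auto
        then show "?Inv 0 s'" using inv by simp
      qed simp
    next
      fix s2 assume "?Inv 0 s2"
      then have "path_written v p s (effect ?c s2)"
        by (auto simp: path_written_def x_def m_def v_def)
      then show "runs ?c s2 8 (path_written v p s)" by (intro runs_effect) simp_all
    qed
  qed
  then show ?thesis unfolding v_def by (rule runs_mono) auto
qed

section \<open>The table of partial solutions\<close>

definition handled :: "('v, 'a) pricing \<Rightarrow> nat \<Rightarrow> nat \<Rightarrow> (nat \<times> nat) set" where
  "handled I a b = {(x, y). 1 \<le> x \<and> x \<le> y \<and> y \<le> horizon I \<and> (x < a \<or> x = a \<and> y < b)}"

lemma handled_Suc:
  assumes "1 \<le> a" "a \<le> b" "b \<le> horizon I"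
  shows "handled I a (b + 1) = insert (a, b) (handled I a b)"
  using assms by (auto simp: handled_def)

lemma handled_next_row: "handled I a (horizon I + 1) = handled I (a + 1) (a + 1)"
  by (auto simp: handled_def)

text \<open>
  The recursion restricted to the intervals handled so far. Here \<open>B t = 0\<close> means that no path for an
  interval ending at \<open>t\<close> has been found yet.
\<close>

definition partial_table :: "('v, 'a) pricing \<Rightarrow> (nat \<times> nat) set \<Rightarrow>
    (nat \<Rightarrow> nat \<Rightarrow> ('v, 'a) path option) \<Rightarrow> (nat \<Rightarrow> real) \<Rightarrow> (nat \<Rightarrow> nat) \<Rightarrow> bool" where
  "partial_table I H P F B \<longleftrightarrow> F 0 = 0 \<and> (\<forall>t\<in>{1..horizon I}.
     (B t = 0 \<longrightarrow> (\<forall>x. (x, t) \<in> H \<longrightarrow> P x t = None)) \<and>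
     (B t \<noteq> 0 \<longrightarrow> (B t, t) \<in> H \<and> (\<exists>p. P (B t) t = Some p \<and>
        F t = F (B t - 1) + penalty I + interval_cost I (B t) t p)) \<and>
     (\<forall>x p. (x, t) \<in> H \<longrightarrow> P x t = Some p \<longrightarrow>
        F t \<le> F (x - 1) + penalty I + interval_cost I x t p))"

lemma partial_table_None:
  assumes tab: "partial_table I H P F B"
    and P': "\<And>x y. (x, y) \<in> H \<Longrightarrow> P' x y = P x y" "P' a b = None"
  shows "partial_table I (insert (a, b) H) P' F B"
  unfolding partial_table_def
proof (intro conjI ballI)
  show "F 0 = 0" using tab by (simp only: partial_table_def)
next
  fix t assume t: "t \<in> {1..horizon I}"
  have 1: "B t = 0 \<longrightarrow> (\<forall>x. (x, t) \<in> H \<longrightarrow> P x t = None)"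
    "B t \<noteq> 0 \<longrightarrow> (B t, t) \<in> H \<and> (\<exists>p. P (B t) t = Some p \<and>
        F t = F (B t - 1) + penalty I + interval_cost I (B t) t p)"
    "\<forall>x p. (x, t) \<in> H \<longrightarrow> P x t = Some p \<longrightarrow>
        F t \<le> F (x - 1) + penalty I + interval_cost I x t p"
    using tab t unfolding partial_table_def by blast+
  show "B t = 0 \<longrightarrow> (\<forall>x. (x, t) \<in> insert (a, b) H \<longrightarrow> P' x t = None)"
    using 1(1) P' by (metis Pair_inject insertE)
  show "B t \<noteq> 0 \<longrightarrow> (B t, t) \<in> insert (a, b) H \<and> (\<exists>p. P' (B t) t = Some p \<and>
        F t = F (B t - 1) + penalty I + interval_cost I (B t) t p)"
    using 1(2) P'(1) by (metis insertCI)
  show "\<forall>x p. (x, t) \<in> insert (a, b) H \<longrightarrow> P' x t = Some p \<longrightarrow>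
        F t \<le> F (x - 1) + penalty I + interval_cost I x t p"
    using 1(3) P' by (metis Pair_inject insertE option.distinct(1))
qed

text \<open>
  Changing \<open>F b\<close> does not disturb the equations of other entries: they refer to \<open>F (x - 1)\<close> for starts
  \<open>x \<le> a \<le> b\<close> only.
\<close>

lemma partial_table_Some:
  assumes tab: "partial_table I (handled I a b) P F B" and ab: "1 \<le> a" "a \<le> b" "b \<le> horizon I"
    and P': "\<And>x y. (x, y) \<in> handled I a b \<Longrightarrow> P' x y = P x y" "P' a b = Some p"
    and r: "r = F (a - 1) + penalty I + interval_cost I a b p"
    and F': "F' = (if B b = 0 \<or> r < F b then F(b := r) else F)"
    and B': "B' = (if B b = 0 \<or> r < F b then B(b := a) else B)"
  shows "partial_table I (insert (a, b) (handled I a b)) P' F' B'"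
  unfolding partial_table_def
proof (intro conjI ballI)
  let ?H = "handled I a b"
  show "F' 0 = 0" using tab ab F' by (auto simp: partial_table_def)
  have Fx: "F' (x - 1) = F (x - 1)" if "(x, y) \<in> insert (a, b) ?H" for x y
  proof -
    have "x - 1 \<noteq> b" using that ab by (auto simp: handled_def)
    then show ?thesis by (simp add: F')
  qed
  fix t assume t: "t \<in> {1..horizon I}"
  have 1: "B t = 0 \<Longrightarrow> (x, t) \<in> ?H \<Longrightarrow> P x t = None"
    "B t \<noteq> 0 \<Longrightarrow> (B t, t) \<in> ?H"
    "B t \<noteq> 0 \<Longrightarrow> \<exists>p. P (B t) t = Some p \<and>
        F t = F (B t - 1) + penalty I + interval_cost I (B t) t p"
    "(x, t) \<in> ?H \<Longrightarrow> P x t = Some q \<Longrightarrow>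
        F t \<le> F (x - 1) + penalty I + interval_cost I x t q" for x q
    using tab t unfolding partial_table_def by blast+
  show "B' t = 0 \<longrightarrow> (\<forall>x. (x, t) \<in> insert (a, b) ?H \<longrightarrow> P' x t = None)"
  proof (intro impI allI)
    fix x assume B0: "B' t = 0" and x: "(x, t) \<in> insert (a, b) ?H"
    have "t \<noteq> b" using B0 ab by (auto simp: B' split: if_splits)
    moreover from this have "B t = 0" using B0 by (auto simp: B' split: if_splits)
    ultimately show "P' x t = None" using x 1(1) P'(1) by (metis Pair_inject insertE)
  qed
  show "B' t \<noteq> 0 \<longrightarrow> (B' t, t) \<in> insert (a, b) ?H \<and> (\<exists>p. P' (B' t) t = Some p \<and>
        F' t = F' (B' t - 1) + penalty I + interval_cost I (B' t) t p)"
  proof (intro impI)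
    assume B0: "B' t \<noteq> 0"
    show "(B' t, t) \<in> insert (a, b) ?H \<and> (\<exists>p. P' (B' t) t = Some p \<and>
        F' t = F' (B' t - 1) + penalty I + interval_cost I (B' t) t p)"
    proof (cases "t = b \<and> (B b = 0 \<or> r < F b)")
      case True
      then have "B' t = a" "F' t = r" by (auto simp: B' F')
      then show ?thesis using True P'(2) r Fx [of a b] by simp
    next
      case False
      then have eq: "B' t = B t" "F' t = F t" by (auto simp: B' F')
      then have "B t \<noteq> 0" using B0 by simp
      then show ?thesis using 1(2,3) P'(1) Fx [of "B t" t] unfolding eq by (metis insertCI)
    qed
  qed
  show "\<forall>x p. (x, t) \<in> insert (a, b) ?H \<longrightarrow> P' x t = Some p \<longrightarrow>
        F' t \<le> F' (x - 1) + penalty I + interval_cost I x t p"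
  proof (intro impI allI)
    fix x q assume x: "(x, t) \<in> insert (a, b) ?H" and q: "P' x t = Some q"
    show "F' t \<le> F' (x - 1) + penalty I + interval_cost I x t q"
      unfolding Fx [OF x]
    proof (cases "(x, t) = (a, b)")
      case True
      then have "r = F (x - 1) + penalty I + interval_cost I x t q" using q P'(2) r by simp
      moreover have "F' t \<le> r" using True by (simp add: F')
      ultimately show "F' t \<le> F (x - 1) + penalty I + interval_cost I x t q" by simp
    next
      case False
      then have xt: "(x, t) \<in> ?H" and Pq: "P x t = Some q" using x q P'(1) by auto
      have "F' t \<le> F t"
      proof (cases "t = b \<and> B b = 0")
        case True
        then show ?thesis using 1(1) xt Pq by auto
      qed (auto simp: F')
      then show "F' t \<le> F (x - 1) + penalty I + interval_cost I x t q"
        using 1(4) [OF xt Pq] by linarith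
    qed
  qed
qed

section \<open>Recording the result for an interval\<close>

definition input_ok :: "(nat, nat) pricing \<Rightarrow> (nat \<Rightarrow> nat list) \<Rightarrow> state \<Rightarrow> bool" where
  "input_ok I es s \<longleftrightarrow>
     nreg s ''T'' = horizon I \<and> nreg s ''V'' = card (verts (graph I)) \<and>
     rreg s ''demand'' = demand I \<and> rreg s ''penalty'' = penalty I \<and>
     (\<forall>t\<in>{1..horizon I}. narr s ''origin'' t = origin I t \<and>
        narr s ''destination'' t = destination I t \<and>
        narr s ''first'' (t + 1) = narr s ''first'' t + length (es t) \<and>
        (\<forall>k<length (es t). narr s ''arc'' (narr s ''first'' t + k) = es t ! k \<and>
          rarr s ''dual'' (narr s ''first'' t + k) = dual I (es t ! k) t)) \<and>
     (\<forall>a\<in>arcs (graph I). narr s ''tail'' a = tail (graph I) a \<and> narr s ''head'' a = head (graph I) a)"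

lemma input_ok_unchanged:
  assumes "input_ok I es s" "unchanged X s s'"
    and "X \<inter> {''T'', ''V'', ''demand'', ''penalty'', ''origin'', ''destination'', ''first'', ''arc'',
      ''dual'', ''tail'', ''head''} = {}"
  shows "input_ok I es s'"
proof -
  have "nreg s' ''T'' = nreg s ''T''" "nreg s' ''V'' = nreg s ''V''"
    "rreg s' ''demand'' = rreg s ''demand''" "rreg s' ''penalty'' = rreg s ''penalty''"
    "narr s' ''origin'' = narr s ''origin''" "narr s' ''destination'' = narr s ''destination''"
    "narr s' ''first'' = narr s ''first''" "narr s' ''arc'' = narr s ''arc''"
    "rarr s' ''dual'' = rarr s ''dual''" "narr s' ''tail'' = narr s ''tail''"
    "narr s' ''head'' = narr s ''head''"
    using assms(2,3) unfolding unchanged_def by blast+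
  then show ?thesis using assms(1) unfolding input_ok_def by simp
qed

definition pair_index :: "nat \<Rightarrow> nat \<Rightarrow> nat \<Rightarrow> nat" where
  "pair_index T a b = (a - 1) * T + (b - 1)"

text \<open>
  Results are written at increasing positions, so they are never overwritten.
\<close>

lemma pair_index_less:
  assumes "(x, y) \<in> handled I a b" "1 \<le> a" "a \<le> b"
  shows "pair_index (horizon I) x y < pair_index (horizon I) a b"
proof (cases "x < a")
  case True
  have xy: "1 \<le> x" "x \<le> y" "y \<le> horizon I" using assms(1) by (auto simp: handled_def)
  then have "pair_index (horizon I) x y < (x - 1) * horizon I + horizon I"
    by (simp add: pair_index_def)
  also have "\<dots> = x * horizon I" using xy by (cases x) auto
  also have "\<dots> \<le> (a - 1) * horizon I" using True by (intro mult_right_mono) auto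
  finally show ?thesis by (simp add: pair_index_def)
next
  case False
  then show ?thesis using assms by (auto simp: handled_def pair_index_def)
qed

text \<open>
  The register \<open>m\<close> is the first free position of \<open>P_arc\<close>. Finished segments lie below it and survive when
  further paths are appended.
\<close>

definition results_ok :: "(nat, nat) pricing \<Rightarrow> (nat \<times> nat) set \<Rightarrow> state \<Rightarrow> bool" where
  "results_ok I H s \<longleftrightarrow>
     narr s ''S_arc'' = narr s ''P_arc'' \<and>
     (\<forall>x y. (x, y) \<in> H \<longrightarrow>
       (case output_interval_path I s x y of
          None \<Rightarrow> \<not> (\<exists>p. valid_path_on I x y p)
        | Some p \<Rightarrow> lowest_cost_path I x y p) \<and>
       (narr s ''P_exists'' (pair_index (horizon I) x y) \<noteq> 0 \<longrightarrow>
          narr s ''P_start'' (pair_index (horizon I) x y) +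
          narr s ''P_length'' (pair_index (horizon I) x y) \<le> nreg s ''m'')) \<and>
     partial_table I H (output_interval_path I s) (rarr s ''F'') (narr s ''B'') \<and>
     (\<forall>t\<in>{1..horizon I}. narr s ''B'' t \<noteq> 0 \<longrightarrow>
        narr s ''X'' t = pair_index (horizon I) (narr s ''B'' t) t)"

lemma output_interval_path_cong:
  assumes "narr s' ''P_exists'' = narr s ''P_exists''" "narr s' ''P_origin'' = narr s ''P_origin''"
    "narr s' ''P_start'' = narr s ''P_start''" "narr s' ''P_length'' = narr s ''P_length''"
    "narr s' ''P_arc'' = narr s ''P_arc''"
  shows "output_interval_path I s' = output_interval_path I s"
  by (intro ext) (simp add: output_interval_path_def assms Let_def)

lemma results_ok_unchanged:
  assumes "results_ok I H s" "unchanged X s s'"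
    and "X \<inter> {''S_arc'', ''P_arc'', ''P_exists'', ''P_origin'', ''P_start'', ''P_length'', ''m'',
      ''F'', ''B'', ''X''} = {}"
  shows "results_ok I H s'"
proof -
  have eq: "narr s' ''S_arc'' = narr s ''S_arc''" "narr s' ''P_arc'' = narr s ''P_arc''"
    "narr s' ''P_exists'' = narr s ''P_exists''" "narr s' ''P_origin'' = narr s ''P_origin''"
    "narr s' ''P_start'' = narr s ''P_start''" "narr s' ''P_length'' = narr s ''P_length''"
    "nreg s' ''m'' = nreg s ''m''" "rarr s' ''F'' = rarr s ''F''" "narr s' ''B'' = narr s ''B''"
    "narr s' ''X'' = narr s ''X''"
    using assms(2,3) unfolding unchanged_def by blast+
  have out: "output_interval_path I s' = output_interval_path I s"
    by (rule output_interval_path_cong) (fact eq)+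
  show ?thesis using assms(1) unfolding results_ok_def out eq .
qed

definition update_table :: com where
  "update_table = block [
     SetRReg ''r'' (RAdd (RAdd (RArr ''F'' (NSub (NReg ''t1'') (NNum 1))) (RReg ''penalty''))
       (RArr ''key'' (NAdd (NReg ''V'') (NArr ''origin'' (NReg ''t2''))))),
     Cond (BOr (NEq (NArr ''B'' (NReg ''t2'')) (NNum 0)) (RLess (RReg ''r'') (RArr ''F'' (NReg ''t2''))))
       (block [SetRArr ''F'' (NReg ''t2'') (RReg ''r''),
         SetNArr ''B'' (NReg ''t2'') (NReg ''t1''),
         SetNArr ''X'' (NReg ''t2'') (NReg ''p'')])
       Skip]"

definition record_pair :: com where
  "record_pair = Cond (BAnd (NEq (NReg ''ok'') (NNum 1))
       (BNot (NEq (NArr ''reached'' (NArr ''origin'' (NReg ''t2''))) (NNum 0))))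
     (Seq write_path update_table) (SetNArr ''P_exists'' (NReg ''p'') (NNum 0))"

lemma writes_record_pair: "writes record_pair = {''P_exists'', ''P_origin'', ''P_start'', ''P_length'',
    ''P_arc'', ''S_arc'', ''a'', ''v'', ''m'', ''r'', ''F'', ''B'', ''X''}"
  by (auto simp: record_pair_def update_table_def writes_write_path)

lemma path_written_output:
  assumes "path_written v p s s'"
    and "nreg s ''p'' = pair_index (horizon I) a b"
  shows "output_interval_path I s' a b = Some (v, p)"
    and "pair_index (horizon I) x y \<noteq> pair_index (horizon I) a b \<Longrightarrow>
      (narr s ''P_exists'' (pair_index (horizon I) x y) \<noteq> 0 \<Longrightarrow>
        narr s ''P_start'' (pair_index (horizon I) x y) +
        narr s ''P_length'' (pair_index (horizon I) x y) \<le> nreg s ''m'') \<Longrightarrow>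
      output_interval_path I s' x y = output_interval_path I s x y"
proof -
  have "map (narr s' ''P_arc'') [nreg s ''m''..<nreg s ''m'' + length p] = p"
    using assms(1) by (intro nth_equalityI) (auto simp: path_written_def)
  then show "output_interval_path I s' a b = Some (v, p)"
    using assms unfolding output_interval_path_def pair_index_def [symmetric]
    by (simp add: path_written_def Let_def)
  assume "pair_index (horizon I) x y \<noteq> pair_index (horizon I) a b"
    and "narr s ''P_exists'' (pair_index (horizon I) x y) \<noteq> 0 \<Longrightarrow>
        narr s ''P_start'' (pair_index (horizon I) x y) +
        narr s ''P_length'' (pair_index (horizon I) x y) \<le> nreg s ''m''"
  then show "output_interval_path I s' x y = output_interval_path I s x y"
    using assms unfolding output_interval_path_def pair_index_def [symmetric]
    by (auto simp: path_written_def Let_def)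
qed

lemma common_arcs_subset:
  assumes "pricing_problem I" "1 \<le> a" "a \<le> b" "b \<le> horizon I"
  shows "common_arcs I a b \<subseteq> arcs (graph I)"
  using assms by (fastforce simp: common_arcs_def pricing_problem_def)

lemma runs_record_pair:
  assumes I: "pricing_problem I" and V: "verts (graph I) = {..<N}" and inp: "input_ok I es s"
    and ab: "1 \<le> a" "a \<le> b" "b \<le> horizon I"
    and regs: "nreg s ''t1'' = a" "nreg s ''t2'' = b" "nreg s ''p'' = pair_index (horizon I) a b"
      "nreg s ''ok'' = (if same_ends I a b then 1 else 0)"
    and res: "results_ok I (handled I a b) s"
    and st: "search_state (graph I) (destination I b) (common_arcs I a b) (interval_weight I a b) S S {} s"
  shows "runs record_pair s (40 * N + 100) (results_ok I (handled I a (b + 1)))"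
proof -
  let ?G = "graph I" and ?A = "common_arcs I a b" and ?w = "interval_weight I a b"
    and ?O = "origin I b" and ?D = "destination I b" and ?H = "handled I a b"
    and ?ix = "pair_index (horizon I)" and ?out = "output_interval_path I s"
  let ?d = "\<lambda>v. rarr s ''key'' (N + v)"
  have b: "b \<in> {1..horizon I}" using ab by simp
  interpret fin_digraph ?G using I by (simp add: pricing_problem_def)
  have N: "card (verts ?G) = N" using V by simp
  have O: "?O \<in> verts ?G" "?O < N" using I b V unfolding pricing_problem_def by auto
  have A: "?A \<subseteq> arcs ?G" by (rule common_arcs_subset [OF I ab])
  have arrs: "narr s ''origin'' b = ?O" "narr s ''destination'' b = ?D" "nreg s ''V'' = N"
    "rreg s ''penalty'' = penalty I"
    using inp b N unfolding input_ok_def by auto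
  have inv: "search_inv ?G ?D ?A ?w S S {} ?d (narr s ''succ'')"
    and reached: "narr s ''reached'' ?O \<noteq> 0 \<longleftrightarrow> ?O \<in> S"
    using st O by (auto simp: search_state_def Let_def N)
  note result = search_result [OF wf_digraph ab(2) A O(1) inv]
  have oldH: "case ?out x y of None \<Rightarrow> \<not> (\<exists>p. valid_path_on I x y p) | Some p \<Rightarrow> lowest_cost_path I x y p"
      "narr s ''P_exists'' (?ix x y) \<noteq> 0 \<Longrightarrow>
        narr s ''P_start'' (?ix x y) + narr s ''P_length'' (?ix x y) \<le> nreg s ''m''"
    if "(x, y) \<in> ?H" for x y
    using res that unfolding results_ok_def by blast+
  have same: "narr s ''S_arc'' = narr s ''P_arc''"
    and tab: "partial_table I ?H ?out (rarr s ''F'') (narr s ''B'')"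
    and X: "\<And>t. t \<in> {1..horizon I} \<Longrightarrow> narr s ''B'' t \<noteq> 0 \<Longrightarrow> narr s ''X'' t = ?ix (narr s ''B'' t) t"
    using res unfolding results_ok_def by blast+
  have ix: "?ix x y \<noteq> ?ix a b" if "(x, y) \<in> ?H" for x y
    using pair_index_less [OF that ab(1,2)] by simp
  let ?b = "BAnd (NEq (NReg ''ok'') (NNum 1))
       (BNot (NEq (NArr ''reached'' (NArr ''origin'' (NReg ''t2''))) (NNum 0)))"
  have bv: "bval ?b s \<longleftrightarrow> same_ends I a b \<and> ?O \<in> S"
    using reached by (auto simp: regs arrs)
  have "runs record_pair s (1 + bcost ?b + (40 * N + 80)) (results_ok I (insert (a, b) ?H))"
    unfolding record_pair_def
  proof (rule runs_Cond)
    assume "\<not> bval ?b s"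
    then have none: "\<not> (\<exists>p. valid_path_on I a b p)" using bv result(1) by blast
    define s1 where "s1 = effect (SetNArr ''P_exists'' (NReg ''p'') (NNum 0)) s"
    have s1: "s1 = s\<lparr>narr := (narr s)(''P_exists'' := (narr s ''P_exists'')(?ix a b := 0))\<rparr>"
      by (simp add: s1_def regs)
    have out: "output_interval_path I s1 x y = ?out x y" if "(x, y) \<in> ?H" for x y
      using ix [OF that] unfolding output_interval_path_def pair_index_def [symmetric]
      by (simp add: s1 Let_def)
    have outab: "output_interval_path I s1 a b = None"
      unfolding output_interval_path_def pair_index_def [symmetric] by (simp add: s1 Let_def)
    have "partial_table I (insert (a, b) ?H) (output_interval_path I s1) (rarr s ''F'') (narr s ''B'')"
      by (rule partial_table_None [OF tab out outab])
    moreover have "(case output_interval_path I s1 x y of None \<Rightarrow> \<not> (\<exists>p. valid_path_on I x y p)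
          | Some p \<Rightarrow> lowest_cost_path I x y p) \<and>
        (narr s1 ''P_exists'' (?ix x y) \<noteq> 0 \<longrightarrow>
          narr s1 ''P_start'' (?ix x y) + narr s1 ''P_length'' (?ix x y) \<le> nreg s1 ''m'')"
      if xy: "(x, y) \<in> insert (a, b) ?H" for x y
    proof (cases "(x, y) = (a, b)")
      case True
      then show ?thesis using outab none by (simp add: s1)
    next
      case False
      then have H: "(x, y) \<in> ?H" using xy by blast
      show ?thesis using oldH [OF H] ix [OF H] unfolding out [OF H] by (simp add: s1)
    qed
    ultimately have "results_ok I (insert (a, b) ?H) s1"
      using same X unfolding results_ok_def by (simp add: s1)
    then show "runs (SetNArr ''P_exists'' (NReg ''p'') (NNum 0)) s (40 * N + 80)
        (results_ok I (insert (a, b) ?H))"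
      by (intro runs_effect) (simp_all add: s1_def)
  next
    assume "bval ?b s"
    then have ok: "same_ends I a b" "?O \<in> S" using bv by auto
    obtain p where p: "tree_path ?G ?D ?A (narr s ''succ'') S ?O p" "?d ?O = sum_list (map ?w p)"
      using search_final_path [OF inv ok(2)] by blast
    have low: "lowest_cost_path I a b (?O, p)" "interval_cost I a b (?O, p) = ?d ?O"
      using result(2) [OF ok(1) p] by auto
    have "apath ?O p ?D" using tree_path_apath [OF p(1) A O(1)] by blast
    then have len: "length p \<le> N" using length_apath N by metis
    have "runs (Seq write_path update_table) s ((40 * length p + 40) + 40) (results_ok I (insert (a, b) ?H))"
    proof (rule runs_Seq)
      have "runs write_path s (40 * length p + 40) (path_written (narr s ''origin'' (nreg s ''t2'')) p s)"
        by (rule runs_write_path [where G = ?G and A = ?A and S = S])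
          (use p(1) same A inp in \<open>auto simp: regs arrs input_ok_def\<close>)
      then show "runs write_path s (40 * length p + 40)
          (\<lambda>s'. path_written ?O p s s' \<and> unchanged (writes write_path) s s')"
        using runs_frame by (simp add: regs arrs)
    next
      fix s1 assume s1: "path_written ?O p s s1 \<and> unchanged (writes write_path) s s1"
      then have fr: "rarr s1 ''F'' = rarr s ''F''" "narr s1 ''B'' = narr s ''B''" "narr s1 ''X'' = narr s ''X''"
          "nreg s1 ''t1'' = a" "nreg s1 ''t2'' = b" "nreg s1 ''p'' = ?ix a b" "nreg s1 ''V'' = N"
          "rreg s1 ''penalty'' = penalty I" "rarr s1 ''key'' = rarr s ''key''"
          "narr s1 ''origin'' b = ?O"
        by (simp_all add: unchanged_def writes_write_path regs arrs)
      have out: "output_interval_path I s1 x y = ?out x y" if "(x, y) \<in> ?H" for x y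
        using path_written_output(2) [OF conjunct1 [OF s1] regs(3) ix [OF that]] oldH(2) [OF that] by blast
      have outab: "output_interval_path I s1 a b = Some (?O, p)"
        using path_written_output(1) [OF conjunct1 [OF s1] regs(3)] .
      define r where "r = rarr s ''F'' (a - 1) + penalty I + ?d ?O"
      let ?upd = "narr s ''B'' b = 0 \<or> r < rarr s ''F'' b"
      define s2 where "s2 = effect update_table s1"
      have s2: "rarr s2 ''F'' = (if ?upd then (rarr s ''F'')(b := r) else rarr s ''F'')"
        "narr s2 ''B'' = (if ?upd then (narr s ''B'')(b := a) else narr s ''B'')"
        "narr s2 ''X'' = (if ?upd then (narr s ''X'')(b := ?ix a b) else narr s ''X'')"
        "narr s2 ''P_exists'' = narr s1 ''P_exists''" "narr s2 ''P_origin'' = narr s1 ''P_origin''"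
        "narr s2 ''P_start'' = narr s1 ''P_start''" "narr s2 ''P_length'' = narr s1 ''P_length''"
        "narr s2 ''P_arc'' = narr s1 ''P_arc''" "narr s2 ''S_arc'' = narr s1 ''S_arc''"
        "nreg s2 ''m'' = nreg s1 ''m''"
        by (auto simp: s2_def update_table_def fr r_def)
      have out2: "output_interval_path I s2 = output_interval_path I s1"
        by (rule output_interval_path_cong) (fact s2)+
      have "partial_table I (insert (a, b) ?H) (output_interval_path I s1) (rarr s2 ''F'') (narr s2 ''B'')"
        by (rule partial_table_Some [OF tab ab out outab _ s2(1,2)]) (simp_all add: r_def low)
      moreover have "(case output_interval_path I s1 x y of None \<Rightarrow> \<not> (\<exists>p. valid_path_on I x y p)
            | Some p \<Rightarrow> lowest_cost_path I x y p) \<and>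
          (narr s1 ''P_exists'' (?ix x y) \<noteq> 0 \<longrightarrow>
            narr s1 ''P_start'' (?ix x y) + narr s1 ''P_length'' (?ix x y) \<le> nreg s1 ''m'')"
        if xy: "(x, y) \<in> insert (a, b) ?H" for x y
      proof (cases "(x, y) = (a, b)")
        case True
        then show ?thesis using outab low(1) s1 regs(3) by (simp add: path_written_def)
      next
        case False
        then have H: "(x, y) \<in> ?H" using xy by blast
        show ?thesis using oldH [OF H] ix [OF H] s1 regs(3) unfolding out [OF H]
          by (auto simp: path_written_def)
      qed
      moreover have "narr s2 ''X'' t = ?ix (narr s2 ''B'' t) t"
        if "t \<in> {1..horizon I}" "narr s2 ''B'' t \<noteq> 0" for t
        using X [OF that(1)] that(2) by (auto simp: s2 split: if_splits)
      moreover have "narr s1 ''S_arc'' = narr s1 ''P_arc''" using s1 by (simp add: path_written_def)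
      ultimately have "results_ok I (insert (a, b) ?H) s2"
        unfolding results_ok_def out2 s2(4-10) by blast
      then show "runs update_table s1 40 (results_ok I (insert (a, b) ?H))"
        by (intro runs_effect) (simp_all add: s2_def update_table_def)
    qed
    then show "runs (Seq write_path update_table) s (40 * N + 80) (results_ok I (insert (a, b) ?H))"
      by (rule runs_mono) (use len in simp_all)
  qed
  then show ?thesis unfolding handled_Suc [OF ab] by (rule runs_mono) simp_all
qed

section \<open>Handling one interval\<close>

definition stamp :: com where
  "stamp = block [
     increment ''z'',
     Cond (BAnd (NEq (NArr ''origin'' (NReg ''t2'')) (NArr ''origin'' (NReg ''t1'')))
         (NEq (NArr ''destination'' (NReg ''t2'')) (NArr ''destination'' (NReg ''t1''))))
       Skip (SetNReg ''ok'' (NNum 0))]"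

definition prepare :: com where
  "prepare = Seq clear (Seq stamp collect_arcs)"

lemma writes_prepare: "writes prepare = {''i'', ''tree'', ''reached'', ''bucket'', ''z'', ''ok'',
    ''a'', ''v'', ''weight'', ''alive'', ''next''}"
  by (auto simp: prepare_def stamp_def writes_clear writes_collect_arcs)

text \<open>
  The state before the pair \<open>(a, b)\<close> is handled, so the marks belong to the interval up to \<open>b - 1\<close>. At the
  beginning of a row, \<open>a = b\<close>, that interval is empty, and the marks only have to be in the past.
\<close>

definition arcs_state :: "(nat, nat) pricing \<Rightarrow> nat \<Rightarrow> nat \<Rightarrow> state \<Rightarrow> bool" where
  "arcs_state I a b s \<longleftrightarrow>
     (\<forall>e. narr s ''alive'' e \<le> nreg s ''z'') \<and>
     (a < b \<longrightarrow> (\<forall>e. narr s ''alive'' e = nreg s ''z'' \<longleftrightarrow> e \<in> common_arcs I a (b - 1)) \<and>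
       (\<forall>e\<in>common_arcs I a (b - 1). rarr s ''weight'' e = interval_weight I a (b - 1) e)) \<and>
     nreg s ''ok'' = (if same_ends I a (b - 1) then 1 else 0)"

lemma arcs_state_unchanged:
  assumes "arcs_state I a b s" "unchanged X s s'"
    and "X \<inter> {''alive'', ''z'', ''weight'', ''ok''} = {}"
  shows "arcs_state I a b s'"
proof -
  have eq: "narr s' ''alive'' = narr s ''alive''" "nreg s' ''z'' = nreg s ''z''"
    "rarr s' ''weight'' = rarr s ''weight''" "nreg s' ''ok'' = nreg s ''ok''"
    using assms(2,3) unfolding unchanged_def by blast+
  show ?thesis using assms(1) unfolding arcs_state_def eq .
qed

lemma interval_snoc:
  fixes a b :: nat
  assumes "1 \<le> a" "a \<le> b"
  shows "{a..b} = insert b {a..b - 1}"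
  using assms by auto

lemma common_arcs_snoc:
  assumes "1 \<le> a" "a \<le> b"
  shows "e \<in> common_arcs I a b \<longleftrightarrow> e \<in> allowed I b \<and> (a = b \<or> e \<in> common_arcs I a (b - 1))"
proof (cases "a = b")
  case False
  then show ?thesis unfolding common_arcs_def interval_snoc [OF assms] by blast
qed (simp add: common_arcs_def)

lemma interval_weight_snoc:
  assumes "1 \<le> a" "a \<le> b"
  shows "interval_weight I a b e =
    (if a = b then 0 else interval_weight I a (b - 1) e) - demand I * dual I e b"
proof (cases "a = b")
  case False
  have "b \<notin> {a..b - 1}" using assms by auto
  then show ?thesis using False unfolding interval_weight_def interval_snoc [OF assms] by simp
qed (simp add: interval_weight_def)

lemma same_ends_snoc:
  assumes "1 \<le> a" "a \<le> b"
  shows "same_ends I a b \<longleftrightarrow> same_ends I a (b - 1) \<and>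
    origin I b = origin I a \<and> destination I b = destination I a"
  unfolding same_ends_def interval_snoc [OF assms] by blast

lemma interval_weight_nonneg:
  assumes "pricing_problem I" "1 \<le> a" "b \<le> horizon I" "e \<in> common_arcs I a b"
  shows "0 \<le> interval_weight I a b e"
  unfolding interval_weight_def
proof (rule sum_nonneg)
  fix t assume t: "t \<in> {a..b}"
  then have "t \<in> {1..horizon I}" "e \<in> allowed I t" using assms by (auto simp: common_arcs_def)
  then have "dual I e t \<le> 0" "0 \<le> demand I" using assms(1) unfolding pricing_problem_def by blast+
  then show "0 \<le> - demand I * dual I e t" by (simp add: mult_nonneg_nonpos)
qed

lemma runs_prepare:
  assumes I: "pricing_problem I" and V: "verts (graph I) = {..<N}"
    and es: "distinct (es b)" "set (es b) = allowed I b" and inp: "input_ok I es s"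
    and par: "\<And>j. j \<in> {1..<2 * N} \<Longrightarrow> narr s ''parent'' j = j div 2"
    and ab: "1 \<le> a" "a \<le> b" "b \<le> horizon I"
    and regs: "nreg s ''t1'' = a" "nreg s ''t2'' = b" and arcs: "arcs_state I a b s"
  shows "runs prepare s (60 * N + 100 * length (es b) + 70) (\<lambda>s'. arcs_state I a (b + 1) s' \<and>
    (\<forall>j<2 * N. narr s' ''tree'' j = 0 \<and> narr s' ''reached'' j = 0) \<and>
    (\<exists>adj. search_env (graph I) (common_arcs I a b) (interval_weight I a b) adj s' \<and>
       (\<Sum>v<N. length (adj v)) \<le> length (es b)))"
proof -
  let ?G = "graph I" and ?A = "common_arcs I a b" and ?w = "interval_weight I a b"
  let ?E = "length (es b)"
  have b: "b \<in> {1..horizon I}" "a \<in> {1..horizon I}" using ab by auto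
  interpret fin_digraph ?G using I by (simp add: pricing_problem_def)
  have A: "?A \<subseteq> arcs ?G" by (rule common_arcs_subset [OF I ab])
  have N: "card (verts ?G) = N" using V by simp
  have arrs: "narr s ''origin'' b = origin I b" "narr s ''origin'' a = origin I a"
    "narr s ''destination'' b = destination I b" "narr s ''destination'' a = destination I a"
    "nreg s ''V'' = N" "rreg s ''demand'' = demand I"
    "narr s ''first'' (b + 1) = narr s ''first'' b + ?E"
    using inp b N unfolding input_ok_def by auto
  have arrs2: "\<And>k. k < ?E \<Longrightarrow> narr s ''arc'' (narr s ''first'' b + k) = es b ! k"
      "\<And>k. k < ?E \<Longrightarrow> rarr s ''dual'' (narr s ''first'' b + k) = dual I (es b ! k) b"
    using inp b(1) unfolding input_ok_def by blast+
  have arrs3: "\<And>e. e \<in> arcs ?G \<Longrightarrow> narr s ''tail'' e = tail ?G e"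
      "\<And>e. e \<in> arcs ?G \<Longrightarrow> narr s ''head'' e = head ?G e"
    using inp unfolding input_ok_def by blast+
  have allowed: "allowed I b \<subseteq> arcs ?G" using I b unfolding pricing_problem_def by blast
  have alive: "\<And>e. narr s ''alive'' e \<le> nreg s ''z''"
    "a < b \<Longrightarrow> narr s ''alive'' e = nreg s ''z'' \<longleftrightarrow> e \<in> common_arcs I a (b - 1)"
    "a < b \<Longrightarrow> e \<in> common_arcs I a (b - 1) \<Longrightarrow> rarr s ''weight'' e = interval_weight I a (b - 1) e"
    "nreg s ''ok'' = (if same_ends I a (b - 1) then 1 else 0)" for e
    using arcs unfolding arcs_state_def by blast+
  let ?Q = "\<lambda>s'. arcs_state I a (b + 1) s' \<and>
    (\<forall>j<2 * N. narr s' ''tree'' j = 0 \<and> narr s' ''reached'' j = 0) \<and>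
    (\<exists>adj. search_env ?G ?A ?w adj s' \<and> (\<Sum>v<N. length (adj v)) \<le> ?E)"
  have "runs prepare s ((60 * N + 20) + (30 + (100 * ?E + 20))) ?Q"
    unfolding prepare_def
  proof (rule runs_Seq)
    show "runs clear s (60 * N + 20) (\<lambda>s'. (\<forall>j<2 * N. narr s' ''tree'' j = 0 \<and>
      narr s' ''reached'' j = 0 \<and> narr s' ''bucket'' j = 0) \<and> unchanged (writes clear) s s')"
      by (rule runs_frame, rule runs_clear) (rule arrs)
  next
    fix s1 assume s1: "(\<forall>j<2 * N. narr s1 ''tree'' j = 0 \<and>
      narr s1 ''reached'' j = 0 \<and> narr s1 ''bucket'' j = 0) \<and> unchanged (writes clear) s s1"
    then have fr1: "x \<notin> {''i'', ''tree'', ''reached'', ''bucket''} \<Longrightarrow> nreg s1 x = nreg s x \<and>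
        narr s1 x = narr s x \<and> rreg s1 x = rreg s x \<and> rarr s1 x = rarr s x" for x
      unfolding unchanged_def writes_clear by blast
    define s2 where "s2 = effect stamp s1"
    have s2: "s2 = s1\<lparr>nreg := (nreg s1)(''z'' := nreg s ''z'' + 1,
        ''ok'' := (if same_ends I a b then 1 else 0))\<rparr>"
      using alive(4) same_ends_snoc [OF ab(1,2), of I]
      by (simp add: s2_def stamp_def fr1 regs arrs fun_upd_idem)
    show "runs (Seq stamp collect_arcs) s1 (30 + (100 * ?E + 20)) ?Q"
    proof (rule runs_Seq)
      show "runs stamp s1 30 (\<lambda>s'. s' = s2)"
        by (rule runs_effect) (simp_all add: stamp_def s2_def)
    next
      fix s' assume s': "s' = s2"
      let ?live = "{e \<in> set (es b). nreg s2 ''t1'' = nreg s2 ''t2'' \<or>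
        narr s2 ''alive'' e + 1 = nreg s2 ''z''}"
      have live: "?live = ?A"
      proof (rule set_eqI)
        fix e
        have "e \<in> ?live \<longleftrightarrow> e \<in> allowed I b \<and> (a = b \<or> narr s ''alive'' e = nreg s ''z'')"
          by (simp add: s2 fr1 regs es)
        also have "\<dots> \<longleftrightarrow> e \<in> ?A"
          using alive(2) [of e] ab(2) unfolding common_arcs_snoc [OF ab(1,2)]
          by (cases "a = b") auto
        finally show "e \<in> ?live \<longleftrightarrow> e \<in> ?A" .
      qed
      have fr2: "nreg s2 ''t1'' = a" "nreg s2 ''t2'' = b" "nreg s2 ''z'' = nreg s ''z'' + 1"
        "narr s2 ''alive'' = narr s ''alive''" "rarr s2 ''weight'' = rarr s ''weight''"
        "rreg s2 ''demand'' = demand I" "narr s2 ''first'' = narr s ''first''"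
        "narr s2 ''arc'' = narr s ''arc''" "rarr s2 ''dual'' = rarr s ''dual''"
        "narr s2 ''head'' = narr s ''head''" "narr s2 ''tail'' = narr s ''tail''"
        "nreg s2 ''V'' = N" "narr s2 ''parent'' = narr s ''parent''"
        "nreg s2 ''ok'' = (if same_ends I a b then 1 else 0)"
        by (simp_all add: s2 fr1 regs arrs)
      have "runs collect_arcs s2 (100 * ?E + 20) (\<lambda>s'.
          (\<forall>e. narr s' ''alive'' e = (if e \<in> ?live then nreg s2 ''z'' else narr s2 ''alive'' e)) \<and>
          (\<forall>e\<in>?live. rarr s' ''weight'' e =
            (if nreg s2 ''t1'' = nreg s2 ''t2'' then 0 else rarr s2 ''weight'' e)
              - rreg s2 ''demand'' * dual I e b) \<and>
          (\<exists>adj. buckets_ok N (head ?G) ?live adj s' \<and> (\<Sum>v<N. length (adj v)) \<le> ?E))"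
      proof (rule runs_collect_arcs)
        show "narr s2 ''first'' (nreg s2 ''t2'') = narr s ''first'' b" by (simp add: fr2)
        show "narr s2 ''first'' (nreg s2 ''t2'' + 1) = narr s ''first'' b + ?E"
          using arrs by (simp add: fr2)
        show "\<And>k. k < ?E \<Longrightarrow> narr s2 ''arc'' (narr s ''first'' b + k) = es b ! k"
          using arrs2 by (simp add: fr2)
        show "\<And>k. k < ?E \<Longrightarrow> rarr s2 ''dual'' (narr s ''first'' b + k) = dual I (es b ! k) b"
          using arrs2 by (simp add: fr2)
        show "distinct (es b)" by (rule es)
        show "\<And>e. e \<in> set (es b) \<Longrightarrow> narr s2 ''head'' e = head ?G e \<and> head ?G e < N"
          using es allowed arrs3 head_in_verts V by (auto simp: fr2)
        show "\<And>v. v < N \<Longrightarrow> narr s2 ''bucket'' v = 0" using s1 by (simp add: s2)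
      qed
      from runs_frame [OF this] show "runs collect_arcs s' (100 * ?E + 20) ?Q"
        unfolding s'
      proof (rule runs_mono)
        fix s3 assume *: "((\<forall>e. narr s3 ''alive'' e = (if e \<in> ?live then nreg s2 ''z'' else narr s2 ''alive'' e)) \<and>
          (\<forall>e\<in>?live. rarr s3 ''weight'' e =
            (if nreg s2 ''t1'' = nreg s2 ''t2'' then 0 else rarr s2 ''weight'' e)
              - rreg s2 ''demand'' * dual I e b) \<and>
          (\<exists>adj. buckets_ok N (head ?G) ?live adj s3 \<and> (\<Sum>v<N. length (adj v)) \<le> ?E)) \<and>
          unchanged (writes collect_arcs) s2 s3"
        then have al: "narr s3 ''alive'' e = (if e \<in> ?A then nreg s ''z'' + 1 else narr s ''alive'' e)"
          and wt: "e \<in> ?A \<Longrightarrow> rarr s3 ''weight'' e =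
            (if a = b then 0 else rarr s ''weight'' e) - demand I * dual I e b" for e
          unfolding live unfolding fr2 by blast+
        have fr3: "nreg s3 ''z'' = nreg s ''z'' + 1" "nreg s3 ''ok'' = (if same_ends I a b then 1 else 0)"
          "narr s3 ''tree'' = narr s1 ''tree''" "narr s3 ''reached'' = narr s1 ''reached''"
          "nreg s3 ''V'' = N" "narr s3 ''parent'' = narr s ''parent''"
          "narr s3 ''tail'' = narr s ''tail''" "narr s3 ''head'' = narr s ''head''"
          using * by (simp_all add: unchanged_def writes_collect_arcs fr2) (simp_all add: s2)
        have wt': "rarr s3 ''weight'' e = ?w e" if "e \<in> ?A" for e
          using wt [OF that] alive(3) [of e] that ab(2)
          unfolding interval_weight_snoc [OF ab(1,2)] common_arcs_snoc [OF ab(1,2)]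
          by (auto split: if_splits)
        have "narr s3 ''alive'' e = nreg s3 ''z'' \<longleftrightarrow> e \<in> ?A" for e
          using alive(1) [of e] by (simp add: al fr3)
        moreover have "narr s3 ''alive'' e \<le> nreg s3 ''z''" for e
          using alive(1) [of e] by (simp add: al fr3)
        ultimately have "arcs_state I a (b + 1) s3"
          using wt' by (simp add: arcs_state_def fr3)
        moreover obtain adj where adj: "buckets_ok N (head ?G) ?A adj s3"
            "(\<Sum>v<N. length (adj v)) \<le> ?E"
          using * unfolding live by blast
        then have "search_env ?G ?A ?w adj s3"
          using A V par wt' interval_weight_nonneg [OF I ab(1,3)] arrs3
            tail_in_verts head_in_verts
          unfolding search_env_def N fr3 buckets_ok_def by blast
        moreover have "\<forall>j<2 * N. narr s3 ''tree'' j = 0 \<and> narr s3 ''reached'' j = 0"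
          using s1 by (simp add: fr3)
        ultimately show "?Q s3" using adj(2) by blast
      qed simp
    qed
  qed
  then show ?thesis by (rule runs_mono) auto
qed

definition handle_pair :: com where
  "handle_pair = Seq prepare (Seq search (Seq record_pair (block [increment ''p'', increment ''t2''])))"

lemma writes_handle_pair: "writes handle_pair = {''i'', ''tree'', ''reached'', ''bucket'', ''z'', ''ok'',
    ''a'', ''v'', ''weight'', ''alive'', ''next'', ''u'', ''l'', ''x'', ''e'', ''succ'', ''key'', ''c'',
    ''P_exists'', ''P_origin'', ''P_start'', ''P_length'', ''P_arc'', ''S_arc'', ''m'', ''r'', ''F'',
    ''B'', ''X'', ''p'', ''t2''}"
  by (auto simp: handle_pair_def writes_prepare writes_search writes_record_pair)

definition loop_inv :: "(nat, nat) pricing \<Rightarrow> (nat \<Rightarrow> nat list) \<Rightarrow> nat \<Rightarrow> nat \<Rightarrow> state \<Rightarrow> bool" where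
  "loop_inv I es a b s \<longleftrightarrow> input_ok I es s \<and>
     (\<forall>j\<in>{1..<2 * card (verts (graph I))}. narr s ''parent'' j = j div 2) \<and>
     nreg s ''t1'' = a \<and> nreg s ''t2'' = b \<and> nreg s ''p'' = pair_index (horizon I) a b \<and>
     arcs_state I a b s \<and> results_ok I (handled I a b) s"

text \<open>
  The factor 1000 generously covers the constants of all parts of the program for one pair.
\<close>

definition pair_time :: "nat \<Rightarrow> nat \<Rightarrow> nat" where
  "pair_time N E = 1000 * (floor_log N + 1) * (N + E)"

lemma runs_handle_pair:
  assumes I: "pricing_problem I" and V: "verts (graph I) = {..<N}"
    and es: "distinct (es b)" "set (es b) = allowed I b" "length (es b) \<le> E"
    and ab: "1 \<le> a" "a \<le> b" "b \<le> horizon I" and inv: "loop_inv I es a b s"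
  shows "runs handle_pair s (pair_time N E) (loop_inv I es a (b + 1))"
proof -
  let ?G = "graph I" and ?A = "common_arcs I a b" and ?w = "interval_weight I a b"
  let ?ix = "pair_index (horizon I)"
  define L where "L = floor_log N + 1"
  have b: "b \<in> {1..horizon I}" using ab by auto
  have N: "card (verts ?G) = N" using V by simp
  have Db: "destination I b \<in> verts ?G" using I b unfolding pricing_problem_def by blast
  then have N0: "0 < N" using V by auto
  have inp: "input_ok I es s" and par: "\<And>j. j \<in> {1..<2 * N} \<Longrightarrow> narr s ''parent'' j = j div 2"
    and regs: "nreg s ''t1'' = a" "nreg s ''t2'' = b" "nreg s ''p'' = ?ix a b"
    and arcs: "arcs_state I a b s" and res: "results_ok I (handled I a b) s"
    using inv unfolding loop_inv_def N by blast+
  let ?Q = "\<lambda>s'. arcs_state I a (b + 1) s' \<and> results_ok I (handled I a (b + 1)) s' \<and>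
      nreg s' ''p'' = ?ix a (b + 1) \<and> nreg s' ''t2'' = b + 1"
  let ?t1 = "60 * N + 100 * E + 70"
  let ?t2 = "N * (60 * L + 45) + E * (60 * L + 84) + 60 * L + 40"
  let ?t3 = "40 * N + 100"
  have "runs handle_pair s (?t1 + (?t2 + (?t3 + 8))) ?Q"
    unfolding handle_pair_def
  proof (rule runs_Seq)
    have "runs prepare s ?t1 (\<lambda>s'. arcs_state I a (b + 1) s' \<and>
      (\<forall>j<2 * N. narr s' ''tree'' j = 0 \<and> narr s' ''reached'' j = 0) \<and>
      (\<exists>adj. search_env ?G ?A ?w adj s' \<and> (\<Sum>v<N. length (adj v)) \<le> E))"
      by (rule runs_mono [OF runs_prepare [OF I V es(1,2) inp par ab regs(1,2) arcs]])
        (use es(3) in \<open>auto intro: le_trans\<close>)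
    then show "runs prepare s ?t1 (\<lambda>s'. (arcs_state I a (b + 1) s' \<and>
      (\<forall>j<2 * N. narr s' ''tree'' j = 0 \<and> narr s' ''reached'' j = 0) \<and>
      (\<exists>adj. search_env ?G ?A ?w adj s' \<and> (\<Sum>v<N. length (adj v)) \<le> E)) \<and>
      unchanged (writes prepare) s s')"
      by (rule runs_frame)
  next
    fix s1 assume s1: "(arcs_state I a (b + 1) s1 \<and>
      (\<forall>j<2 * N. narr s1 ''tree'' j = 0 \<and> narr s1 ''reached'' j = 0) \<and>
      (\<exists>adj. search_env ?G ?A ?w adj s1 \<and> (\<Sum>v<N. length (adj v)) \<le> E)) \<and>
      unchanged (writes prepare) s s1"
    have inp1: "input_ok I es s1"
      by (rule input_ok_unchanged [OF inp, of "writes prepare"]) (use s1 in \<open>auto simp: writes_prepare\<close>)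
    have res1: "results_ok I (handled I a b) s1"
      by (rule results_ok_unchanged [OF res, of "writes prepare"]) (use s1 in \<open>auto simp: writes_prepare\<close>)
    have regs1: "nreg s1 ''t1'' = a" "nreg s1 ''t2'' = b" "nreg s1 ''p'' = ?ix a b"
      using s1 regs by (simp_all add: unchanged_def writes_prepare)
    obtain adj where env: "search_env ?G ?A ?w adj s1" and adj: "(\<Sum>v<N. length (adj v)) \<le> E"
      using s1 by blast
    show "runs (Seq search (Seq record_pair (block [increment ''p'', increment ''t2'']))) s1
        (?t2 + (?t3 + 8)) ?Q"
    proof (rule runs_Seq)
      have "runs search s1 ((\<Sum>v<card (verts ?G). 60 * L + 45 + length (adj v) * (60 * L + 84)) + 60 * L + 40)
          (\<lambda>s'. \<exists>S. search_state ?G (destination I b) ?A ?w S S {} s')"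
        by (rule runs_search [OF env _ Db])
          (use inp1 regs1 b s1 in \<open>auto simp: input_ok_def N L_def\<close>)
      then have "runs search s1 ?t2 (\<lambda>s'. \<exists>S. search_state ?G (destination I b) ?A ?w S S {} s')"
      proof (rule runs_mono)
        have "(\<Sum>v<N. length (adj v) * (60 * L + 84)) \<le> E * (60 * L + 84)"
          using adj unfolding sum_distrib_right [symmetric] by (rule mult_right_mono) simp
        then show "(\<Sum>v<card (verts ?G). 60 * L + 45 + length (adj v) * (60 * L + 84)) + 60 * L + 40 \<le> ?t2"
          unfolding N sum.distrib by (simp add: algebra_simps)
      qed
      then show "runs search s1 ?t2 (\<lambda>s'. (\<exists>S. search_state ?G (destination I b) ?A ?w S S {} s') \<and>
          unchanged (writes search) s1 s')"
        by (rule runs_frame)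
    next
      fix s2 assume s2: "(\<exists>S. search_state ?G (destination I b) ?A ?w S S {} s2) \<and>
          unchanged (writes search) s1 s2"
      then obtain S where S: "search_state ?G (destination I b) ?A ?w S S {} s2" by blast
      have inp2: "input_ok I es s2"
        by (rule input_ok_unchanged [OF inp1, of "writes search"]) (use s2 in \<open>auto simp: writes_search\<close>)
      have res2: "results_ok I (handled I a b) s2"
        by (rule results_ok_unchanged [OF res1, of "writes search"]) (use s2 in \<open>auto simp: writes_search\<close>)
      have arcs2: "arcs_state I a (b + 1) s2"
        by (rule arcs_state_unchanged [of _ _ _ s1 "writes search"])
          (use s1 s2 in \<open>auto simp: writes_search\<close>)
      have regs2: "nreg s2 ''t1'' = a" "nreg s2 ''t2'' = b" "nreg s2 ''p'' = ?ix a b"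
        using s2 regs1 by (simp_all add: unchanged_def writes_search)
      have ok2: "nreg s2 ''ok'' = (if same_ends I a b then 1 else 0)"
        using arcs2 by (simp add: arcs_state_def)
      show "runs (Seq record_pair (block [increment ''p'', increment ''t2''])) s2 (?t3 + 8) ?Q"
      proof (rule runs_Seq)
        show "runs record_pair s2 ?t3 (\<lambda>s'. results_ok I (handled I a (b + 1)) s' \<and>
            unchanged (writes record_pair) s2 s')"
          by (rule runs_frame, rule runs_record_pair [OF I V inp2 ab regs2 ok2 res2 S])
      next
        fix s3 assume s3: "results_ok I (handled I a (b + 1)) s3 \<and> unchanged (writes record_pair) s2 s3"
        have arcs3: "arcs_state I a (b + 1) s3"
          by (rule arcs_state_unchanged [OF arcs2, of "writes record_pair"])
            (use s3 in \<open>auto simp: writes_record_pair\<close>)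
        have regs3: "nreg s3 ''t2'' = b" "nreg s3 ''p'' = ?ix a b"
          using s3 regs2 by (simp_all add: unchanged_def writes_record_pair)
        let ?c = "block [increment ''p'', increment ''t2'']"
        have u: "unchanged (writes ?c) s3 (effect ?c s3)"
          by (auto simp: unchanged_def)
        have "arcs_state I a (b + 1) (effect ?c s3)"
          by (rule arcs_state_unchanged [OF arcs3 u]) simp
        moreover have "results_ok I (handled I a (b + 1)) (effect ?c s3)"
          by (rule results_ok_unchanged [OF conjunct1 [OF s3] u]) simp
        ultimately have "?Q (effect ?c s3)"
          using regs3 ab by (simp add: pair_index_def)
        then show "runs ?c s3 8 ?Q" by (rule runs_effect [rotated 2]) simp_all
      qed
    qed
  qed
  from runs_frame [OF this] show ?thesis
  proof (rule runs_mono)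
    fix s' assume *: "?Q s' \<and> unchanged (writes handle_pair) s s'"
    have "input_ok I es s'"
      by (rule input_ok_unchanged [OF inp, of "writes handle_pair"])
        (use * in \<open>auto simp: writes_handle_pair\<close>)
    moreover have "narr s' ''parent'' = narr s ''parent''" "nreg s' ''t1'' = a"
      using * regs by (simp_all add: unchanged_def writes_handle_pair)
    ultimately show "loop_inv I es a (b + 1) s'"
      using * par by (simp add: loop_inv_def N)
  next
    have "1 \<le> L" by (simp add: L_def)
    then have "N \<le> N * L" "E \<le> E * L" "L \<le> N * L" "1 \<le> N * L" using N0 by simp_all
    moreover have "?t1 + (?t2 + (?t3 + 8)) = 145 * N + 184 * E + 218 + 60 * (N * L) + 60 * (E * L) + 60 * L"
      by (simp add: algebra_simps)
    moreover have "pair_time N E = 1000 * (N * L) + 1000 * (E * L)"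
      by (simp add: pair_time_def L_def algebra_simps)
    ultimately show "?t1 + (?t2 + (?t3 + 8)) \<le> pair_time N E" by linarith
  qed
qed

section \<open>All intervals with the same start\<close>

definition row_inv :: "(nat, nat) pricing \<Rightarrow> (nat \<Rightarrow> nat list) \<Rightarrow> nat \<Rightarrow> state \<Rightarrow> bool" where
  "row_inv I es a s \<longleftrightarrow> input_ok I es s \<and>
     (\<forall>j\<in>{1..<2 * card (verts (graph I))}. narr s ''parent'' j = j div 2) \<and>
     nreg s ''t1'' = a \<and> nreg s ''p'' = pair_index (horizon I) a a \<and>
     (\<forall>e. narr s ''alive'' e \<le> nreg s ''z'') \<and> results_ok I (handled I a a) s"

text \<open>
  The pairs of a row end at the index \<open>t1 * T\<close>; adding \<open>t1\<close> skips the unused pairs with \<open>t2 < t1\<close> in the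
  next row.
\<close>

definition handle_row :: com where
  "handle_row = Seq (block [SetNReg ''t2'' (NReg ''t1''), SetNReg ''ok'' (NNum 1)])
     (Seq (While (NLess (NReg ''t2'') (NAdd (NReg ''T'') (NNum 1))) handle_pair)
       (block [SetNReg ''p'' (NAdd (NReg ''p'') (NReg ''t1'')), increment ''t1'']))"

lemma runs_handle_row:
  assumes I: "pricing_problem I" and V: "verts (graph I) = {..<N}"
    and es: "\<And>t. t \<in> {1..horizon I} \<Longrightarrow> distinct (es t) \<and> set (es t) = allowed I t \<and> length (es t) \<le> E"
    and a: "1 \<le> a" "a \<le> horizon I" and inv: "row_inv I es a s"
  shows "runs handle_row s (horizon I * (pair_time N E + 6) + 20) (row_inv I es (a + 1))"
proof -
  let ?T = "horizon I"
  let ?b = "NLess (NReg ''t2'') (NAdd (NReg ''T'') (NNum 1))"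
  let ?c1 = "block [SetNReg ''t2'' (NReg ''t1''), SetNReg ''ok'' (NNum 1)]"
  let ?c2 = "block [SetNReg ''p'' (NAdd (NReg ''p'') (NReg ''t1'')), increment ''t1'']"
  have row: "input_ok I es s" "\<forall>j\<in>{1..<2 * card (verts (graph I))}. narr s ''parent'' j = j div 2"
     "nreg s ''t1'' = a" "nreg s ''p'' = pair_index ?T a a"
     "\<forall>e. narr s ''alive'' e \<le> nreg s ''z''" "results_ok I (handled I a a) s"
    using inv unfolding row_inv_def by blast+
  have "runs handle_row s (4 + ((?T * (pair_time N E + 6) + 6) + 8)) (row_inv I es (a + 1))"
    unfolding handle_row_def
  proof (rule runs_Seq)
    have u: "unchanged (writes ?c1) s (effect ?c1 s)" by (auto simp: unchanged_def)
    have "input_ok I es (effect ?c1 s)" by (rule input_ok_unchanged [OF row(1) u]) simp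
    moreover have "results_ok I (handled I a a) (effect ?c1 s)"
      by (rule results_ok_unchanged [OF row(6) u]) simp
    moreover have "arcs_state I a a (effect ?c1 s)"
      using row(5) a(1) by (simp add: arcs_state_def same_ends_def)
    ultimately have "loop_inv I es a a (effect ?c1 s)"
      unfolding loop_inv_def using row(2,3,4) by (auto simp only: effect.simps block.simps) auto
    then show "runs ?c1 s 4 (loop_inv I es a a)"
      by (rule runs_effect [rotated 2]) simp_all
  next
    fix s1 assume s1: "loop_inv I es a a s1"
    show "runs (Seq (While ?b handle_pair) ?c2) s1 (?T * (pair_time N E + 6) + 6 + 8) (row_inv I es (a + 1))"
    proof (rule runs_Seq)
      let ?Inv = "\<lambda>n s'. \<exists>b. a \<le> b \<and> b \<le> ?T + 1 \<and> n = ?T + 1 - b \<and> loop_inv I es a b s'"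
      show "runs (While ?b handle_pair) s1 (?T * (pair_time N E + 6) + 6) (loop_inv I es a (?T + 1))"
      proof (rule runs_While_count [where Inv = ?Inv and l = "pair_time N E"])
        show "?Inv (?T + 1 - a) s1" using s1 a by (intro exI [of _ a]) simp
      next
        fix n s' assume "?Inv n s'" and bv: "bval ?b s'"
        then obtain b where b: "a \<le> b" "b \<le> ?T + 1" "n = ?T + 1 - b" "loop_inv I es a b s'" by blast
        have bT: "b \<le> ?T" using bv b(4) by (simp add: loop_inv_def input_ok_def)
        have e: "distinct (es b)" "set (es b) = allowed I b" "length (es b) \<le> E"
          using es [of b] b(1) bT a(1) by auto
        have "runs handle_pair s' (pair_time N E) (loop_inv I es a (b + 1))"
          by (rule runs_handle_pair [where es = es and b = b, OF I V e a(1) b(1) bT b(4)])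
        then have "runs handle_pair s' (pair_time N E) (?Inv (?T - b))"
          by (rule runs_mono) (use b bT in \<open>auto intro!: exI [of _ "b + 1"]\<close>)
        then show "\<exists>m. n = Suc m \<and> runs handle_pair s' (pair_time N E) (?Inv m)"
          using b(3) bT by (intro exI [of _ "?T - b"]) simp
      next
        have "(?T + 1 - a) * (pair_time N E + 6) \<le> ?T * (pair_time N E + 6)"
          using a(1) by (intro mult_right_mono) auto
        then show "(?T + 1 - a) * (1 + bcost ?b + pair_time N E) + 1 + bcost ?b
            \<le> ?T * (pair_time N E + 6) + 6"
          by (simp add: algebra_simps)
      next
        fix n s' assume "?Inv n s'" and bv: "\<not> bval ?b s'"
        then obtain b where b: "b \<le> ?T + 1" "loop_inv I es a b s'" by blast
        then have "b = ?T + 1" using bv by (simp add: loop_inv_def input_ok_def)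
        then show "loop_inv I es a (?T + 1) s'" using b by simp
      qed
    next
      fix s2 assume "loop_inv I es a (?T + 1) s2"
      then have l: "input_ok I es s2" "\<forall>j\<in>{1..<2 * card (verts (graph I))}. narr s2 ''parent'' j = j div 2"
        "nreg s2 ''t1'' = a" "nreg s2 ''p'' = pair_index ?T a (?T + 1)"
        "arcs_state I a (?T + 1) s2" "results_ok I (handled I (a + 1) (a + 1)) s2"
        unfolding loop_inv_def handled_next_row by blast+
      have u: "unchanged (writes ?c2) s2 (effect ?c2 s2)" by (auto simp: unchanged_def)
      have "input_ok I es (effect ?c2 s2)" by (rule input_ok_unchanged [OF l(1) u]) simp
      moreover have "results_ok I (handled I (a + 1) (a + 1)) (effect ?c2 s2)"
        by (rule results_ok_unchanged [OF l(6) u]) simp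
      moreover have "pair_index ?T a (?T + 1) + a = pair_index ?T (a + 1) (a + 1)"
        using a(1) by (cases a) (auto simp: pair_index_def)
      then have "nreg (effect ?c2 s2) ''p'' = pair_index ?T (a + 1) (a + 1)"
        using l(3,4) by simp
      moreover have "\<forall>e. narr s2 ''alive'' e \<le> nreg s2 ''z''" using l(5) by (simp add: arcs_state_def)
      then have "\<forall>e. narr (effect ?c2 s2) ''alive'' e \<le> nreg (effect ?c2 s2) ''z''" by simp
      moreover have "\<forall>j\<in>{1..<2 * card (verts (graph I))}. narr (effect ?c2 s2) ''parent'' j = j div 2"
        "nreg (effect ?c2 s2) ''t1'' = a + 1"
        using l(2,3) by simp_all
      ultimately have "row_inv I es (a + 1) (effect ?c2 s2)"
        unfolding row_inv_def by blast
      then show "runs ?c2 s2 8 (row_inv I es (a + 1))"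
        by (rule runs_effect [rotated 2]) simp_all
    qed
  qed
  then show ?thesis by (rule runs_mono) auto
qed

section \<open>Tracing an optimal sequence\<close>

definition trace_step :: com where
  "trace_step = block [
     Cond (NLess (NReg ''t'') (NReg ''j''))
       (block [SetNReg ''j'' (NArr ''B'' (NReg ''t'')), SetNReg ''q'' (NArr ''X'' (NReg ''t''))]) Skip,
     SetNArr ''S_origin'' (NReg ''t'') (NArr ''P_origin'' (NReg ''q'')),
     SetNArr ''S_start'' (NReg ''t'') (NArr ''P_start'' (NReg ''q'')),
     SetNArr ''S_length'' (NReg ''t'') (NArr ''P_length'' (NReg ''q'')),
     SetNReg ''t'' (NSub (NReg ''t'') (NNum 1))]"

definition trace :: com where
  "trace = Seq (block [SetNReg ''t'' (NReg ''T''), SetNReg ''j'' (NAdd (NReg ''T'') (NNum 1))])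
     (While (NLess (NNum 0) (NReg ''t'')) trace_step)"

text \<open>
  If \<open>t < j\<close>, a block has been completed and the next one ends at \<open>t\<close>. Otherwise the block \<open>{j..e}\<close> is being
  written, and \<open>q\<close> is the position of its path.
\<close>

definition traced :: "(nat \<Rightarrow> nat \<Rightarrow> ('v, 'a) path option) \<Rightarrow> (nat \<Rightarrow> nat) \<Rightarrow> nat \<Rightarrow>
    (nat \<Rightarrow> ('v, 'a) path) \<Rightarrow> nat \<Rightarrow> nat \<Rightarrow> nat \<Rightarrow> bool" where
  "traced P B n s t j q \<longleftrightarrow> (if t < j then blocks P B n s t
     else \<exists>e\<in>{1..n}. t \<le> e \<and> blocks P B n s e \<and> j = B e \<and> q = pair_index n (B e) e \<and>
       (\<forall>u\<in>{t + 1..e}. P (B e) e = Some (s u)))"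

lemma traced_step:
  assumes tab: "dp_table I P n F B" and tr: "traced P B n s t j q" and t: "t \<in> {1..n}"
    and j': "j' = (if t < j then B t else j)"
    and q': "q' = (if t < j then pair_index n (B t) t else q)"
    and s': "\<And>u. u \<noteq> t \<Longrightarrow> s' u = s u"
      "\<And>x y. P x y \<noteq> None \<Longrightarrow> q' = pair_index n x y \<Longrightarrow> P x y = Some (s' t)"
  shows "traced P B n s' (t - 1) j' q'"
proof -
  obtain e where e: "e \<in> {1..n}" "t \<le> e" "blocks P B n s e" "j' = B e" "q' = pair_index n (B e) e"
    "j' \<le> t" "\<forall>u\<in>{t + 1..e}. P (B e) e = Some (s u)"
  proof (cases "t < j")
    case True
    have "B t \<le> t" using dp_table_choice [OF tab t] by metis
    then show ?thesis using that [of t] True t tr j' q' unfolding traced_def by auto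
  next
    case False
    then show ?thesis using that tr j' q' unfolding traced_def by auto
  qed
  obtain p where p: "1 \<le> B e" "B e \<le> e" "P (B e) e = Some p"
    using dp_table_choice [OF tab e(1)] by metis
  have "P (B e) e = Some (s' t)" using s'(2) [OF _ e(5)] p(3) by simp
  then have eq: "P (B e) e = Some (s' u)" if "u \<in> {t..e}" for u
    using e(7) s'(1) [of u] that by (cases "u = t") auto
  have blk: "blocks P B n s' e"
    by (rule blocks_cong [OF e(3)]) (use e(2) s'(1) in \<open>metis not_less\<close>)
  show ?thesis
  proof (cases "t - 1 < j'")
    case True
    then have "t = B e" using e(4,6) by simp
    then have "blocks P B n s' (t - 1)"
      using blocks_step [OF blk p(1,2)] eq by simp
    then show ?thesis using True by (simp add: traced_def)
  next
    case False
    have "\<forall>u\<in>{t - 1 + 1..e}. P (B e) e = Some (s' u)" using eq t by simp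
    moreover have "t - 1 \<le> e" using e(2) by simp
    ultimately have "\<exists>e\<in>{1..n}. t - 1 \<le> e \<and> blocks P B n s' e \<and> j' = B e \<and>
        q' = pair_index n (B e) e \<and> (\<forall>u\<in>{t - 1 + 1..e}. P (B e) e = Some (s' u))"
      using e(1,4,5) blk by blast
    then show ?thesis using False unfolding traced_def by (simp only: if_False)
  qed
qed

lemma runs_trace:
  assumes T: "nreg s ''T'' = horizon I" and same: "narr s ''S_arc'' = narr s ''P_arc''"
    and tab: "dp_table I (output_interval_path I s) (horizon I) F (narr s ''B'')"
    and X: "\<forall>t\<in>{1..horizon I}. narr s ''X'' t = pair_index (horizon I) (narr s ''B'' t) t"
  shows "runs trace s (50 * horizon I + 20) (\<lambda>s'.
    output_interval_path I s' = output_interval_path I s \<and>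
    blocks (output_interval_path I s) (narr s ''B'') (horizon I) (output_sequence s') 0)"
proof -
  let ?T = "horizon I" and ?P = "output_interval_path I s" and ?B = "narr s ''B''"
  let ?b = "NLess (NNum 0) (NReg ''t'')"
  let ?same = "\<lambda>(s' :: state). unchanged {''t'', ''j'', ''q'', ''S_origin'', ''S_start'', ''S_length''} s s'"
  let ?Inv = "\<lambda>n (s' :: state). n = nreg s' ''t'' \<and> n \<le> ?T \<and> ?same s' \<and>
    traced ?P ?B ?T (output_sequence s') (nreg s' ''t'') (nreg s' ''j'') (nreg s' ''q'')"
  let ?c = "block [SetNReg ''t'' (NReg ''T''), SetNReg ''j'' (NAdd (NReg ''T'') (NNum 1))]"
  have "runs trace s (6 + (50 * ?T + 4)) (?Inv 0)"
    unfolding trace_def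
  proof (rule runs_Seq)
    have "?same (effect ?c s)" by (simp add: unchanged_def)
    then have "?Inv ?T (effect ?c s)" using T by (simp add: traced_def blocks_end)
    then show "runs ?c s 6 (?Inv ?T)" by (rule runs_effect [rotated 2]) simp_all
  next
    fix s1 assume s1: "?Inv ?T s1"
    show "runs (While ?b trace_step) s1 (50 * ?T + 4) (?Inv 0)"
    proof (rule runs_While_count [where Inv = ?Inv and l = 40])
      show "?Inv ?T s1" by (rule s1)
    next
      fix n s' assume inv: "?Inv n s'" and b: "bval ?b s'"
      define t j q where "t = nreg s' ''t''" and "j = nreg s' ''j''" and "q = nreg s' ''q''"
      have t: "t \<in> {1..?T}" "n = Suc (t - 1)" using inv b by (auto simp: t_def)
      have fr: "narr s' ''B'' = ?B" "narr s' ''X'' = narr s ''X''" "narr s' ''S_arc'' = narr s ''P_arc''"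
        "narr s' ''P_origin'' = narr s ''P_origin''" "narr s' ''P_start'' = narr s ''P_start''"
        "narr s' ''P_length'' = narr s ''P_length''"
        using inv same by (simp_all add: unchanged_def)
      define j' q' where "j' = (if t < j then ?B t else j)"
        and "q' = (if t < j then pair_index ?T (?B t) t else q)"
      let ?s = "effect trace_step s'"
      have eff: "?s = s'\<lparr>nreg := (nreg s')(''j'' := j', ''q'' := q', ''t'' := t - 1),
          narr := (narr s')(''S_origin'' := (narr s' ''S_origin'')(t := narr s ''P_origin'' q'),
            ''S_start'' := (narr s' ''S_start'')(t := narr s ''P_start'' q'),
            ''S_length'' := (narr s' ''S_length'')(t := narr s ''P_length'' q'))\<rparr>"
      proof -
        have "narr s ''X'' t = pair_index ?T (?B t) t" using X t(1) by blast
        then show ?thesis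
          by (simp add: trace_step_def fr t_def j_def q_def j'_def q'_def fun_upd_twist fun_upd_idem)
      qed
      have "traced ?P ?B ?T (output_sequence ?s) (t - 1) j' q'"
      proof (rule traced_step [OF tab _ t(1) j'_def q'_def])
        show "traced ?P ?B ?T (output_sequence s') t j q" using inv by (simp add: t_def j_def q_def)
      next
        fix u assume "u \<noteq> t"
        then show "output_sequence ?s u = output_sequence s' u"
          unfolding output_sequence_def Let_def eff by simp
      next
        fix x y assume xy: "?P x y \<noteq> None" "q' = pair_index ?T x y"
        then show "?P x y = Some (output_sequence ?s t)"
          unfolding output_sequence_def output_interval_path_def Let_def pair_index_def [symmetric] eff
          by (simp add: fr split: if_splits)
      qed
      moreover have "?same ?s" using inv unfolding eff by (simp add: unchanged_def)
      moreover have "t - 1 \<le> ?T" using t(1) by auto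
      moreover have "nreg ?s ''t'' = t - 1" "nreg ?s ''j'' = j'" "nreg ?s ''q'' = q'"
        by (simp_all add: eff)
      ultimately have "?Inv (t - 1) ?s" by (simp only: simp_thms)
      then have "runs trace_step s' 40 (?Inv (t - 1))"
        by (rule runs_effect [rotated 2]) (simp_all add: trace_step_def)
      then show "\<exists>m. n = Suc m \<and> runs trace_step s' 40 (?Inv m)" using t(2) by blast
    next
      fix n s' assume "?Inv n s'" and b: "\<not> bval ?b s'"
      then show "?Inv 0 s'" by simp
    qed simp
  qed
  then show ?thesis
  proof (rule runs_mono)
    fix s' assume inv: "?Inv 0 s'"
    have t: "nreg s' ''t'' = 0" using inv by simp
    have tr: "traced ?P ?B ?T (output_sequence s') (nreg s' ''t'') (nreg s' ''j'') (nreg s' ''q'')"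
      using inv by blast
    have "output_interval_path I s' = ?P"
      by (rule output_interval_path_cong) (use inv in \<open>simp_all add: unchanged_def\<close>)
    moreover have "blocks ?P ?B ?T (output_sequence s') 0"
    proof (cases "0 < nreg s' ''j''")
      case True
      then show ?thesis using tr unfolding traced_def t by simp
    next
      case False
      then obtain e where "e \<in> {1..?T}" "?B e = 0" using tr unfolding traced_def t by auto
      then show ?thesis using dp_table_choice [OF tab, of e] by (metis not_one_le_zero)
    qed
    ultimately show "output_interval_path I s' = ?P \<and> blocks ?P ?B ?T (output_sequence s') 0" by blast
  qed simp
qed

text \<open>
  At every time step some path is valid, so the interval consisting of this step alone provides an
  entry.
\<close>

lemma partial_table_complete:
  assumes I: "pricing_problem I" and P: "interval_paths I P"
    and tab: "partial_table I (handled I (horizon I + 1) (horizon I + 1)) P F B"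
  shows "dp_table I P (horizon I) F B" and "\<forall>t\<in>{1..horizon I}. B t \<noteq> 0"
proof -
  let ?H = "handled I (horizon I + 1) (horizon I + 1)"
  have H: "(x, t) \<in> ?H \<longleftrightarrow> 1 \<le> x \<and> x \<le> t \<and> t \<le> horizon I" for x t
    by (auto simp: handled_def)
  show B: "\<forall>t\<in>{1..horizon I}. B t \<noteq> 0"
  proof
    fix t assume t: "t \<in> {1..horizon I}"
    then have "(t, t) \<in> ?H" unfolding H by simp
    moreover obtain p where "P t t = Some p" using interval_paths_singleton [OF I P t] by blast
    ultimately show "B t \<noteq> 0" using tab t unfolding partial_table_def
      by (metis option.distinct(1))
  qed
  show "dp_table I P (horizon I) F B"
    unfolding dp_table_def
  proof (intro conjI ballI)
    show "F 0 = 0" using tab by (simp only: partial_table_def)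
  next
    fix t assume t: "t \<in> {1..horizon I}"
    have "(B t, t) \<in> ?H \<and> (\<exists>p. P (B t) t = Some p \<and>
        F t = F (B t - 1) + penalty I + interval_cost I (B t) t p)"
      using tab t B unfolding partial_table_def by blast
    then show "\<exists>p. 1 \<le> B t \<and> B t \<le> t \<and> P (B t) t = Some p \<and>
        F t = F (B t - 1) + penalty I + interval_cost I (B t) t p"
      unfolding H by blast
    have "\<forall>x p. (x, t) \<in> ?H \<longrightarrow> P x t = Some p \<longrightarrow>
        F t \<le> F (x - 1) + penalty I + interval_cost I x t p"
      using tab t unfolding partial_table_def by blast
    then show "\<forall>a p. 1 \<le> a \<and> a \<le> t \<and> P a t = Some p \<longrightarrow>
        F t \<le> F (a - 1) + penalty I + interval_cost I a t p"
      using t unfolding H by simp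
  qed
qed

section \<open>The program and its running time\<close>

lemma array_of_concat:
  assumes "t \<in> {1..T}" "k < length (f t)"
  shows "array_of (concat (map f [1..<T + 1])) ((\<Sum>i = 1..<t. length (f i)) + k) = f t ! k"
proof -
  have "[1..<T + 1] = [1..<t] @ [t..<T + 1]"
    using assms(1) upt_add_eq_append [of 1 t "T + 1 - t"] by auto
  also have "[t..<T + 1] = t # [t + 1..<T + 1]"
    using assms(1) by (subst upt_conv_Cons) auto
  finally have "concat (map f [1..<T + 1]) =
      concat (map f [1..<t]) @ f t @ concat (map f [t + 1..<T + 1])" by simp
  moreover have "length (concat (map f [1..<t])) = (\<Sum>i = 1..<t. length (f i))"
    by (simp add: length_concat comp_def interv_sum_list_conv_sum_set_nat)
  ultimately show ?thesis using assms(2) by (simp add: array_of_def nth_append)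
qed

lemma input_ok_initial:
  assumes "encoding I es"
  shows "input_ok I es (initial_state I es)"
proof -
  have arcs: "a < card (arcs (graph I))" if "a \<in> arcs (graph I)" for a
    using assms that unfolding encoding_def by blast
  have dual: "array_of (concat (map (\<lambda>t. map (\<lambda>e. dual I e t) (es t)) [1..<horizon I + 1]))
      ((\<Sum>i = 1..<t. length (es i)) + k) = dual I (es t ! k) t"
    if "t \<in> {1..horizon I}" "k < length (es t)" for t k
    using array_of_concat [of t "horizon I" k "\<lambda>t. map (\<lambda>e. dual I e t) (es t)"] that by simp
  show ?thesis
    unfolding input_ok_def
  proof (intro conjI ballI allI impI)
    fix t assume t: "t \<in> {1..horizon I}"
    let ?s = "initial_state I es"
    have first: "narr ?s ''first'' t = (\<Sum>i = 1..<t. length (es i))"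
      using t by (simp add: initial_state_def Let_def)
    show "narr ?s ''first'' (t + 1) = narr ?s ''first'' t + length (es t)"
      using t by (simp add: initial_state_def Let_def)
    show "narr ?s ''arc'' (narr ?s ''first'' t + k) = es t ! k" if "k < length (es t)" for k
      using array_of_concat [of t "horizon I" k es] t that unfolding first by (simp add: initial_state_def Let_def)
    show "rarr ?s ''dual'' (narr ?s ''first'' t + k) = dual I (es t ! k) t" if "k < length (es t)" for k
      using dual [OF t that] unfolding first by (simp add: initial_state_def Let_def)
  qed (auto simp: initial_state_def Let_def array_of_def arcs)
qed

definition solved :: "(nat, nat) pricing \<Rightarrow> state \<Rightarrow> bool" where
  "solved I s \<longleftrightarrow> interval_paths I (output_interval_path I s) \<and>
     optimal_sequence I (output_sequence s) \<and>
     (\<forall>t\<in>{1..horizon I}. output_sequence s t \<in> candidate_paths I (output_interval_path I s) t)"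

definition solve :: com where
  "solve = Seq parents (Seq (SetNReg ''t1'' (NNum 1))
     (Seq (While (NLess (NReg ''t1'') (NAdd (NReg ''T'') (NNum 1))) handle_row) trace))"

lemma runs_solve:
  assumes I: "pricing_problem I" and enc: "encoding I es"
  shows "runs solve (initial_state I es)
    (2 * (horizon I * horizon I * pair_time (card (verts (graph I))) (max_arcs I)))
    (solved I)"
proof -
  let ?T = "horizon I"
  define N E where "N = card (verts (graph I))" and "E = max_arcs I"
  let ?K = "pair_time N E" and ?s = "initial_state I es"
  have V: "verts (graph I) = {..<N}" using enc by (simp add: encoding_def N_def)
  have T: "1 \<le> ?T" using I by (simp add: pricing_problem_def)
  then have "origin I 1 \<in> verts (graph I)" using I unfolding pricing_problem_def by auto
  then have N0: "1 \<le> N" using V by auto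
  have es: "distinct (es t) \<and> set (es t) = allowed I t \<and> length (es t) \<le> E"
    if t: "t \<in> {1..?T}" for t
  proof -
    have d: "distinct (es t)" "set (es t) = allowed I t" using enc t by (auto simp: encoding_def)
    then have "length (es t) = card (allowed I t)" using distinct_card by metis
    also have "\<dots> \<le> E" unfolding E_def max_arcs_def using t by (intro Max_ge) auto
    finally show ?thesis using d by blast
  qed
  let ?b = "NLess (NReg ''t1'') (NAdd (NReg ''T'') (NNum 1))"
  let ?c = "SetNReg ''t1'' (NNum 1)"
  let ?row = "?T * (?K + 6) + 20"
  have "runs solve ?s ((60 * N + 20) + (2 + ((?T * (?row + 6) + 6) + (50 * ?T + 20)))) (solved I)"
    unfolding solve_def
  proof (rule runs_Seq)
    show "runs parents ?s (60 * N + 20) (\<lambda>s'. (\<forall>j\<in>{1..<2 * N}. narr s' ''parent'' j = j div 2) \<and>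
        unchanged (writes parents) ?s s')"
      by (rule runs_frame, rule runs_parents)
        (use N0 in \<open>simp_all add: initial_state_def Let_def N_def fun_eq_iff\<close>)
  next
    fix s1 assume s1: "(\<forall>j\<in>{1..<2 * N}. narr s1 ''parent'' j = j div 2) \<and>
        unchanged (writes parents) ?s s1"
    show "runs (Seq ?c (Seq (While ?b handle_row) trace)) s1
        (2 + ((?T * (?row + 6) + 6) + (50 * ?T + 20))) (solved I)"
    proof (rule runs_Seq)
      have inp: "input_ok I es s1"
        by (rule input_ok_unchanged [OF input_ok_initial [OF enc], of "writes parents"])
          (use s1 in \<open>auto simp: writes_parents\<close>)
      have fr: "narr s1 ''S_arc'' = (\<lambda>_. 0)" "narr s1 ''P_arc'' = (\<lambda>_. 0)" "rarr s1 ''F'' = (\<lambda>_. 0)"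
        "narr s1 ''B'' = (\<lambda>_. 0)" "narr s1 ''alive'' = (\<lambda>_. 0)" "nreg s1 ''p'' = 0"
        using s1 by (simp_all add: unchanged_def writes_parents initial_state_def Let_def)
      have h: "handled I 1 1 = {}" by (auto simp: handled_def)
      have u: "unchanged (writes ?c) s1 (effect ?c s1)" by (simp add: unchanged_def)
      have "input_ok I es (effect ?c s1)" by (rule input_ok_unchanged [OF inp u]) simp
      moreover have "results_ok I (handled I 1 1) s1"
        unfolding results_ok_def h by (simp add: fr partial_table_def)
      then have "results_ok I (handled I 1 1) (effect ?c s1)"
        by (rule results_ok_unchanged [OF _ u]) simp
      ultimately have "row_inv I es 1 (effect ?c s1)"
        unfolding row_inv_def using s1 by (simp add: fr pair_index_def N_def)
      then show "runs ?c s1 2 (row_inv I es 1)" by (rule runs_effect [rotated 2]) simp_all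
    next
      fix s2 assume s2: "row_inv I es 1 s2"
      show "runs (Seq (While ?b handle_row) trace) s2 ((?T * (?row + 6) + 6) + (50 * ?T + 20)) (solved I)"
      proof (rule runs_Seq)
        let ?Inv = "\<lambda>n s'. \<exists>a. 1 \<le> a \<and> a \<le> ?T + 1 \<and> n = ?T + 1 - a \<and> row_inv I es a s'"
        show "runs (While ?b handle_row) s2 (?T * (?row + 6) + 6) (row_inv I es (?T + 1))"
        proof (rule runs_While_count [where Inv = ?Inv and l = ?row])
          show "?Inv ?T s2" using s2 by (intro exI [of _ 1]) simp
        next
          fix n s' assume "?Inv n s'" and bv: "bval ?b s'"
          then obtain a where a: "1 \<le> a" "a \<le> ?T + 1" "n = ?T + 1 - a" "row_inv I es a s'" by blast
          have aT: "a \<le> ?T" using bv a(4) by (simp add: row_inv_def input_ok_def)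
          have "runs handle_row s' ?row (row_inv I es (a + 1))"
            by (rule runs_handle_row [OF I V es a(1) aT a(4)])
          then have "runs handle_row s' ?row (?Inv (?T - a))"
            by (rule runs_mono) (use a aT in \<open>auto intro!: exI [of _ "a + 1"]\<close>)
          then show "\<exists>m. n = Suc m \<and> runs handle_row s' ?row (?Inv m)"
            using a(3) aT by (intro exI [of _ "?T - a"]) simp
        next
          show "?T * (1 + bcost ?b + ?row) + 1 + bcost ?b \<le> ?T * (?row + 6) + 6"
            by (simp add: algebra_simps)
        next
          fix n s' assume "?Inv n s'" and bv: "\<not> bval ?b s'"
          then obtain a where a: "a \<le> ?T + 1" "row_inv I es a s'" by blast
          then have "a = ?T + 1" using bv by (simp add: row_inv_def input_ok_def)
          then show "row_inv I es (?T + 1) s'" using a by simp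
        qed
      next
        fix s3 assume s3: "row_inv I es (?T + 1) s3"
        let ?P = "output_interval_path I s3" and ?H = "handled I (?T + 1) (?T + 1)"
        have res: "results_ok I ?H s3" and TT: "nreg s3 ''T'' = ?T"
          using s3 by (simp_all add: row_inv_def input_ok_def)
        have P: "interval_paths I ?P"
          unfolding interval_paths_def
        proof (intro allI impI)
          fix x y assume "1 \<le> x \<and> x \<le> y \<and> y \<le> ?T"
          then have "(x, y) \<in> ?H" by (simp add: handled_def)
          then show "case ?P x y of None \<Rightarrow> \<not> (\<exists>p. valid_path_on I x y p)
              | Some p \<Rightarrow> lowest_cost_path I x y p"
            using res unfolding results_ok_def by blast
        qed
        have "partial_table I ?H ?P (rarr s3 ''F'') (narr s3 ''B'')"
          using res unfolding results_ok_def by blast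
        note tab = partial_table_complete [OF I P this]
        have X: "\<forall>t\<in>{1..?T}. narr s3 ''X'' t = pair_index ?T (narr s3 ''B'' t) t"
          and same: "narr s3 ''S_arc'' = narr s3 ''P_arc''"
          using res tab(2) unfolding results_ok_def by blast+
        show "runs trace s3 (50 * ?T + 20) (solved I)"
        proof (rule runs_mono [OF runs_trace [OF TT same tab(1) X]])
          fix s' assume *: "output_interval_path I s' = ?P \<and>
            blocks ?P (narr s3 ''B'') ?T (output_sequence s') 0"
          then show "solved I s'"
            using blocks_optimal [OF I tab(1) P, of "output_sequence s'"] P by (simp add: solved_def)
        qed simp
      qed
    qed
  qed
  then show ?thesis
    unfolding N_def [symmetric] E_def [symmetric]
  proof (rule runs_mono)
    have "1000 * N \<le> 1000 * (floor_log N + 1) * (N + E)"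
      by (rule mult_le_mono) simp_all
    then have K: "1000 * N \<le> ?K" by (simp add: pair_time_def)
    have TT: "?T \<le> ?T * ?T" "1 \<le> ?T * ?T" using T by simp_all
    then have NT: "N \<le> ?T * ?T * N" by simp
    have "?T * ?T * (1000 * N) \<le> ?T * ?T * ?K" using K by (rule mult_left_mono) simp
    then have "1000 * (?T * ?T * N) \<le> ?T * ?T * ?K" by (simp add: ac_simps)
    moreover have "?T * ?T \<le> ?T * ?T * N" using N0 by simp
    moreover have "60 * N + 20 + (2 + (?T * (?row + 6) + 6 + (50 * ?T + 20)))
        = ?T * ?T * ?K + 6 * (?T * ?T) + 76 * ?T + 60 * N + 48"
      by (simp add: algebra_simps)
    ultimately show "60 * N + 20 + (2 + (?T * (?row + 6) + 6 + (50 * ?T + 20))) \<le> 2 * (?T * ?T * ?K)"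
      using TT NT by linarith
  qed simp
qed

text \<open>
  By \<open>N \<le> c E\<close>, the logarithm of \<open>N\<close> is at most that of \<open>E\<close> plus a constant, and \<open>ln E \<ge> ln 2\<close> absorbs
  the constant.
\<close>

lemma pair_time_bound:
  fixes c :: real
  assumes "2 \<le> E" "real N \<le> c * real E" "1 \<le> N"
  shows "real (pair_time N E) \<le>
    1000 * ((\<bar>ln c\<bar> / ln 2 + 2) / ln 2) * (c + 1) * (real E * ln (real E))"
proof -
  have "0 < c * real E" using assms by linarith
  then have c: "0 < c" using assms(1) by (simp add: zero_less_mult_iff)
  have l2: "0 < ln (2 :: real)" by simp
  have lE: "ln 2 \<le> ln (real E)" using assms(1) by simp
  have "2 ^ floor_log N \<le> N" using floor_log_exp2_le [of N] assms(3) by simp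
  then have "2 ^ floor_log N \<le> real N" by (metis of_nat_le_iff of_nat_numeral of_nat_power)
  then have "2 ^ floor_log N \<le> c * real E" using assms(2) by linarith
  then have "ln (2 ^ floor_log N) \<le> ln (c * real E)"
    using c assms(1) by (subst ln_le_cancel_iff) auto
  then have "real (floor_log N) * ln 2 \<le> ln c + ln (real E)"
    using c assms(1) by (simp add: ln_realpow ln_mult)
  also have "\<dots> \<le> \<bar>ln c\<bar> * (ln (real E) / ln 2) + ln (real E)"
  proof -
    have "1 \<le> ln (real E) / ln 2" using lE l2 by simp
    then have "\<bar>ln c\<bar> * 1 \<le> \<bar>ln c\<bar> * (ln (real E) / ln 2)" by (rule mult_left_mono) simp
    then show ?thesis by linarith
  qed
  finally have "(real (floor_log N) + 1) * ln 2 \<le> (\<bar>ln c\<bar> / ln 2 + 2) * ln (real E)"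
    using lE by (simp add: algebra_simps)
  then have L: "real (floor_log N) + 1 \<le> (\<bar>ln c\<bar> / ln 2 + 2) / ln 2 * ln (real E)"
    using l2 by (simp add: field_simps)
  have "real N + real E \<le> (c + 1) * real E" using assms(2) by (simp add: algebra_simps)
  then have "(real (floor_log N) + 1) * (real N + real E) \<le>
      ((\<bar>ln c\<bar> / ln 2 + 2) / ln 2 * ln (real E)) * ((c + 1) * real E)"
    using L by (intro mult_mono) (auto intro: order_trans [OF _ L])
  then have "1000 * ((real (floor_log N) + 1) * (real N + real E)) \<le>
      1000 * (((\<bar>ln c\<bar> / ln 2 + 2) / ln 2 * ln (real E)) * ((c + 1) * real E))" by simp
  moreover have "real (pair_time N E) = 1000 * ((real (floor_log N) + 1) * (real N + real E))"
    by (simp add: pair_time_def algebra_simps)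
  moreover have "1000 * (((\<bar>ln c\<bar> / ln 2 + 2) / ln 2 * ln (real E)) * ((c + 1) * real E)) =
      1000 * ((\<bar>ln c\<bar> / ln 2 + 2) / ln 2) * (c + 1) * (real E * ln (real E))"
    by (simp only: ac_simps)
  ultimately show ?thesis by (simp only:)
qed

lemma computable_in_time_mono:
  assumes "computable_in_time f R"
    and "\<And>x y. f x y \<le> g x y" and "\<And>x y. 1 \<le> x \<Longrightarrow> 2 \<le> y \<Longrightarrow> 0 \<le> f x y"
    and "\<And>I s. R I s \<Longrightarrow> R' I s"
  shows "computable_in_time g R'"
proof -
  let ?instance = "\<lambda>c I es. pricing_problem I \<and> encoding I es \<and>
    2 \<le> max_arcs I \<and> real (card (verts (graph I))) \<le> c * real (max_arcs I)"
  let ?solves = "\<lambda>prog C f R I es. \<exists>n s. exec prog (initial_state I es) n s \<and>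
    real n \<le> C * f (real (horizon I)) (real (max_arcs I)) \<and> R I s"
  obtain prog where prog: "\<forall>c::real. \<exists>C::real. \<forall>I es. ?instance c I es \<longrightarrow> ?solves prog C f R I es"
    using assms(1) unfolding computable_in_time_def by blast
  show ?thesis
    unfolding computable_in_time_def
  proof (rule exI [of _ prog], rule allI)
    fix c :: real
    obtain C where C: "\<forall>I es. ?instance c I es \<longrightarrow> ?solves prog C f R I es"
      using prog by blast
    \<comment> \<open>The given constant may be negative, and then a larger bound need not hold with it.\<close>
    show "\<exists>C::real. \<forall>I es. ?instance c I es \<longrightarrow> ?solves prog C g R' I es"
    proof (intro exI [of _ "\<bar>C\<bar>"] allI impI)
      fix I es assume *: "?instance c I es"
      let ?x = "real (horizon I)" and ?y = "real (max_arcs I)"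
      obtain n s where n: "exec prog (initial_state I es) n s" "real n \<le> C * f ?x ?y" "R I s"
        using C * by blast
      have "0 \<le> f ?x ?y" using * by (intro assms(3)) (auto simp: pricing_problem_def)
      then have "C * f ?x ?y \<le> \<bar>C\<bar> * f ?x ?y" by (intro mult_right_mono) auto
      also have "\<dots> \<le> \<bar>C\<bar> * g ?x ?y" using assms(2) by (intro mult_left_mono) auto
      finally have "real n \<le> \<bar>C\<bar> * g ?x ?y" using n(2) by linarith
      then show "?solves prog \<bar>C\<bar> g R' I es"
        using n(1,3) assms(4) by blast
    qed
  qed
qed

lemma solve_in_time: "computable_in_time (\<lambda>T E. T ^ 2 * E * ln E) solved"
  unfolding computable_in_time_def
proof (rule exI [of _ solve], rule allI)
  fix c :: real
  let ?C = "2 * (1000 * ((\<bar>ln c\<bar> / ln 2 + 2) / ln 2) * (c + 1))"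
  show "\<exists>C::real. \<forall>I es.
        pricing_problem I \<and> encoding I es \<and>
        2 \<le> max_arcs I \<and> real (card (verts (graph I))) \<le> c * real (max_arcs I) \<longrightarrow>
        (\<exists>n s. exec solve (initial_state I es) n s \<and>
           real n \<le> C * ((real (horizon I))\<^sup>2 * real (max_arcs I) * ln (real (max_arcs I))) \<and> solved I s)"
  proof (intro exI [of _ ?C] allI impI)
    fix I es assume *: "pricing_problem I \<and> encoding I es \<and>
        2 \<le> max_arcs I \<and> real (card (verts (graph I))) \<le> c * real (max_arcs I)"
    let ?N = "card (verts (graph I))" and ?E = "max_arcs I" and ?T = "horizon I"
    obtain n s where n: "exec solve (initial_state I es) n s"
        "n \<le> 2 * (?T * ?T * pair_time ?N ?E)" "solved I s"
      using runs_solve [of I es] * unfolding runs_def by blast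
    have "1 \<in> {1..?T}" using * by (simp add: pricing_problem_def)
    then have "origin I 1 \<in> verts (graph I)" "finite (verts (graph I))"
      using * unfolding pricing_problem_def by (blast, simp add: fin_digraph.finite_verts)
    then have N: "1 \<le> ?N" by (simp add: Suc_le_eq card_gt_0_iff) blast
    have "real n \<le> real (2 * (?T * ?T * pair_time ?N ?E))" using n(2) by (rule of_nat_mono)
    also have "\<dots> = 2 * (real ?T)\<^sup>2 * real (pair_time ?N ?E)" by (simp add: power2_eq_square)
    also have "\<dots> \<le> 2 * (real ?T)\<^sup>2 *
        (1000 * ((\<bar>ln c\<bar> / ln 2 + 2) / ln 2) * (c + 1) * (real ?E * ln (real ?E)))"
      using pair_time_bound [of ?E ?N c] * N by (intro mult_left_mono) auto
    also have "\<dots> = ?C * ((real ?T)\<^sup>2 * real ?E * ln (real ?E))" by simp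
    finally show "\<exists>n s. exec solve (initial_state I es) n s \<and>
        real n \<le> ?C * ((real ?T)\<^sup>2 * real ?E * ln (real ?E)) \<and> solved I s"
      using n(1,3) by blast
  qed
qed

theorem mainTheorem2:
  shows
    "(\<forall>(I :: ('v, 'a) pricing) P.
        pricing_problem I \<and> interval_paths I P \<longrightarrow>
        (\<exists>s. optimal_sequence I s \<and> (\<forall>t\<in>{1..horizon I}. s t \<in> candidate_paths I P t)))
     \<and>
     computable_in_time (\<lambda>T E. T ^ 2 * E * ln E)
       (\<lambda>I s. interval_paths I (output_interval_path I s))
     \<and>
     computable_in_time (\<lambda>T E. max (T ^ 3) (T ^ 2 * E * ln E))
       (\<lambda>I s. interval_paths I (output_interval_path I s) \<and>
          optimal_sequence I (output_sequence s) \<and>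
          (\<forall>t\<in>{1..horizon I}.
             output_sequence s t \<in> candidate_paths I (output_interval_path I s) t))"
proof (intro conjI allI impI)
  fix I :: "('v, 'a) pricing" and P
  assume "pricing_problem I \<and> interval_paths I P"
  then show "\<exists>s. optimal_sequence I s \<and> (\<forall>t\<in>{1..horizon I}. s t \<in> candidate_paths I P t)"
    using optimal_sequence_of_candidates by blast
next
  show "computable_in_time (\<lambda>T E. T ^ 2 * E * ln E)
       (\<lambda>I s. interval_paths I (output_interval_path I s))"
    by (rule computable_in_time_mono [OF solve_in_time]) (auto simp: solved_def)
next
  show "computable_in_time (\<lambda>T E. max (T ^ 3) (T ^ 2 * E * ln E))
       (\<lambda>I s. interval_paths I (output_interval_path I s) \<and>
          optimal_sequence I (output_sequence s) \<and>
          (\<forall>t\<in>{1..horizon I}.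
             output_sequence s t \<in> candidate_paths I (output_interval_path I s) t))"
    by (rule computable_in_time_mono [OF solve_in_time]) (auto simp: solved_def)
qed

end
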